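(* Let $u\in H$ and $j\in\mathbb N$. The following are equivalent: (i) $u\in D(A^j)$; (ii) the function $\lambda\mapsto\lambda^j(\tilde Vu)(\lambda)$ belongs to $L^2_q$; (iii) for every $k=1,\dots,n$, the function $\lambda\mapsto\lambda^j(\tilde Vu)_k(\lambda)$ belongs to $L^2((a_k,+\infty),q_k\,d\lambda)$.
   Context: Fix an integer $n\ge 2$, constants $c_1,\dots,c_n>0$ and $0\le a_1\le\dots\le a_n<\infty$. Let $N_1,\dots,N_n$ be $n$ disjoint copies of $(0,\infty)$ and $N$ the star-shaped network obtained from $\overline{N_1},\dots,\overline{N_n}$ by identifying their endpoints $0$; functions on $N$ are $n$-tuples of functions on the $N_k$, $\int_N g\,dx:=\sum_k\int_{N_k}g_k\,dx$. $H=L^2(N)=\prod_kL^2(N_k)$. $A$: $D(A)=\{u\in\prod_kH^2(N_k): u_i(0)=u_k(0)\ \forall i,k,\ \sum_kc_ku_k'(0^+)=0\}$, $Au=(-c_ku_k''+a_ku_k)_k$ (self-adjoint); $D(A^j)$ is the domain of its $j$-th power. Complex square root: $\sqrt{re^{i\phi}}=\sqrt re^{i\phi/2}$, $r\ge0$, $\phi\in[-\pi,\pi)$. For $\lambda\in\mathbb C$: $\xi_k(\lambda)=\sqrt{(\lambda-a_k)/c_k}$, $s_k(\lambda)=-\sum_{l\ne k}c_l\xi_l(\lambda)/(c_k\xi_k(\lambda))$. $F^{-,j}_\lambda:N\to\mathbb C$ is given for $x\in\overline{N_k}$ by $F^{-,j}_\lambda(x)=\cos(\xi_j(\lambda)x)-is_j(\lambda)\sin(\xi_j(\lambda)x)$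 if $k=j$ and $\exp(-i\xi_k(\lambda)x)$ if $k\ne j$. For real $\lambda$, $w(\lambda):=-i\sum_jc_j\xi_j(\lambda)$, $q_l(\lambda)=0$ if $\lambda<a_l$ and $q_l(\lambda)=c_l\xi_l(\lambda)/(\pi|w(\lambda)|^2)$ if $\lambda>a_l$. $L^2_q:=\prod_kL^2((a_k,\infty),q_k\,d\lambda)$. For $f\in L^1(N)$, $(Vf)_k(\lambda)=\int_Nf\,\overline{F^{-,k}_\lambda}\,dx$ ($\lambda\ge a_k$); $\tilde V:H\to L^2_q$ is the unique isometric extension of $V$ from $\prod_kC_c^\infty(N_k)$ equipped with the $H$-norm. *)

theory Defs
  imports "HOL-Analysis.Analysis"
begin

text \<open>Edges N_1..N_n are indexed by k in {1..n}; a function on N is a map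
  nat => real => complex, whose k-th component lives on (0,oo).\<close>

definition argm :: "complex \<Rightarrow> real" where
  "argm z = (if Arg z = pi then - pi else Arg z)"

definition psqrt :: "complex \<Rightarrow> complex" where
  "psqrt z = complex_of_real (sqrt (cmod z)) * cis (argm z / 2)"

definition L2 :: "'a measure \<Rightarrow> ('a \<Rightarrow> complex) \<Rightarrow> bool" where
  "L2 M f \<longleftrightarrow> f \<in> borel_measurable M \<and> integrable M (\<lambda>x. (cmod (f x))^2)"

definition inH :: "nat \<Rightarrow> (nat \<Rightarrow> real \<Rightarrow> complex) \<Rightarrow> bool" where
  "inH n u \<longleftrightarrow> (\<forall>k\<in>{1..n}. L2 (lebesgue_on {0<..}) (u k))"

definition Hdist2 :: "nat \<Rightarrow> (nat \<Rightarrow> real \<Rightarrow> complex) \<Rightarrow> (nat \<Rightarrow> real \<Rightarrow> complex) \<Rightarrow> ennreal" where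
  "Hdist2 n f g = (\<Sum>k\<in>{1..n}. \<integral>\<^sup>+ x. ennreal ((cmod (f k x - g k x))^2) \<partial>(lebesgue_on {0<..}))"

definition test_fun :: "(real \<Rightarrow> complex) \<Rightarrow> bool" where
  "test_fun \<phi> \<longleftrightarrow>
     (\<exists>D :: nat \<Rightarrow> real \<Rightarrow> complex. D 0 = \<phi> \<and>
        (\<forall>m x. (D m has_vector_derivative D (Suc m) x) (at x))) \<and>
     (\<exists>s t. 0 < s \<and> s \<le> t \<and> (\<forall>x. x \<notin> {s..t} \<longrightarrow> \<phi> x = 0))"

definition weak_deriv :: "(real \<Rightarrow> complex) \<Rightarrow> (real \<Rightarrow> complex) \<Rightarrow> bool" where
  "weak_deriv f g \<longleftrightarrow>
     (\<forall>\<phi>. test_fun \<phi> \<longrightarrow>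
        (LINT x|lebesgue_on {0<..}. f x * vector_derivative \<phi> (at x))
          = - (LINT x|lebesgue_on {0<..}. g x * \<phi> x))"

text \<open>A_rel n c a u w: u is in D(A) and w = Au (almost everywhere).
  u_k in H^2 means u_k, u_k', u_k'' in L^2 (weak derivatives g_k, h_k);
  the boundary values u_k(0), u_k'(0+) are the values at 0 of the continuous
  representatives v_k, dv_k (on [0,oo)) of u_k and u_k'.\<close>

definition A_rel :: "nat \<Rightarrow> (nat \<Rightarrow> real) \<Rightarrow> (nat \<Rightarrow> real) \<Rightarrow>
    (nat \<Rightarrow> real \<Rightarrow> complex) \<Rightarrow> (nat \<Rightarrow> real \<Rightarrow> complex) \<Rightarrow> bool" where
  "A_rel n c a u w \<longleftrightarrow>
    (\<exists>g h v dv :: nat \<Rightarrow> real \<Rightarrow> complex.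
      (\<forall>k\<in>{1..n}.
         L2 (lebesgue_on {0<..}) (u k) \<and> L2 (lebesgue_on {0<..}) (g k) \<and>
         L2 (lebesgue_on {0<..}) (h k) \<and>
         weak_deriv (u k) (g k) \<and> weak_deriv (g k) (h k) \<and>
         continuous_on {0..} (v k) \<and> continuous_on {0..} (dv k) \<and>
         (AE x in lebesgue_on {0<..}. v k x = u k x) \<and>
         (AE x in lebesgue_on {0<..}. dv k x = g k x) \<and>
         (AE x in lebesgue_on {0<..}.
             w k x = - complex_of_real (c k) * h k x + complex_of_real (a k) * u k x)) \<and>
      (\<forall>i\<in>{1..n}. \<forall>k\<in>{1..n}. v i 0 = v k 0) \<and>
      (\<Sum>k\<in>{1..n}. complex_of_real (c k) * dv k 0) = 0)"

fun DA :: "nat \<Rightarrow> (nat \<Rightarrow> real) \<Rightarrow> (nat \<Rightarrow> real) \<Rightarrow> nat \<Rightarrow>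
    (nat \<Rightarrow> real \<Rightarrow> complex) \<Rightarrow> bool" where
  "DA n c a 0 u = inH n u"
| "DA n c a (Suc j) u = (\<exists>w. A_rel n c a u w \<and> DA n c a j w)"

definition xi :: "(nat \<Rightarrow> real) \<Rightarrow> (nat \<Rightarrow> real) \<Rightarrow> nat \<Rightarrow> complex \<Rightarrow> complex" where
  "xi c a k lam = psqrt ((lam - complex_of_real (a k)) / complex_of_real (c k))"

definition s_fun :: "nat \<Rightarrow> (nat \<Rightarrow> real) \<Rightarrow> (nat \<Rightarrow> real) \<Rightarrow> nat \<Rightarrow> complex \<Rightarrow> complex" where
  "s_fun n c a k lam =
     - (\<Sum>l\<in>{1..n}-{k}. complex_of_real (c l) * xi c a l lam)
       / (complex_of_real (c k) * xi c a k lam)"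

definition F :: "nat \<Rightarrow> (nat \<Rightarrow> real) \<Rightarrow> (nat \<Rightarrow> real) \<Rightarrow> nat \<Rightarrow> complex \<Rightarrow> nat \<Rightarrow> real \<Rightarrow> complex" where
  "F n c a j lam m x =
     (if m = j then cos (xi c a j lam * complex_of_real x)
                    - \<i> * s_fun n c a j lam * sin (xi c a j lam * complex_of_real x)
      else exp (- \<i> * xi c a m lam * complex_of_real x))"

definition w_fun :: "nat \<Rightarrow> (nat \<Rightarrow> real) \<Rightarrow> (nat \<Rightarrow> real) \<Rightarrow> real \<Rightarrow> complex" where
  "w_fun n c a lam = - \<i> * (\<Sum>j\<in>{1..n}. complex_of_real (c j) * xi c a j (complex_of_real lam))"

definition q :: "nat \<Rightarrow> (nat \<Rightarrow> real) \<Rightarrow> (nat \<Rightarrow> real) \<Rightarrow> nat \<Rightarrow> real \<Rightarrow> real" where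
  "q n c a l lam =
     (if lam > a l then Re (complex_of_real (c l) * xi c a l (complex_of_real lam))
                      / (pi * (cmod (w_fun n c a lam))^2)
      else 0)"

definition qmeasure :: "nat \<Rightarrow> (nat \<Rightarrow> real) \<Rightarrow> (nat \<Rightarrow> real) \<Rightarrow> nat \<Rightarrow> real measure" where
  "qmeasure n c a k = density (lebesgue_on {a k<..}) (\<lambda>lam. ennreal (q n c a k lam))"

definition inL2q :: "nat \<Rightarrow> (nat \<Rightarrow> real) \<Rightarrow> (nat \<Rightarrow> real) \<Rightarrow> (nat \<Rightarrow> real \<Rightarrow> complex) \<Rightarrow> bool" where
  "inL2q n c a \<psi> \<longleftrightarrow> (\<forall>k\<in>{1..n}. L2 (qmeasure n c a k) (\<psi> k))"

definition L2q_dist2 :: "nat \<Rightarrow> (nat \<Rightarrow> real) \<Rightarrow> (nat \<Rightarrow> real) \<Rightarrow>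
    (nat \<Rightarrow> real \<Rightarrow> complex) \<Rightarrow> (nat \<Rightarrow> real \<Rightarrow> complex) \<Rightarrow> ennreal" where
  "L2q_dist2 n c a f g =
     (\<Sum>k\<in>{1..n}. \<integral>\<^sup>+ lam. ennreal ((cmod (f k lam - g k lam))^2) \<partial>(qmeasure n c a k))"

definition V :: "nat \<Rightarrow> (nat \<Rightarrow> real) \<Rightarrow> (nat \<Rightarrow> real) \<Rightarrow>
    (nat \<Rightarrow> real \<Rightarrow> complex) \<Rightarrow> nat \<Rightarrow> real \<Rightarrow> complex" where
  "V n c a f k lam =
     (\<Sum>m\<in>{1..n}. LINT x|lebesgue_on {0<..}.
         f m x * cnj (F n c a k (complex_of_real lam) m x))"

text \<open>is_Vtilde n c a u \<psi>: psi is (a representative of) \<tilde>V u, i.e. the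
  L^2_q-limit of V phi_m for test tuples phi_m converging to u in H.\<close>
definition is_Vtilde :: "nat \<Rightarrow> (nat \<Rightarrow> real) \<Rightarrow> (nat \<Rightarrow> real) \<Rightarrow>
    (nat \<Rightarrow> real \<Rightarrow> complex) \<Rightarrow> (nat \<Rightarrow> real \<Rightarrow> complex) \<Rightarrow> bool" where
  "is_Vtilde n c a u \<psi> \<longleftrightarrow> inL2q n c a \<psi> \<and>
     (\<exists>\<phi> :: nat \<Rightarrow> nat \<Rightarrow> real \<Rightarrow> complex.
        (\<forall>m. \<forall>k\<in>{1..n}. test_fun (\<phi> m k)) \<and>
        (\<lambda>m. Hdist2 n (\<phi> m) u) \<longlonglongrightarrow> 0 \<and>
        (\<lambda>m. L2q_dist2 n c a (V n c a (\<phi> m)) \<psi>) \<longlonglongrightarrow> 0)"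

end

(*
  Everything is tested against the exponentials exp (-kappa x) supported on one edge.
  Their transforms are explicit algebraic functions of lam, and their Gram matrix in L2_q is
  computed by shifting the integral of an algebraic function to the line Im z = -eps
  and closing it in the lower half-plane; hence V is isometric on their span, which is dense in H by the Weierstrass
  theorem in y = exp (-x).  The resolvent (A + t)^(-1) maps an exponential exp (-m x) to a combination
  of exponentials, provided t avoids the countably many resonances c_k m^2 = a_k + t, and
  V turns it into multiplication by 1 / (lam + t).  Membership in D(A) is read off Laplace transforms:
  A u = w holds iff c_k (kappa^2 u^_k - kappa b - d_k) = a_k u^_k - w^_k with a common b and
  sum c_k d_k = 0, which in turn says that the Laplace transforms of u at the integers are those of
  (A + t)^(-1) (w + t u).  So A corresponds to multiplication by lam on the closed range
  of V, and the theorem follows by induction on j.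
*)

theory Submission
  imports Defs "HOL-Complex_Analysis.Complex_Analysis"
begin

section \<open>Square-integrable tuples\<close>

text \<open>Two obstacles shape the argument. A general test function has no transform in closed
  form, so the isometry is computed on exponentials, whose transforms are algebraic in the roots;
  test functions enter afterwards as weighted uniform limits of sums of exponentials. And the range
  of V is known only to be closed: square integrability of lam \<psi> does not yet make it a
  transform. It is reached as the limit, for t to infinity, of (t - t^2 / (lam + t)) \<psi>, the
  transforms of the Yosida approximations t u - t^2 (A + t)^(-1) u; hence the demand for arbitrarily
  large t off the resonances. Since transforms are determined only almost everywhere, the extension
  of V is handled as a closed relation, \<open>graph\<close>. Two families of exponents occur: the
  integers, which suffice for density and for the uniqueness of Laplace transforms, and the positive
  reals, because the resolvent introduces the decay rates sqrt ((a_k + t) / c_k).\<close>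

definition tuple_L2 :: "nat \<Rightarrow> (nat \<Rightarrow> 'a measure) \<Rightarrow> (nat \<Rightarrow> 'a \<Rightarrow> complex) \<Rightarrow> bool" where
  "tuple_L2 n M u \<longleftrightarrow> (\<forall>k\<in>{1..n}. L2 (M k) (u k))"

definition tuple_norm2 :: "nat \<Rightarrow> (nat \<Rightarrow> 'a measure) \<Rightarrow> (nat \<Rightarrow> 'a \<Rightarrow> complex) \<Rightarrow> real" where
  "tuple_norm2 n M u = (\<Sum>k\<in>{1..n}. LINT x|M k. (cmod (u k x))^2)"

definition tuple_inner :: "nat \<Rightarrow> (nat \<Rightarrow> 'a measure) \<Rightarrow> (nat \<Rightarrow> 'a \<Rightarrow> complex) \<Rightarrow> (nat \<Rightarrow> 'a \<Rightarrow> complex) \<Rightarrow> complex" where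
  "tuple_inner n M u v = (\<Sum>k\<in>{1..n}. LINT x|M k. u k x * cnj (v k x))"

lemma L2_measurable [measurable_dest]: "L2 M f \<Longrightarrow> f \<in> borel_measurable M"
  by (simp add: L2_def)

lemma L2_integrable: "L2 M f \<Longrightarrow> integrable M (\<lambda>x. (cmod (f x))^2)"
  by (simp add: L2_def)

lemma L2_zero [simp]: "L2 M (\<lambda>x. 0)"
  by (simp add: L2_def)

lemma L2_bound:
  assumes "f \<in> borel_measurable M" "integrable M h" "\<And>x. x \<in> space M \<Longrightarrow> (cmod (f x))^2 \<le> h x"
  shows "L2 M f"
  unfolding L2_def
proof (intro conjI)
  show "integrable M (\<lambda>x. (cmod (f x))\<^sup>2)"
    by (rule Bochner_Integration.integrable_bound[OF assms(2)])
       (use assms in \<open>auto intro!: AE_I2 measurable_compose[OF assms(1)] order_trans[OF assms(3)]\<close>)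
qed (rule assms)

lemma cmod_add_sq_le: "(cmod (x + y))^2 \<le> 2 * (cmod x)^2 + 2 * (cmod y)^2"
proof -
  have "(cmod (x + y))^2 \<le> (cmod x + cmod y)^2"
    by (intro power_mono norm_triangle_ineq) auto
  also have "\<dots> \<le> 2 * (cmod x)^2 + 2 * (cmod y)^2"
    using sum_squares_bound[of "cmod x" "cmod y"] by (simp add: power2_sum)
  finally show ?thesis .
qed

lemma L2_add [intro]: assumes "L2 M f" "L2 M g" shows "L2 M (\<lambda>x. f x + g x)"
proof (rule L2_bound)
  show "integrable M (\<lambda>x. 2 * (cmod (f x))^2 + 2 * (cmod (g x))^2)"
    using assms by (auto simp: L2_def)
qed (use assms in \<open>auto simp: L2_def cmod_add_sq_le\<close>)

lemma L2_scale [intro]: assumes "L2 M f" shows "L2 M (\<lambda>x. c * f x)"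
  using assms by (auto simp: L2_def norm_mult power_mult_distrib)

lemma L2_diff [intro]: assumes "L2 M f" "L2 M g" shows "L2 M (\<lambda>x. f x - g x)"
  using L2_add[OF assms(1) L2_scale[OF assms(2), of "-1"]] by simp

lemma L2_integrable_mult:
  assumes "L2 M f" "L2 M g" shows "integrable M (\<lambda>x. f x * cnj (g x))"
proof (rule Bochner_Integration.integrable_bound)
  show "integrable M (\<lambda>x. (cmod (f x))^2 + (cmod (g x))^2)"
    using assms by (auto simp: L2_def)
  have "g \<in> borel_measurable M" "f \<in> borel_measurable M" using assms by (auto simp: L2_def)
  then show "(\<lambda>x. f x * cnj (g x)) \<in> borel_measurable M"
    by (intro borel_measurable_times)
       (auto intro: borel_measurable_continuous_on[of cnj] continuous_intros)
  show "AE x in M. norm (f x * cnj (g x)) \<le> norm ((cmod (f x))^2 + (cmod (g x))^2)"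
  proof (rule AE_I2)
    fix x
    have "2 * (cmod (f x) * cmod (g x)) \<le> (cmod (f x))^2 + (cmod (g x))^2"
      using sum_squares_bound[of "cmod (f x)" "cmod (g x)"] by simp
    moreover have "0 \<le> cmod (f x) * cmod (g x)" by simp
    ultimately have "cmod (f x) * cmod (g x) \<le> (cmod (f x))^2 + (cmod (g x))^2" by linarith
    then show "norm (f x * cnj (g x)) \<le> norm ((cmod (f x))^2 + (cmod (g x))^2)"
      by (simp add: norm_mult)
  qed
qed

lemma tuple_L2_add [intro]: "tuple_L2 n M u \<Longrightarrow> tuple_L2 n M v \<Longrightarrow> tuple_L2 n M (\<lambda>k x. u k x + v k x)"
  and tuple_L2_diff [intro]: "tuple_L2 n M u \<Longrightarrow> tuple_L2 n M v \<Longrightarrow> tuple_L2 n M (\<lambda>k x. u k x - v k x)"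
  and tuple_L2_scale [intro]: "tuple_L2 n M u \<Longrightarrow> tuple_L2 n M (\<lambda>k x. c * u k x)"
  and tuple_L2_zero [simp]: "tuple_L2 n M (\<lambda>k x. 0)"
  by (auto simp: tuple_L2_def)

lemma tuple_L2_integrable_mult:
  "tuple_L2 n M u \<Longrightarrow> tuple_L2 n M v \<Longrightarrow> k \<in> {1..n} \<Longrightarrow> integrable (M k) (\<lambda>x. u k x * cnj (v k x))"
  by (auto simp: tuple_L2_def intro!: L2_integrable_mult)

lemma tuple_norm2_nonneg [simp]: "0 \<le> tuple_norm2 n M u"
  by (auto simp: tuple_norm2_def intro!: sum_nonneg)

lemma tuple_inner_self: "tuple_inner n M u u = of_real (tuple_norm2 n M u)"
  unfolding tuple_inner_def tuple_norm2_def of_real_sum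
  by (intro sum.cong refl) (simp add: complex_norm_square[symmetric] del: of_real_power)

lemma tuple_inner_add_left: "tuple_L2 n M u \<Longrightarrow> tuple_L2 n M v \<Longrightarrow> tuple_L2 n M z \<Longrightarrow>
    tuple_inner n M (\<lambda>k x. u k x + v k x) z = tuple_inner n M u z + tuple_inner n M v z"
  unfolding tuple_inner_def by (simp add: ring_distribs tuple_L2_integrable_mult sum.distrib)

lemma tuple_inner_diff_left: "tuple_L2 n M u \<Longrightarrow> tuple_L2 n M v \<Longrightarrow> tuple_L2 n M z \<Longrightarrow>
    tuple_inner n M (\<lambda>k x. u k x - v k x) z = tuple_inner n M u z - tuple_inner n M v z"
  unfolding tuple_inner_def by (simp add: ring_distribs tuple_L2_integrable_mult sum_subtractf)

lemma tuple_inner_scale_left: "tuple_inner n M (\<lambda>k x. c * u k x) z = c * tuple_inner n M u z"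
  unfolding tuple_inner_def by (simp add: sum_distrib_left mult.assoc)

lemma tuple_inner_commute: "tuple_inner n M u v = cnj (tuple_inner n M v u)"
proof -
  have "(LINT x|M k. u k x * cnj (v k x)) = cnj (LINT x|M k. v k x * cnj (u k x))" for k
    using Bochner_Integration.integral_cnj[of "M k" "\<lambda>x. v k x * cnj (u k x)"] by (simp add: mult.commute)
  then show ?thesis unfolding tuple_inner_def cnj_sum by simp
qed

lemma tuple_inner_add_right: "tuple_L2 n M u \<Longrightarrow> tuple_L2 n M v \<Longrightarrow> tuple_L2 n M z \<Longrightarrow>
    tuple_inner n M z (\<lambda>k x. u k x + v k x) = tuple_inner n M z u + tuple_inner n M z v"
  by (subst (1 2 3) tuple_inner_commute) (simp add: tuple_inner_add_left)

lemma tuple_inner_diff_right: "tuple_L2 n M u \<Longrightarrow> tuple_L2 n M v \<Longrightarrow> tuple_L2 n M z \<Longrightarrow>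
    tuple_inner n M z (\<lambda>k x. u k x - v k x) = tuple_inner n M z u - tuple_inner n M z v"
  by (subst (1 2 3) tuple_inner_commute) (simp add: tuple_inner_diff_left)

lemma tuple_inner_scale_right: "tuple_inner n M z (\<lambda>k x. c * u k x) = cnj c * tuple_inner n M z u"
  by (subst (1 2) tuple_inner_commute) (simp add: tuple_inner_scale_left)

lemma tuple_norm2_scale: "tuple_norm2 n M (\<lambda>k x. c * u k x) = (cmod c)^2 * tuple_norm2 n M u"
  by (simp add: tuple_norm2_def norm_mult power_mult_distrib sum_distrib_left)

lemma tuple_norm2_minus_commute: "tuple_norm2 n M (\<lambda>k x. u k x - v k x) = tuple_norm2 n M (\<lambda>k x. v k x - u k x)"
  by (simp add: tuple_norm2_def norm_minus_commute)

lemma tuple_norm2_add_le: assumes "tuple_L2 n M u" "tuple_L2 n M v"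
  shows "tuple_norm2 n M (\<lambda>k x. u k x + v k x) \<le> 2 * tuple_norm2 n M u + 2 * tuple_norm2 n M v"
proof -
  have "(LINT x|M k. (cmod (u k x + v k x))^2) \<le>
      2 * (LINT x|M k. (cmod (u k x))^2) + 2 * (LINT x|M k. (cmod (v k x))^2)" if "k \<in> {1..n}" for k
  proof -
    have L: "L2 (M k) (u k)" "L2 (M k) (v k)" using assms that by (auto simp: tuple_L2_def)
    have "(LINT x|M k. (cmod (u k x + v k x))^2) \<le> (LINT x|M k. 2 * (cmod (u k x))^2 + 2 * (cmod (v k x))^2)"
      using L2_integrable[OF L(1)] L2_integrable[OF L(2)] L2_integrable[OF L2_add[OF L]]
      by (intro integral_mono) (auto simp: cmod_add_sq_le)
    then show ?thesis using L2_integrable[OF L(1)] L2_integrable[OF L(2)] by simp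
  qed
  then have "tuple_norm2 n M (\<lambda>k x. u k x + v k x) \<le> (\<Sum>k\<in>{1..n}. 2 * (LINT x|M k. (cmod (u k x))^2) + 2 * (LINT x|M k. (cmod (v k x))^2))"
    unfolding tuple_norm2_def by (intro sum_mono) auto
  then show ?thesis by (simp add: tuple_norm2_def sum.distrib sum_distrib_left)
qed

lemma tuple_norm2_triangle: assumes "tuple_L2 n M u" "tuple_L2 n M v" "tuple_L2 n M w"
  shows "tuple_norm2 n M (\<lambda>k x. u k x - w k x) \<le>
     2 * tuple_norm2 n M (\<lambda>k x. u k x - v k x) + 2 * tuple_norm2 n M (\<lambda>k x. v k x - w k x)"
  using tuple_norm2_add_le[OF tuple_L2_diff[OF assms(1,2)] tuple_L2_diff[OF assms(2,3)]] by simp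

lemma tuple_norm2_add: assumes "tuple_L2 n M u" "tuple_L2 n M v"
  shows "tuple_norm2 n M (\<lambda>k x. u k x + v k x) = tuple_norm2 n M u + tuple_norm2 n M v + 2 * Re (tuple_inner n M u v)"
proof -
  have "complex_of_real (tuple_norm2 n M (\<lambda>k x. u k x + v k x)) =
     of_real (tuple_norm2 n M u) + of_real (tuple_norm2 n M v) + (tuple_inner n M u v + tuple_inner n M v u)"
    unfolding tuple_inner_self[symmetric] using assms by (simp add: tuple_inner_add_left tuple_inner_add_right tuple_L2_add)
  then have "tuple_norm2 n M (\<lambda>k x. u k x + v k x) = Re (of_real (tuple_norm2 n M u) + of_real (tuple_norm2 n M v) + (tuple_inner n M u v + tuple_inner n M v u))"
    by (metis Re_complex_of_real)
  then show ?thesis by (simp add: tuple_inner_commute[of n M v u])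
qed

lemma tuple_inner_Cauchy_Schwarz: assumes "tuple_L2 n M u" "tuple_L2 n M v"
  shows "(cmod (tuple_inner n M u v))^2 \<le> tuple_norm2 n M u * tuple_norm2 n M v"
proof -
  define p where "p = tuple_inner n M u v"
  \<comment> \<open>Positivity of the norm of u - t p v, with p the inner product of u and v: the
    factor p makes the mixed term real, namely -2 t times the squared modulus of p.\<close>
  have *: "0 \<le> tuple_norm2 n M u + t^2 * (cmod p)^2 * tuple_norm2 n M v - 2 * t * (cmod p)^2" for t :: real
  proof -
    define s where "s = - of_real t * p"
    have "0 \<le> tuple_norm2 n M (\<lambda>k x. u k x + s * v k x)" by simp
    also have "\<dots> = tuple_norm2 n M u + (cmod s)^2 * tuple_norm2 n M v + 2 * Re (cnj s * p)"
      by (subst tuple_norm2_add) (use assms in \<open>auto simp: tuple_norm2_scale tuple_inner_scale_right p_def\<close>)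
    also have "s = - of_real t * p" by (rule s_def)
    also have "Re (cnj (- of_real t * p) * p) = - t * (cmod p)^2"
    proof -
      have "cnj (- of_real t * p) * p = of_real (- t * (cmod p)^2)"
        using complex_norm_square[of p] by (simp add: mult.commute mult.left_commute)
      then show ?thesis by (metis Re_complex_of_real)
    qed
    finally show ?thesis by (simp add: norm_mult power_mult_distrib)
  qed
  show ?thesis
  proof (cases "p = 0")
    case False
    then have p: "(cmod p)^2 > 0" by simp
    show ?thesis
    proof (cases "tuple_norm2 n M v = 0")
      case True
      \<comment> \<open>When v has norm zero the bound is affine in t with negative slope; for this
        t its value is minus the squared norm of u minus 2, a contradiction.\<close>
      have "tuple_norm2 n M u + 2 \<le> 0" using *[of "(tuple_norm2 n M u + 1) / (cmod p)^2"] p by (simp add: True)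
      then show ?thesis using tuple_norm2_nonneg[of n M u] by linarith
    next
      case False
      then have v: "tuple_norm2 n M v > 0" using tuple_norm2_nonneg[of n M v] by linarith
      show ?thesis using *[of "1 / tuple_norm2 n M v"] v p
        by (simp add: field_simps power2_eq_square p_def)
    qed
  qed (simp add: p_def[symmetric])
qed

section \<open>Completeness of the space of square-integrable tuples\<close>

definition tuple_Cauchy where
  "tuple_Cauchy n M f \<longleftrightarrow> (\<forall>e>0. \<exists>N. \<forall>i\<ge>N. \<forall>j\<ge>N. tuple_norm2 n M (\<lambda>k x. f i k x - f j k x) < e)"

text \<open>Fatou's lemma in the index j of \<open>f i - f j\<close>, with i fixed, carries the
  Cauchy bound over to \<open>f i - g\<close>. The whole sequence is treated at once, so a limit
  already known pointwise is recognized as the L2 limit.\<close>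

lemma tuple_L2_Cauchy_limit:
  fixes f :: "nat \<Rightarrow> nat \<Rightarrow> 'a \<Rightarrow> complex"
  assumes f: "\<And>i. tuple_L2 n M (f i)" and C: "tuple_Cauchy n M f"
    and g: "\<And>k. k \<in> {1..n} \<Longrightarrow> g k \<in> borel_measurable (M k)"
    and lim: "\<And>k. k \<in> {1..n} \<Longrightarrow> AE x in M k. (\<lambda>i. f i k x) \<longlonglongrightarrow> g k x"
  shows "tuple_L2 n M g" "(\<lambda>i. tuple_norm2 n M (\<lambda>k x. f i k x - g k x)) \<longlonglongrightarrow> 0"
proof -
  have key: "\<exists>N. \<forall>i\<ge>N. \<forall>k\<in>{1..n}. (\<integral>\<^sup>+ x. ennreal ((cmod (f i k x - g k x))^2) \<partial>M k) \<le> ennreal e" if e: "e > 0" for e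
  proof -
    obtain N where N: "\<And>i j. i \<ge> N \<Longrightarrow> j \<ge> N \<Longrightarrow> tuple_norm2 n M (\<lambda>k x. f i k x - f j k x) < e"
      using C e unfolding tuple_Cauchy_def by blast
    have "(\<integral>\<^sup>+ x. ennreal ((cmod (f i k x - g k x))^2) \<partial>M k) \<le> ennreal e"
      if i: "i \<ge> N" and k: "k \<in> {1..n}" for i k
    proof -
      have m: "\<And>j. f j k \<in> borel_measurable (M k)" "g k \<in> borel_measurable (M k)"
        using f k g by (auto simp: tuple_L2_def L2_def)
      have "(\<integral>\<^sup>+ x. ennreal ((cmod (f i k x - g k x))^2) \<partial>M k) =
        (\<integral>\<^sup>+ x. liminf (\<lambda>j. ennreal ((cmod (f i k x - f j k x))^2)) \<partial>M k)"
      proof (rule nn_integral_cong_AE)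
        show "AE x in M k. ennreal ((cmod (f i k x - g k x))^2) = liminf (\<lambda>j. ennreal ((cmod (f i k x - f j k x))^2))"
          using lim[OF k]
        proof eventually_elim
          case (elim x)
          have "(\<lambda>j. ennreal ((cmod (f i k x - f j k x))^2)) \<longlonglongrightarrow> ennreal ((cmod (f i k x - g k x))^2)"
            by (intro tendsto_ennrealI tendsto_intros elim)
          then show ?case by (rule lim_imp_Liminf[OF sequentially_bot, symmetric])
        qed
      qed
      also have "\<dots> \<le> liminf (\<lambda>j. \<integral>\<^sup>+ x. ennreal ((cmod (f i k x - f j k x))^2) \<partial>M k)"
        by (rule nn_integral_liminf) (use m in measurable)
      also have "\<dots> \<le> ennreal e"
      proof -
        have "\<forall>\<^sub>F j in sequentially. (\<integral>\<^sup>+ x. ennreal ((cmod (f i k x - f j k x))^2) \<partial>M k) \<le> ennreal e"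
          using eventually_ge_at_top[of N]
        proof eventually_elim
          case (elim j)
          have L: "L2 (M k) (\<lambda>x. f i k x - f j k x)" using f k by (auto simp: tuple_L2_def)
          have "(\<integral>\<^sup>+ x. ennreal ((cmod (f i k x - f j k x))^2) \<partial>M k) = ennreal (LINT x|M k. (cmod (f i k x - f j k x))^2)"
            by (rule nn_integral_eq_integral) (use L2_integrable[OF L] in auto)
          also have "(LINT x|M k. (cmod (f i k x - f j k x))^2) \<le> tuple_norm2 n M (\<lambda>k x. f i k x - f j k x)"
            unfolding tuple_norm2_def by (rule member_le_sum[OF k]) auto
          also have "\<dots> \<le> e" using N[OF i elim] by simp
          finally show ?case by (auto intro: ennreal_leI)
        qed
        then have "liminf (\<lambda>j. \<integral>\<^sup>+ x. ennreal ((cmod (f i k x - f j k x))^2) \<partial>M k) \<le> liminf (\<lambda>j::nat. ennreal e)"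
          by (rule Liminf_mono)
        then show ?thesis by (simp add: Liminf_const)
      qed
      finally show ?thesis .
    qed
    then show ?thesis by blast
  qed
  have L2d: "L2 (M k) (\<lambda>x. f i k x - g k x)" "(LINT x|M k. (cmod (f i k x - g k x))^2) \<le> e"
    if "k \<in> {1..n}" "e > 0" "(\<integral>\<^sup>+ x. ennreal ((cmod (f i k x - g k x))^2) \<partial>M k) \<le> ennreal e" for i k e
  proof -
    have m: "f i k \<in> borel_measurable (M k)" "g k \<in> borel_measurable (M k)"
      using f that g by (auto simp: tuple_L2_def L2_def)
    have "integrable (M k) (\<lambda>x. (cmod (f i k x - g k x))^2)"
      by (rule integrableI_bounded) (use m that(3) in \<open>auto intro: order.strict_trans1[OF that(3)]\<close>)
    then show "L2 (M k) (\<lambda>x. f i k x - g k x)" using m by (auto simp: L2_def)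
    show "(LINT x|M k. (cmod (f i k x - g k x))^2) \<le> e"
      using that(3) \<open>integrable _ _\<close> that(2) by (subst (asm) nn_integral_eq_integral) auto
  qed
  show "tuple_L2 n M g"
  proof -
    obtain N where N: "\<forall>i\<ge>N. \<forall>k\<in>{1..n}. (\<integral>\<^sup>+ x. ennreal ((cmod (f i k x - g k x))^2) \<partial>M k) \<le> ennreal 1"
      using key[of 1] by auto
    have "L2 (M k) (\<lambda>x. f N k x - (f N k x - g k x))" if "k \<in> {1..n}" for k
      by (rule L2_diff[OF _ L2d(1)[OF that, of 1]]) (use f that N in \<open>auto simp: tuple_L2_def\<close>)
    then show ?thesis by (simp add: tuple_L2_def)
  qed
  show "(\<lambda>i. tuple_norm2 n M (\<lambda>k x. f i k x - g k x)) \<longlonglongrightarrow> 0"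
  proof (rule LIMSEQ_I)
    fix r :: real assume r: "r > 0"
    \<comment> \<open>Each of the n edges contributes at most e, and the denominator exceeds
      n.\<close>
    define e where "e = r / (2 * (real n + 1))"
    have e: "e > 0" using r by (simp add: e_def)
    obtain N where N: "\<forall>i\<ge>N. \<forall>k\<in>{1..n}. (\<integral>\<^sup>+ x. ennreal ((cmod (f i k x - g k x))^2) \<partial>M k) \<le> ennreal e"
      using key[OF e] by auto
    have "tuple_norm2 n M (\<lambda>k x. f i k x - g k x) < r" if "i \<ge> N" for i
    proof -
      have "tuple_norm2 n M (\<lambda>k x. f i k x - g k x) \<le> (\<Sum>k\<in>{1..n}. e)"
        unfolding tuple_norm2_def by (intro sum_mono L2d(2)) (use N that e in auto)
      also have "\<dots> = real n * e" by simp
      also have "\<dots> < r" using r by (simp add: e_def field_simps) (smt (verit, best) mult_nonneg_nonneg of_nat_0_le_iff)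
      finally show ?thesis .
    qed
    then show "\<exists>no. \<forall>i\<ge>no. norm (tuple_norm2 n M (\<lambda>k x. f i k x - g k x) - 0) < r" by auto
  qed
qed

lemma tuple_L2_tuple_norm2_measurable_AE:
  assumes "tuple_L2 n M f" "tuple_norm2 n M f \<le> e" "k \<in> {1..n}"
  shows "(\<integral>\<^sup>+ x. ennreal ((cmod (f k x))^2) \<partial>M k) \<le> ennreal e"
proof -
  have L: "L2 (M k) (f k)" using assms by (auto simp: tuple_L2_def)
  have "(\<integral>\<^sup>+ x. ennreal ((cmod (f k x))^2) \<partial>M k) = ennreal (LINT x|M k. (cmod (f k x))^2)"
    by (rule nn_integral_eq_integral) (use L2_integrable[OF L] in auto)
  also have "(LINT x|M k. (cmod (f k x))^2) \<le> tuple_norm2 n M f"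
    unfolding tuple_norm2_def by (rule member_le_sum[OF assms(3)]) auto
  finally show ?thesis using assms(2) by (meson ennreal_leI order_trans)
qed

text \<open>Riesz-Fischer: along a fast subsequence the increments are summable almost everywhere,
  and the pointwise limit so obtained is the norm limit by the previous lemma.\<close>

lemma tuple_L2_complete:
  fixes f :: "nat \<Rightarrow> nat \<Rightarrow> 'a \<Rightarrow> complex"
  assumes f: "\<And>i. tuple_L2 n M (f i)" and C: "tuple_Cauchy n M f"
  shows "\<exists>g. tuple_L2 n M g \<and> (\<lambda>i. tuple_norm2 n M (\<lambda>k x. f i k x - g k x)) \<longlonglongrightarrow> 0"
proof -
  \<comment> \<open>The rate 8^(-m) leaves room for a weight 4^m: the weighted squares of the
    increments have integrals at most 2^(-m), so almost everywhere they sum to a finite C and the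
    m-th increment is at most sqrt C 2^(-m).\<close>
  define P where "P = (\<lambda>(m::nat) (N::nat). \<forall>i\<ge>N. \<forall>j\<ge>N. tuple_norm2 n M (\<lambda>k x. f i k x - f j k x) < (1/8)^m)"
  have "\<exists>N. P m N" for m
    using C[unfolded tuple_Cauchy_def, rule_format, of "(1/8)^m"] by (auto simp: P_def)
  then obtain N0 where N0: "\<And>m. P m (N0 m)" by metis
  \<comment> \<open>Summing the thresholds, with one added each time, makes the subsequence strictly
    increasing while it stays beyond every threshold.\<close>
  define r where "r = (\<lambda>m. \<Sum>i\<le>m. N0 i + 1)"
  have r_ge: "N0 m \<le> r m" for m
  proof -
    have "N0 m \<le> (\<Sum>i\<in>{m}. N0 i + 1)" by simp
    also have "\<dots> \<le> r m" unfolding r_def by (rule sum_mono2) auto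
    finally show ?thesis .
  qed
  have r_mono: "strict_mono r" by (rule strict_monoI_Suc) (simp add: r_def)
  have r_le: "r m \<le> r (Suc m)" for m using r_mono by (simp add: strict_mono_leD)
  have d: "tuple_norm2 n M (\<lambda>k x. f (r (Suc m)) k x - f (r m) k x) \<le> (1/8)^m" for m
    using N0[of m] r_ge[of m] r_le[of m] unfolding P_def by (meson less_imp_le order_trans)
  define D where "D = (\<lambda>m k x. f (r (Suc m)) k x - f (r m) k x)"
  have DL: "tuple_L2 n M (D m)" for m unfolding D_def using f by auto
  have conv: "AE x in M k. convergent (\<lambda>m. f (r m) k x)" if k: "k \<in> {1..n}" for k
  proof -
    have m: "\<And>i. f i k \<in> borel_measurable (M k)" "\<And>i. D i k \<in> borel_measurable (M k)"
      using f DL k by (auto simp: tuple_L2_def L2_def)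
    have "(\<integral>\<^sup>+ x. (\<Sum>m. ennreal (4^m * (cmod (D m k x))^2)) \<partial>M k)
        = (\<Sum>m. \<integral>\<^sup>+ x. ennreal (4^m * (cmod (D m k x))^2) \<partial>M k)"
      by (rule nn_integral_suminf) (use m in measurable)
    also have "\<dots> \<le> (\<Sum>m. ennreal ((1/2)^m))"
    proof (rule suminf_le)
      fix m
      have "(\<integral>\<^sup>+ x. ennreal (4^m * (cmod (D m k x))^2) \<partial>M k) = ennreal (4^m) * (\<integral>\<^sup>+ x. ennreal ((cmod (D m k x))^2) \<partial>M k)"
        using m by (simp add: ennreal_mult nn_integral_cmult)
      also have "\<dots> \<le> ennreal (4^m) * ennreal ((1/8)^m)"
        by (intro mult_left_mono tuple_L2_tuple_norm2_measurable_AE[OF DL _ k]) (use d in \<open>auto simp: D_def\<close>)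
      also have "\<dots> = ennreal ((1/2)^m)"
        by (simp add: ennreal_mult[symmetric] power_mult_distrib[symmetric])
      finally show "(\<integral>\<^sup>+ x. ennreal (4^m * (cmod (D m k x))^2) \<partial>M k) \<le> ennreal ((1/2)^m)" .
    qed auto
    also have "\<dots> < \<infinity>"
      by (subst suminf_ennreal2) (auto simp: summable_geometric)
    finally have fin: "(\<integral>\<^sup>+ x. (\<Sum>m. ennreal (4^m * (cmod (D m k x))^2)) \<partial>M k) \<noteq> \<infinity>" by simp
    have "AE x in M k. (\<Sum>m. ennreal (4^m * (cmod (D m k x))^2)) \<noteq> \<infinity>"
      by (rule nn_integral_PInf_AE[OF _ fin]) (use m in measurable)
    then show ?thesis
    proof eventually_elim
      case (elim x)
      define S where "S = (\<Sum>m. ennreal (4^m * (cmod (D m k x))^2))"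
      define C where "C = enn2real S"
      have S: "S = ennreal C" using elim by (simp add: S_def C_def less_top)
      have C0: "C \<ge> 0" by (simp add: C_def)
      have b: "cmod (D m k x) \<le> sqrt C * (1/2)^m" for m
      proof -
        have "ennreal (4^m * (cmod (D m k x))^2) = (\<Sum>i\<in>{m}. ennreal (4^i * (cmod (D i k x))^2))" by simp
        also have "\<dots> \<le> S" unfolding S_def by (rule sum_le_suminf) auto
        finally have "4^m * (cmod (D m k x))^2 \<le> C" using S C0 by simp
        moreover have "4^m * (cmod (D m k x))^2 = (2^m * cmod (D m k x))^2"
          by (simp add: power_mult_distrib power_mult[symmetric] mult.commute[of _ 2]) (simp add: power_mult)
        ultimately have "2^m * cmod (D m k x) \<le> sqrt C" by (metis real_le_rsqrt)
        then show ?thesis by (simp add: field_simps power_one_over)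
      qed
      have "summable (\<lambda>m. D m k x)"
        by (rule summable_comparison_test'[of "\<lambda>m. sqrt C * (1/2)^m" 0])
           (use b in \<open>auto intro!: summable_mult summable_geometric\<close>)
      then have "convergent (\<lambda>m. \<Sum>i<m. D i k x)" by (simp add: summable_iff_convergent)
      moreover have "(\<Sum>i<m. D i k x) = f (r m) k x - f (r 0) k x" for m
        unfolding D_def by (induction m) auto
      ultimately have "convergent (\<lambda>m. f (r m) k x - f (r 0) k x)" by simp
      then have "convergent (\<lambda>m. (f (r m) k x - f (r 0) k x) + f (r 0) k x)"
        by (intro convergent_add convergent_const)
      then show "convergent (\<lambda>m. f (r m) k x)" by simp
    qed
  qed
  define g where "g = (\<lambda>k x. lim (\<lambda>m. f (r m) k x))"
  have gm: "g k \<in> borel_measurable (M k)" if "k \<in> {1..n}" for k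
    unfolding g_def by (rule borel_measurable_lim_metric) (use f that in \<open>auto simp: tuple_L2_def L2_def\<close>)
  have cl: "AE x in M k. (\<lambda>m. f (r m) k x) \<longlonglongrightarrow> g k x" if "k \<in> {1..n}" for k
    using conv[OF that] by eventually_elim (simp add: g_def convergent_LIMSEQ_iff)
  have rr: "r m \<ge> m" for m using r_mono by (rule seq_suble)
  have C': "tuple_Cauchy n M (\<lambda>m. f (r m))"
    unfolding tuple_Cauchy_def using C[unfolded tuple_Cauchy_def] rr by (meson order_trans)
  have g: "tuple_L2 n M g" and lim: "(\<lambda>i. tuple_norm2 n M (\<lambda>k x. f (r i) k x - g k x)) \<longlonglongrightarrow> 0"
    using tuple_L2_Cauchy_limit[OF f C' gm cl] by auto
  have "(\<lambda>i. tuple_norm2 n M (\<lambda>k x. f i k x - g k x)) \<longlonglongrightarrow> 0"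
  proof (rule LIMSEQ_I)
    fix e :: real assume e: "e > 0"
    obtain A where A: "\<forall>i\<ge>A. \<forall>j\<ge>A. tuple_norm2 n M (\<lambda>k x. f i k x - f j k x) < e/4"
      using C[unfolded tuple_Cauchy_def, rule_format, of "e/4"] e by auto
    obtain B where B: "\<forall>i\<ge>B. tuple_norm2 n M (\<lambda>k x. f (r i) k x - g k x) < e/4"
      using LIMSEQ_D[OF lim, of "e/4"] e by auto
    have "tuple_norm2 n M (\<lambda>k x. f i k x - g k x) < e" if "i \<ge> A" for i
    proof -
      have "tuple_norm2 n M (\<lambda>k x. f i k x - g k x) \<le> 2 * tuple_norm2 n M (\<lambda>k x. f i k x - f (r (max A B)) k x)
         + 2 * tuple_norm2 n M (\<lambda>k x. f (r (max A B)) k x - g k x)"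
        by (rule tuple_norm2_triangle) (use f g in auto)
      also have "\<dots> < 2 * (e/4) + 2 * (e/4)"
        using A B that rr[of "max A B"] by (intro add_strict_mono mult_strict_left_mono) auto
      finally show ?thesis by simp
    qed
    then show "\<exists>no. \<forall>i\<ge>no. norm (tuple_norm2 n M (\<lambda>k x. f i k x - g k x) - 0) < e" by auto
  qed
  with g show ?thesis by blast
qed

lemma tuple_inner_tendsto_left:
  assumes "\<And>i. tuple_L2 n M (f i)" "tuple_L2 n M g" "tuple_L2 n M z"
    and lim: "(\<lambda>i. tuple_norm2 n M (\<lambda>k x. f i k x - g k x)) \<longlonglongrightarrow> 0"
  shows "(\<lambda>i. tuple_inner n M (f i) z) \<longlonglongrightarrow> tuple_inner n M g z"
proof -
  have b: "cmod (tuple_inner n M (f i) z - tuple_inner n M g z) \<le> sqrt (tuple_norm2 n M (\<lambda>k x. f i k x - g k x)) * sqrt (tuple_norm2 n M z)" for i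
  proof -
    have "(cmod (tuple_inner n M (\<lambda>k x. f i k x - g k x) z))^2 \<le> tuple_norm2 n M (\<lambda>k x. f i k x - g k x) * tuple_norm2 n M z"
      by (rule tuple_inner_Cauchy_Schwarz) (use assms in auto)
    then have "cmod (tuple_inner n M (\<lambda>k x. f i k x - g k x) z) \<le> sqrt (tuple_norm2 n M (\<lambda>k x. f i k x - g k x) * tuple_norm2 n M z)"
      by (rule real_le_rsqrt)
    then show ?thesis using assms by (simp add: tuple_inner_diff_left real_sqrt_mult)
  qed
  have "(\<lambda>i. sqrt (tuple_norm2 n M (\<lambda>k x. f i k x - g k x)) * sqrt (tuple_norm2 n M z)) \<longlonglongrightarrow> sqrt 0 * sqrt (tuple_norm2 n M z)"
    by (rule tendsto_mult[OF tendsto_real_sqrt[OF lim] tendsto_const])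
  then have z: "(\<lambda>i. sqrt (tuple_norm2 n M (\<lambda>k x. f i k x - g k x)) * sqrt (tuple_norm2 n M z)) \<longlonglongrightarrow> 0" by simp
  have "(\<lambda>i. tuple_inner n M (f i) z - tuple_inner n M g z) \<longlonglongrightarrow> 0"
    by (rule Lim_null_comparison[OF always_eventually[OF allI[OF b]] z])
  then show ?thesis by (simp add: LIM_zero_iff)
qed

text \<open>Expanding the square of (f - g) + g reduces the claim to the convergence of the inner
  products with g.\<close>

lemma tuple_norm2_tendsto:
  assumes f: "\<And>i. tuple_L2 n M (f i)" and g: "tuple_L2 n M g"
    and lim: "(\<lambda>i. tuple_norm2 n M (\<lambda>k x. f i k x - g k x)) \<longlonglongrightarrow> 0"
  shows "(\<lambda>i. tuple_norm2 n M (f i)) \<longlonglongrightarrow> tuple_norm2 n M g"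
proof -
  have eq: "tuple_norm2 n M (f i) = tuple_norm2 n M (\<lambda>k x. f i k x - g k x) - tuple_norm2 n M g + 2 * Re (tuple_inner n M (f i) g)" for i
  proof -
    have "tuple_norm2 n M (\<lambda>k x. (f i k x - g k x) + g k x) = tuple_norm2 n M (\<lambda>k x. f i k x - g k x) + tuple_norm2 n M g + 2 * Re (tuple_inner n M (\<lambda>k x. f i k x - g k x) g)"
      by (rule tuple_norm2_add) (use f g in auto)
    also have "tuple_inner n M (\<lambda>k x. f i k x - g k x) g = tuple_inner n M (f i) g - of_real (tuple_norm2 n M g)"
      using f g by (simp add: tuple_inner_diff_left tuple_inner_self)
    finally show ?thesis by simp
  qed
  have "(\<lambda>i. tuple_norm2 n M (\<lambda>k x. f i k x - g k x) - tuple_norm2 n M g + 2 * Re (tuple_inner n M (f i) g)) \<longlonglongrightarrow> 0 - tuple_norm2 n M g + 2 * Re (tuple_inner n M g g)"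
    by (rule tendsto_add[OF tendsto_diff[OF lim tendsto_const]
          tendsto_mult[OF tendsto_const tendsto_Re[OF tuple_inner_tendsto_left[OF f g g lim]]]])
  then show ?thesis by (simp add: eq[symmetric] tuple_inner_self)
qed

text \<open>With conjugation in the second slot, the norm of u + \<i> v yields the imaginary part.
  Inner products are thus determined by norms, so a linear relation that preserves norms preserves
  inner products.\<close>

lemma tuple_inner_polarization:
  assumes "tuple_L2 n M u" "tuple_L2 n M v"
  shows "tuple_inner n M u v = Complex ((tuple_norm2 n M (\<lambda>k x. u k x + v k x) - tuple_norm2 n M u - tuple_norm2 n M v) / 2)
     ((tuple_norm2 n M (\<lambda>k x. u k x + \<i> * v k x) - tuple_norm2 n M u - tuple_norm2 n M v) / 2)"
  using assms by (simp add: tuple_norm2_add tuple_L2_scale tuple_norm2_scale tuple_inner_scale_right complex_eq_iff)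

lemma tuple_Cauchy_of_lim:
  assumes f: "\<And>i. tuple_L2 n M (f i)" and g: "tuple_L2 n M g"
    and lim: "(\<lambda>i. tuple_norm2 n M (\<lambda>k x. f i k x - g k x)) \<longlonglongrightarrow> 0"
  shows "tuple_Cauchy n M f"
  unfolding tuple_Cauchy_def
proof (intro allI impI)
  fix e :: real assume e: "e > 0"
  obtain B where B: "\<forall>i\<ge>B. tuple_norm2 n M (\<lambda>k x. f i k x - g k x) < e/4"
    using LIMSEQ_D[OF lim, of "e/4"] e by auto
  have "tuple_norm2 n M (\<lambda>k x. f i k x - f j k x) < e" if "i \<ge> B" "j \<ge> B" for i j
  proof -
    have "tuple_norm2 n M (\<lambda>k x. f i k x - f j k x) \<le> 2 * tuple_norm2 n M (\<lambda>k x. f i k x - g k x)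
         + 2 * tuple_norm2 n M (\<lambda>k x. g k x - f j k x)"
      by (rule tuple_norm2_triangle) (use f g in auto)
    also have "tuple_norm2 n M (\<lambda>k x. g k x - f j k x) = tuple_norm2 n M (\<lambda>k x. f j k x - g k x)"
      by (rule tuple_norm2_minus_commute)
    also have "2 * tuple_norm2 n M (\<lambda>k x. f i k x - g k x) + 2 * tuple_norm2 n M (\<lambda>k x. f j k x - g k x) < 2 * (e/4) + 2 * (e/4)"
      using B that by (intro add_strict_mono mult_strict_left_mono) auto
    finally show ?thesis by simp
  qed
  then show "\<exists>N. \<forall>i\<ge>N. \<forall>j\<ge>N. tuple_norm2 n M (\<lambda>k x. f i k x - f j k x) < e" by auto
qed

section \<open>Closure of a linear isometric relation\<close>

locale isometric_span =
  fixes n :: nat and M1 M2 :: "nat \<Rightarrow> real measure"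
    and S :: "(nat \<Rightarrow> real \<Rightarrow> complex) \<Rightarrow> (nat \<Rightarrow> real \<Rightarrow> complex) \<Rightarrow> bool"
  assumes S_L2: "S e v \<Longrightarrow> tuple_L2 n M1 e" "S e v \<Longrightarrow> tuple_L2 n M2 v"
    and S_add: "S e v \<Longrightarrow> S e' v' \<Longrightarrow> S (\<lambda>k x. e k x + e' k x) (\<lambda>k x. v k x + v' k x)"
    and S_scale: "S e v \<Longrightarrow> S (\<lambda>k x. b * e k x) (\<lambda>k x. b * v k x)"
    and S_iso: "S e v \<Longrightarrow> tuple_norm2 n M1 e = tuple_norm2 n M2 v"
begin

text \<open>The closure of S in the product of the two spaces. It is a relation because both sides
  are only determined up to null sets; any square-integrable representative may stand for a
  transform.\<close>

definition graph where
  "graph u \<psi> \<longleftrightarrow> tuple_L2 n M1 u \<and> tuple_L2 n M2 \<psi> \<and>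
    (\<exists>e v. (\<forall>i. S (e i) (v i)) \<and> (\<lambda>i. tuple_norm2 n M1 (\<lambda>k x. e i k x - u k x)) \<longlonglongrightarrow> 0 \<and>
       (\<lambda>i. tuple_norm2 n M2 (\<lambda>k x. v i k x - \<psi> k x)) \<longlonglongrightarrow> 0)"

lemma graph_S: "S e v \<Longrightarrow> graph e v"
  unfolding graph_def by (intro conjI S_L2 exI[of _ "\<lambda>_. e"] exI[of _ "\<lambda>_. v"]) (auto simp: tuple_norm2_def)

lemma graph_L2: "graph u \<psi> \<Longrightarrow> tuple_L2 n M1 u" "graph u \<psi> \<Longrightarrow> tuple_L2 n M2 \<psi>"
  by (auto simp: graph_def)

lemma tuple_norm2_lim_add:
  assumes "\<And>i. tuple_L2 n M (e i)" "\<And>i. tuple_L2 n M (e' i)" "tuple_L2 n M u" "tuple_L2 n M u'"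
    "(\<lambda>i. tuple_norm2 n M (\<lambda>k x. e i k x - u k x)) \<longlonglongrightarrow> 0"
    "(\<lambda>i. tuple_norm2 n M (\<lambda>k x. e' i k x - u' k x)) \<longlonglongrightarrow> 0"
  shows "(\<lambda>i. tuple_norm2 n M (\<lambda>k x. (e i k x + e' i k x) - (u k x + u' k x))) \<longlonglongrightarrow> 0"
proof (rule Lim_null_comparison[OF always_eventually])
  show "(\<lambda>i. 2 * tuple_norm2 n M (\<lambda>k x. e i k x - u k x) + 2 * tuple_norm2 n M (\<lambda>k x. e' i k x - u' k x)) \<longlonglongrightarrow> 0"
    using tendsto_add[OF tendsto_mult_left[OF assms(5), of 2] tendsto_mult_left[OF assms(6), of 2]] by simp
  show "\<forall>i. norm (tuple_norm2 n M (\<lambda>k x. (e i k x + e' i k x) - (u k x + u' k x))) \<le>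
      2 * tuple_norm2 n M (\<lambda>k x. e i k x - u k x) + 2 * tuple_norm2 n M (\<lambda>k x. e' i k x - u' k x)"
  proof
    fix i
    have "(\<lambda>k x. (e i k x + e' i k x) - (u k x + u' k x)) = (\<lambda>k x. (e i k x - u k x) + (e' i k x - u' k x))"
      by (simp add: algebra_simps)
    then show "norm (tuple_norm2 n M (\<lambda>k x. (e i k x + e' i k x) - (u k x + u' k x))) \<le>
      2 * tuple_norm2 n M (\<lambda>k x. e i k x - u k x) + 2 * tuple_norm2 n M (\<lambda>k x. e' i k x - u' k x)"
      using tuple_norm2_add_le[of n M "\<lambda>k x. e i k x - u k x" "\<lambda>k x. e' i k x - u' k x"] assms by auto
  qed
qed

lemma graph_add:
  assumes "graph u \<psi>" "graph u' \<psi>'"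
  shows "graph (\<lambda>k x. u k x + u' k x) (\<lambda>k x. \<psi> k x + \<psi>' k x)"
proof -
  obtain e v where 1: "\<And>i. S (e i) (v i)" "(\<lambda>i. tuple_norm2 n M1 (\<lambda>k x. e i k x - u k x)) \<longlonglongrightarrow> 0"
       "(\<lambda>i. tuple_norm2 n M2 (\<lambda>k x. v i k x - \<psi> k x)) \<longlonglongrightarrow> 0" using assms(1) unfolding graph_def by blast
  obtain e' v' where 2: "\<And>i. S (e' i) (v' i)" "(\<lambda>i. tuple_norm2 n M1 (\<lambda>k x. e' i k x - u' k x)) \<longlonglongrightarrow> 0"
       "(\<lambda>i. tuple_norm2 n M2 (\<lambda>k x. v' i k x - \<psi>' k x)) \<longlonglongrightarrow> 0" using assms(2) unfolding graph_def by blast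
  show ?thesis unfolding graph_def
    apply (intro conjI tuple_L2_add graph_L2[OF assms(1)] graph_L2[OF assms(2)])
    apply (rule exI[of _ "\<lambda>i k x. e i k x + e' i k x"], rule exI[of _ "\<lambda>i k x. v i k x + v' i k x"])
    using tuple_norm2_lim_add[OF S_L2(1)[OF 1(1)] S_L2(1)[OF 2(1)] graph_L2(1)[OF assms(1)] graph_L2(1)[OF assms(2)] 1(2) 2(2)]
      tuple_norm2_lim_add[OF S_L2(2)[OF 1(1)] S_L2(2)[OF 2(1)] graph_L2(2)[OF assms(1)] graph_L2(2)[OF assms(2)] 1(3) 2(3)]
    by (simp add: S_add 1(1) 2(1))
qed

lemma graph_scale:
  assumes "graph u \<psi>"
  shows "graph (\<lambda>k x. b * u k x) (\<lambda>k x. b * \<psi> k x)"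
proof -
  obtain e v where 1: "\<And>i. S (e i) (v i)" "(\<lambda>i. tuple_norm2 n M1 (\<lambda>k x. e i k x - u k x)) \<longlonglongrightarrow> 0"
       "(\<lambda>i. tuple_norm2 n M2 (\<lambda>k x. v i k x - \<psi> k x)) \<longlonglongrightarrow> 0" using assms(1) unfolding graph_def by blast
  have eq: "tuple_norm2 n M (\<lambda>k x. b * f k x - b * g k x) = (cmod b)^2 * tuple_norm2 n M (\<lambda>k x. f k x - g k x)" for f g and M :: "nat \<Rightarrow> real measure"
    by (simp add: right_diff_distrib[symmetric] tuple_norm2_scale)
  show ?thesis unfolding graph_def
    apply (intro conjI tuple_L2_scale graph_L2[OF assms(1)])
    apply (rule exI[of _ "\<lambda>i k x. b * e i k x"], rule exI[of _ "\<lambda>i k x. b * v i k x"])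
    using tendsto_mult_left[OF 1(2), of "(cmod b)^2"] tendsto_mult_left[OF 1(3), of "(cmod b)^2"]
    by (simp add: S_scale 1(1) eq)
qed

lemma graph_diff:
  assumes "graph u \<psi>" "graph u' \<psi>'"
  shows "graph (\<lambda>k x. u k x - u' k x) (\<lambda>k x. \<psi> k x - \<psi>' k x)"
  using graph_add[OF assms(1) graph_scale[OF assms(2), of "-1"]] by simp

lemma graph_iso: assumes "graph u \<psi>" shows "tuple_norm2 n M1 u = tuple_norm2 n M2 \<psi>"
proof -
  obtain e v where 1: "\<And>i. S (e i) (v i)" "(\<lambda>i. tuple_norm2 n M1 (\<lambda>k x. e i k x - u k x)) \<longlonglongrightarrow> 0"
       "(\<lambda>i. tuple_norm2 n M2 (\<lambda>k x. v i k x - \<psi> k x)) \<longlonglongrightarrow> 0" using assms(1) unfolding graph_def by blast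
  have "(\<lambda>i. tuple_norm2 n M1 (e i)) \<longlonglongrightarrow> tuple_norm2 n M1 u"
    by (rule tuple_norm2_tendsto) (use 1 assms in \<open>auto intro: S_L2 graph_L2\<close>)
  moreover have "(\<lambda>i. tuple_norm2 n M2 (v i)) \<longlonglongrightarrow> tuple_norm2 n M2 \<psi>"
    by (rule tuple_norm2_tendsto) (use 1 assms in \<open>auto intro: S_L2 graph_L2\<close>)
  moreover have "tuple_norm2 n M1 (e i) = tuple_norm2 n M2 (v i)" for i using S_iso 1(1) by blast
  ultimately show ?thesis using LIMSEQ_unique by auto
qed

lemma graph_tuple_inner: assumes "graph u \<psi>" "graph u' \<psi>'" shows "tuple_inner n M1 u u' = tuple_inner n M2 \<psi> \<psi>'"
  using graph_iso[OF assms(1)] graph_iso[OF assms(2)] graph_iso[OF graph_add[OF assms]]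
    graph_iso[OF graph_add[OF assms(1) graph_scale[OF assms(2), of \<i>]]]
  by (simp add: tuple_inner_polarization graph_L2[OF assms(1)] graph_L2[OF assms(2)])

lemma graph_iso_diff: assumes "graph u \<psi>" "graph u' \<psi>'"
  shows "tuple_norm2 n M1 (\<lambda>k x. u k x - u' k x) = tuple_norm2 n M2 (\<lambda>k x. \<psi> k x - \<psi>' k x)"
  using graph_iso[OF graph_diff[OF assms]] .

text \<open>Diagonal choice: the i-th pair is replaced by a pair of S within 1 / (i + 1) of it in
  both squared norms.\<close>

lemma graph_closed:
  assumes graph: "\<And>i. graph (u i) (\<psi> i)" and L: "tuple_L2 n M1 w" "tuple_L2 n M2 \<eta>"
    and l1: "(\<lambda>i. tuple_norm2 n M1 (\<lambda>k x. u i k x - w k x)) \<longlonglongrightarrow> 0"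
    and l2: "(\<lambda>i. tuple_norm2 n M2 (\<lambda>k x. \<psi> i k x - \<eta> k x)) \<longlonglongrightarrow> 0"
  shows "graph w \<eta>"
proof -
  have "\<exists>e v. S e v \<and> tuple_norm2 n M1 (\<lambda>k x. e k x - u i k x) < inverse (real (Suc i)) \<and>
      tuple_norm2 n M2 (\<lambda>k x. v k x - \<psi> i k x) < inverse (real (Suc i))" for i
  proof -
    obtain e v where 1: "\<And>i. S (e i) (v i)" "(\<lambda>m. tuple_norm2 n M1 (\<lambda>k x. e m k x - u i k x)) \<longlonglongrightarrow> 0"
       "(\<lambda>m. tuple_norm2 n M2 (\<lambda>k x. v m k x - \<psi> i k x)) \<longlonglongrightarrow> 0" using graph[of i] unfolding graph_def by blast
    have ev: "\<forall>\<^sub>F m in sequentially. tuple_norm2 n M1 (\<lambda>k x. e m k x - u i k x) < inverse (real (Suc i)) \<and>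
      tuple_norm2 n M2 (\<lambda>k x. v m k x - \<psi> i k x) < inverse (real (Suc i))"
      by (intro eventually_conj order_tendstoD(2)[OF 1(2)] order_tendstoD(2)[OF 1(3)]) auto
    then obtain m where "tuple_norm2 n M1 (\<lambda>k x. e m k x - u i k x) < inverse (real (Suc i)) \<and>
      tuple_norm2 n M2 (\<lambda>k x. v m k x - \<psi> i k x) < inverse (real (Suc i))"
      using eventually_happens'[OF sequentially_bot ev] by (elim exE)
    then show ?thesis by (intro exI[of _ "e m"] exI[of _ "v m"] conjI 1(1)) auto
  qed
  then have "\<forall>i. \<exists>p. S (fst p) (snd p) \<and> tuple_norm2 n M1 (\<lambda>k x. fst p k x - u i k x) < inverse (real (Suc i)) \<and>
      tuple_norm2 n M2 (\<lambda>k x. snd p k x - \<psi> i k x) < inverse (real (Suc i))"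
    by (simp only: split_paired_Ex fst_conv snd_conv) blast
  from choice[OF this] obtain p where p: "\<forall>i. S (fst (p i)) (snd (p i)) \<and> tuple_norm2 n M1 (\<lambda>k x. fst (p i) k x - u i k x) < inverse (real (Suc i)) \<and>
      tuple_norm2 n M2 (\<lambda>k x. snd (p i) k x - \<psi> i k x) < inverse (real (Suc i))" ..
  define e where "e = (\<lambda>i. fst (p i))"
  define v where "v = (\<lambda>i. snd (p i))"
  have e: "\<And>i. S (e i) (v i)"
     "\<And>i. tuple_norm2 n M1 (\<lambda>k x. e i k x - u i k x) < inverse (real (Suc i))"
     "\<And>i. tuple_norm2 n M2 (\<lambda>k x. v i k x - \<psi> i k x) < inverse (real (Suc i))"
    using p by (auto simp: e_def v_def)
  have *: "(\<lambda>i. tuple_norm2 n M (\<lambda>k x. f i k x - h k x)) \<longlonglongrightarrow> 0"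
    if "\<And>i. tuple_L2 n M (f i)" "\<And>i. tuple_L2 n M (g i)" "tuple_L2 n M h"
      "\<And>i. tuple_norm2 n M (\<lambda>k x. f i k x - g i k x) < inverse (real (Suc i))"
      "(\<lambda>i. tuple_norm2 n M (\<lambda>k x. g i k x - h k x)) \<longlonglongrightarrow> 0" for f g h and M :: "nat \<Rightarrow> real measure"
  proof (rule Lim_null_comparison[OF always_eventually])
    show "(\<lambda>i. 2 * inverse (real (Suc i)) + 2 * tuple_norm2 n M (\<lambda>k x. g i k x - h k x)) \<longlonglongrightarrow> 0"
      using tendsto_add[OF tendsto_mult_left[OF LIMSEQ_inverse_real_of_nat, of 2] tendsto_mult_left[OF that(5), of 2]] by simp
    show "\<forall>i. norm (tuple_norm2 n M (\<lambda>k x. f i k x - h k x)) \<le> 2 * inverse (real (Suc i)) + 2 * tuple_norm2 n M (\<lambda>k x. g i k x - h k x)"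
    proof
      fix i
      show "norm (tuple_norm2 n M (\<lambda>k x. f i k x - h k x)) \<le> 2 * inverse (real (Suc i)) + 2 * tuple_norm2 n M (\<lambda>k x. g i k x - h k x)"
        using tuple_norm2_triangle[OF that(1)[of i] that(2)[of i] that(3)] that(4)[of i] by simp
    qed
  qed
  have "(\<lambda>i. tuple_norm2 n M1 (\<lambda>k x. e i k x - w k x)) \<longlonglongrightarrow> 0"
    by (rule *[OF S_L2(1)[OF e(1)] graph_L2(1)[OF graph] L(1) e(2) l1])
  moreover have "(\<lambda>i. tuple_norm2 n M2 (\<lambda>k x. v i k x - \<eta> k x)) \<longlonglongrightarrow> 0"
    by (rule *[OF S_L2(2)[OF e(1)] graph_L2(2)[OF graph] L(2) e(3) l2])
  ultimately show ?thesis unfolding graph_def using L e(1) by blast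
qed

text \<open>An isometry carries a convergent sequence of transforms back to a Cauchy sequence of
  originals, so the range is closed. This is the way to show that a given tuple is a
  transform.\<close>

lemma graph_complete_right:
  assumes graph: "\<And>i. graph (u i) (\<psi> i)" and L: "tuple_L2 n M2 \<eta>"
    and l2: "(\<lambda>i. tuple_norm2 n M2 (\<lambda>k x. \<psi> i k x - \<eta> k x)) \<longlonglongrightarrow> 0"
  shows "\<exists>w. graph w \<eta> \<and> (\<lambda>i. tuple_norm2 n M1 (\<lambda>k x. u i k x - w k x)) \<longlonglongrightarrow> 0"
proof -
  have "tuple_Cauchy n M1 u"
    using tuple_Cauchy_of_lim[OF graph_L2(2)[OF graph] L l2] by (simp add: tuple_Cauchy_def graph_iso_diff[OF graph graph])
  from tuple_L2_complete[OF graph_L2(1)[OF graph] this] obtain w where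
    w: "tuple_L2 n M1 w" "(\<lambda>i. tuple_norm2 n M1 (\<lambda>k x. u i k x - w k x)) \<longlonglongrightarrow> 0" by (elim exE conjE)
  have "graph w \<eta>" by (rule graph_closed[OF graph w(1) L w(2) l2])
  with w(2) show ?thesis by (intro exI[of _ w] conjI)
qed

lemma graph_complete_left:
  assumes graph: "\<And>i. graph (u i) (\<psi> i)" and L: "tuple_L2 n M1 w"
    and l1: "(\<lambda>i. tuple_norm2 n M1 (\<lambda>k x. u i k x - w k x)) \<longlonglongrightarrow> 0"
  shows "\<exists>\<eta>. graph w \<eta> \<and> (\<lambda>i. tuple_norm2 n M2 (\<lambda>k x. \<psi> i k x - \<eta> k x)) \<longlonglongrightarrow> 0"
proof -
  have "tuple_Cauchy n M2 \<psi>"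
    using tuple_Cauchy_of_lim[OF graph_L2(1)[OF graph] L l1] by (simp add: tuple_Cauchy_def graph_iso_diff[OF graph graph])
  from tuple_L2_complete[OF graph_L2(2)[OF graph] this] obtain \<eta> where
    w: "tuple_L2 n M2 \<eta>" "(\<lambda>i. tuple_norm2 n M2 (\<lambda>k x. \<psi> i k x - \<eta> k x)) \<longlonglongrightarrow> 0" by (elim exE conjE)
  have "graph w \<eta>" by (rule graph_closed[OF graph L w(1) l1 w(2)])
  with w(2) show ?thesis by (intro exI[of _ \<eta>] conjI)
qed

text \<open>Links the closure to explicit formulas: convergence of the originals already makes the
  transforms Cauchy in norm, so a pointwise limit of theirs must be the transform.\<close>

lemma graph_pointwise:
  assumes graph: "\<And>i. graph (u i) (\<psi> i)" and L: "tuple_L2 n M1 w"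
    and l1: "(\<lambda>i. tuple_norm2 n M1 (\<lambda>k x. u i k x - w k x)) \<longlonglongrightarrow> 0"
    and "\<And>k. k \<in> {1..n} \<Longrightarrow> \<eta> k \<in> borel_measurable (M2 k)"
    and "\<And>k. k \<in> {1..n} \<Longrightarrow> AE x in M2 k. (\<lambda>i. \<psi> i k x) \<longlonglongrightarrow> \<eta> k x"
  shows "graph w \<eta>"
proof -
  have "tuple_Cauchy n M2 \<psi>"
    using tuple_Cauchy_of_lim[OF graph_L2(1)[OF graph] L l1] by (simp add: tuple_Cauchy_def graph_iso_diff[OF graph graph])
  note lim = tuple_L2_Cauchy_limit[OF graph_L2(2)[OF graph] this assms(4,5)]
  show ?thesis by (rule graph_closed[OF graph L lim(1) l1 lim(2)])
qed

end

section \<open>The generalized eigenfunctions and their spectral weights\<close>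

text \<open>With the square root of the context, $\<zeta>_k = i \<xi>_k$ on the real axis; it always lies in the closed first quadrant.\<close>
definition zeta :: "(nat \<Rightarrow> real) \<Rightarrow> (nat \<Rightarrow> real) \<Rightarrow> nat \<Rightarrow> real \<Rightarrow> complex" where
  "zeta c a k lam = Complex (sqrt (max 0 ((a k - lam) / c k))) (sqrt (max 0 ((lam - a k) / c k)))"

text \<open>This is -w for the w of the statement, see \<open>w_fun_W\<close>; its squared modulus
  is the common denominator of the weights.\<close>

definition zeta_sum :: "nat \<Rightarrow> (nat \<Rightarrow> real) \<Rightarrow> (nat \<Rightarrow> real) \<Rightarrow> real \<Rightarrow> complex" where
  "zeta_sum n c a lam = (\<Sum>l\<in>{1..n}. of_real (c l) * zeta c a l lam)"

definition edge_exp :: "real \<Rightarrow> nat \<Rightarrow> nat \<Rightarrow> real \<Rightarrow> complex" where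
  "edge_exp \<kappa> k j x = (if j = k then of_real (exp (- \<kappa> * x)) else 0)"

text \<open>Component j, at lam, of the transform of exp (-\<kappa> x) on edge k, as computed in
  \<open>V_edge_exp\<close> for lam > a j. Values for lam <= a j carry no weight.\<close>

definition edge_exp_transform :: "nat \<Rightarrow> (nat \<Rightarrow> real) \<Rightarrow> (nat \<Rightarrow> real) \<Rightarrow> real \<Rightarrow> nat \<Rightarrow> nat \<Rightarrow> real \<Rightarrow> complex" where
  "edge_exp_transform n c a \<kappa> k j lam = (1 + (if j = k then cnj (zeta_sum n c a lam) / (of_real (c k) * (of_real \<kappa> + zeta c a k lam)) else 0))
      / (of_real \<kappa> + cnj (zeta c a k lam))"

lemma norm_add_pos: assumes "0 \<le> Re z" "0 < \<kappa>" shows "\<kappa> \<le> cmod (of_real \<kappa> + z)" "cmod z \<le> cmod (of_real \<kappa> + z)"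
    "of_real \<kappa> + z \<noteq> 0"
proof -
  have "\<kappa> \<le> Re (of_real \<kappa> + z)" using assms by simp
  also have "\<dots> \<le> cmod (of_real \<kappa> + z)" by (rule complex_Re_le_cmod)
  finally show 1: "\<kappa> \<le> cmod (of_real \<kappa> + z)" .
  show "cmod z \<le> cmod (of_real \<kappa> + z)" unfolding cmod_def using assms
    by (auto intro!: power_mono)
  show "of_real \<kappa> + z \<noteq> 0" using 1 assms by auto
qed

locale star =
  fixes n :: nat and c a :: "nat \<Rightarrow> real"
  assumes n1: "1 \<le> n"
    and c_pos: "k \<in> {1..n} \<Longrightarrow> 0 < c k"
    and a_nonneg: "k \<in> {1..n} \<Longrightarrow> 0 \<le> a k"
begin

abbreviation "Z \<equiv> zeta c a"
abbreviation "W \<equiv> zeta_sum n c a"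
abbreviation "vv \<equiv> edge_exp_transform n c a"

lemma Re_zeta: "0 \<le> Re (zeta c a k lam)" and Im_zeta: "0 \<le> Im (zeta c a k lam)"
  by (auto simp: zeta_def)

lemma Im_zeta_eq_0: "k \<in> {1..n} \<Longrightarrow> lam \<le> a k \<Longrightarrow> Im (Z k lam) = 0"
  using c_pos[of k] by (simp add: zeta_def max_def divide_le_0_iff field_simps)

lemma Im_zeta_pos: "k \<in> {1..n} \<Longrightarrow> a k < lam \<Longrightarrow> Im (Z k lam) = sqrt ((lam - a k) / c k) \<and> Re (Z k lam) = 0 \<and> Im (Z k lam) > 0"
  using c_pos[of k] by (auto simp: zeta_def max_def field_simps)

lemma zeta_sq: assumes "k \<in> {1..n}" shows "of_real (c k) * (Z k lam)^2 = of_real (a k - lam)"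
proof (cases "lam \<le> a k")
  case True
  then have "(a k - lam) / c k \<ge> 0" "Z k lam = of_real (sqrt ((a k - lam) / c k))"
    using c_pos[OF assms] by (auto simp: zeta_def complex_eq_iff max_def divide_simps)
  then show ?thesis using c_pos[OF assms] by (simp flip: of_real_power of_real_mult add: real_sqrt_pow2)
next
  case False
  then have "(lam - a k) / c k \<ge> 0" "Z k lam = \<i> * of_real (sqrt ((lam - a k) / c k))"
    using c_pos[OF assms] by (auto simp: zeta_def complex_eq_iff max_def divide_simps)
  then show ?thesis using c_pos[OF assms]
    by (simp add: power_mult_distrib flip: of_real_power of_real_mult of_real_minus)
qed

lemma norm_zeta: assumes "k \<in> {1..n}" shows "cmod (Z k lam) = sqrt (\<bar>lam - a k\<bar> / c k)"
proof -
  have "c k * (cmod (Z k lam))^2 = \<bar>a k - lam\<bar>"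
    using arg_cong[OF zeta_sq[OF assms, of lam], of cmod] c_pos[OF assms]
    by (simp add: norm_mult norm_power del: of_real_diff)
  then have "(cmod (Z k lam))^2 = \<bar>lam - a k\<bar> / c k" using c_pos[OF assms] by (simp add: field_simps)
  then show ?thesis by (metis norm_ge_zero real_sqrt_abs real_sqrt_power abs_of_nonneg real_sqrt_pow2_iff real_sqrt_unique)
qed

lemma zeta_nz: "0 < \<kappa> \<Longrightarrow> of_real \<kappa> + zeta c a k lam \<noteq> 0" "0 < \<kappa> \<Longrightarrow> of_real \<kappa> + cnj (zeta c a k lam) \<noteq> 0"
  by (rule norm_add_pos, simp_all add: Re_zeta)+

lemma xi_zeta: assumes "k \<in> {1..n}" shows "xi c a k (of_real lam) = - \<i> * Z k lam"
proof -
  have c: "c k > 0" using c_pos assms by auto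
  define r where "r = (lam - a k) / c k"
  have x: "xi c a k (of_real lam) = psqrt (of_real r)" by (simp add: xi_def r_def)
  show ?thesis
  proof (cases "r \<ge> 0")
    case True
    then have "argm (of_real r) = 0" by (cases "r = 0") (auto simp: argm_def Arg_of_real Arg_zero)
    then have "psqrt (of_real r) = of_real (sqrt r)" using True by (simp add: psqrt_def)
    moreover have "Z k lam = \<i> * of_real (sqrt r)"
      using True c by (auto simp: zeta_def r_def complex_eq_iff max_def divide_simps split: if_splits)
    ultimately show ?thesis using x by simp
  next
    case False
    \<comment> \<open>On the negative axis the chosen branch takes the argument -pi, so the root is
      -\<i> times a positive number and exp (-\<i> \<xi> x) decays.\<close>
    then have "argm (of_real r) = - pi" by (auto simp: argm_def Arg_of_real)
    then have "psqrt (of_real r) = of_real (sqrt (-r)) * cis (- (pi/2))" using False by (simp add: psqrt_def)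
    also have "cis (- (pi/2)) = - \<i>" by (simp add: complex_eq_iff)
    finally have "psqrt (of_real r) = - \<i> * of_real (sqrt (-r))" by simp
    moreover have "Z k lam = of_real (sqrt (-r))"
      using False c by (auto simp: zeta_def r_def complex_eq_iff max_def divide_simps split: if_splits)
    ultimately show ?thesis using x by simp
  qed
qed

lemma w_fun_W: "w_fun n c a lam = - W lam"
proof -
  have "(\<Sum>j\<in>{1..n}. of_real (c j) * xi c a j (of_real lam)) = - \<i> * W lam"
    unfolding zeta_sum_def sum_distrib_left by (intro sum.cong refl) (simp add: xi_zeta)
  then show ?thesis by (simp add: w_fun_def)
qed

text \<open>The density q expressed by the imaginary part of \<open>Z j lam\<close>, which vanishes
  below a j by itself: the case distinction of \<open>q\<close> disappears and integrals over the
  bands become integrals over the whole line.\<close>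

definition weight :: "nat \<Rightarrow> real \<Rightarrow> real" where
  "weight j lam = c j * Im (Z j lam) / (pi * (cmod (W lam))^2)"

lemma q_weight: assumes "k \<in> {1..n}" shows "q n c a k lam = weight k lam"
  using Im_zeta_eq_0[OF assms, of lam] by (auto simp: q_def weight_def w_fun_W xi_zeta[OF assms])

lemma weight_nonneg: "k \<in> {1..n} \<Longrightarrow> 0 \<le> weight k lam"
  using c_pos[of k] Im_zeta[of k lam] by (simp add: weight_def)

lemma cnj_edge_exp_transform: "cnj (vv \<kappa> k j lam) = (1 + (if j = k then W lam / (of_real (c k) * (of_real \<kappa> + cnj (Z k lam))) else 0))
      / (of_real \<kappa> + Z k lam)"
  by (simp add: edge_exp_transform_def)

text \<open>The numerator telescopes to B W / Bc - Ac Wc / A. In the application Wc, Ac, Bc are the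
  conjugates of W, A, B, and the right-hand side is the conjugate of 1 / (W A B) minus this number,
  that is, an imaginary part.\<close>

lemma jump_algebra:
  fixes W Wc A Ac B Bc :: complex
  assumes "W \<noteq> 0" "Wc \<noteq> 0" "A \<noteq> 0" "Ac \<noteq> 0" "B \<noteq> 0" "Bc \<noteq> 0"
  shows "((W - Wc) + (A - Ac) * Wc / A + (B - Bc) * W / Bc) / (Ac * B * (W * Wc)) = 1 / (Wc * Ac * Bc) - 1 / (W * A * B)"
  using assms by (simp add: field_simps)

lemma Im_as_diff: "complex_of_real (Im z) = (z - cnj z) / (2 * \<i>)"
  by (simp add: complex_eq_iff)

text \<open>When both brackets are expanded, the constant term sums to Im W, each single correction
  survives only at j = k or j = l, and the product of the corrections only when k = l. The first
  three pieces combine to the imaginary part of one algebraic function with a continuation to the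
  lower half-plane; the last is the diagonal term.\<close>

lemma gram_pointwise:
  assumes k: "k \<in> {1..n}" and l: "l \<in> {1..n}" and \<kappa>: "0 < \<kappa>" and \<mu>: "0 < \<mu>" and W: "W lam \<noteq> 0"
  shows "(\<Sum>j\<in>{1..n}. of_real (weight j lam) * (vv \<kappa> k j lam * cnj (vv \<mu> l j lam))) =
    of_real (- Im (1 / (W lam * (of_real \<kappa> + Z k lam) * (of_real \<mu> + Z l lam))) / pi
      + (if k = l then Im (Z k lam) / (c k * (cmod (of_real \<kappa> + Z k lam))^2 * (cmod (of_real \<mu> + Z k lam))^2) / pi else 0))"
proof -
  define A where "A = of_real \<kappa> + Z k lam"
  define B where "B = of_real \<mu> + Z l lam"
  define w where "w = W lam"
  have nz: "A \<noteq> 0" "cnj A \<noteq> 0" "B \<noteq> 0" "cnj B \<noteq> 0" "w \<noteq> 0" "cnj w \<noteq> 0"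
    using zeta_nz[OF \<kappa>, of k lam] zeta_nz[OF \<mu>, of l lam] W by (auto simp: A_def B_def w_def)
  have ck: "c k \<noteq> 0" "c l \<noteq> 0" using c_pos k l by force+
  define X where "X = cnj w / (of_real (c k) * A)"
  define Y where "Y = w / (of_real (c l) * cnj B)"
  define g where "g = (\<lambda>j. complex_of_real (c j * Im (Z j lam)))"
  define E where "E = (if k = l then g k * X * Y else 0)"
  have v1: "vv \<kappa> k j lam = (1 + (if j = k then X else 0)) / cnj A" for j
    by (simp add: edge_exp_transform_def X_def A_def w_def)
  have v2: "cnj (vv \<mu> l j lam) = (1 + (if j = l then Y else 0)) / B" for j
    unfolding cnj_edge_exp_transform by (simp add: Y_def B_def w_def)
  have ww: "complex_of_real ((cmod w)^2) = w * cnj w" by (rule complex_norm_square)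
  have q: "complex_of_real (weight j lam) = g j / (of_real pi * (w * cnj w))" for j
    unfolding weight_def g_def w_def[symmetric] of_real_divide of_real_mult[of pi] ww ..
  have "(\<Sum>j\<in>{1..n}. of_real (weight j lam) * (vv \<kappa> k j lam * cnj (vv \<mu> l j lam))) =
     (\<Sum>j\<in>{1..n}. g j * ((1 + (if j = k then X else 0)) * (1 + (if j = l then Y else 0)))) / (of_real pi * (w * cnj w) * (cnj A * B))"
    unfolding sum_divide_distrib by (intro sum.cong refl) (simp add: v1 v2 q)
  also have "(\<Sum>j\<in>{1..n}. g j * ((1 + (if j = k then X else 0)) * (1 + (if j = l then Y else 0)))) =
     (\<Sum>j\<in>{1..n}. g j + ((if j = k then g j * X else 0) + ((if j = l then g j * Y else 0) + (if j = k then E else 0))))"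
    by (intro sum.cong refl) (auto simp: algebra_simps E_def)
  also have "\<dots> = (\<Sum>j\<in>{1..n}. g j) + (g k * X + (g l * Y + E))"
    unfolding sum.distrib using k l by (simp add: sum.delta)
  also have "(\<Sum>j\<in>{1..n}. g j) = of_real (Im w)"
    unfolding g_def w_def zeta_sum_def by simp
  \<comment> \<open>Imaginary parts are written as differences z - cnj z, the form in which the
    three pieces telescope.\<close>
  also have "of_real (Im w) = (w - cnj w) / (2 * \<i>)" by (rule Im_as_diff)
  also have "g k * X = (A - cnj A) * cnj w / A / (2 * \<i>)"
  proof -
    have "of_real (Im (Z k lam)) = (A - cnj A) / (2 * \<i>)"
      using Im_as_diff[of A] by (simp add: A_def)
    then show ?thesis using ck by (simp add: g_def X_def)
  qed
  also have "g l * Y = (B - cnj B) * w / cnj B / (2 * \<i>)"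
  proof -
    have "of_real (Im (Z l lam)) = (B - cnj B) / (2 * \<i>)"
      using Im_as_diff[of B] by (simp add: B_def)
    then show ?thesis using ck by (simp add: g_def Y_def)
  qed
  also have "((w - cnj w) / (2 * \<i>) + ((A - cnj A) * cnj w / A / (2 * \<i>) + ((B - cnj B) * w / cnj B / (2 * \<i>) + E))) / (of_real pi * (w * cnj w) * (cnj A * B))
    = (((w - cnj w) + (A - cnj A) * cnj w / A + (B - cnj B) * w / cnj B) / (cnj A * B * (w * cnj w))) / (2 * \<i> * of_real pi) + E / (of_real pi * (w * cnj w) * (cnj A * B))"
    by (simp add: add_divide_distrib mult_ac)
  also have "((w - cnj w) + (A - cnj A) * cnj w / A + (B - cnj B) * w / cnj B) / (cnj A * B * (w * cnj w)) = 1 / (cnj w * cnj A * cnj B) - 1 / (w * A * B)"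
    by (rule jump_algebra[OF nz(5,6,1,2,3,4)])
  also have "1 / (cnj w * cnj A * cnj B) - 1 / (w * A * B) = - (2 * \<i> * of_real (Im (1 / (w * A * B))))"
    by (simp add: Im_as_diff)
  also have "E / (of_real pi * (w * cnj w) * (cnj A * B)) =
     of_real (if k = l then Im (Z k lam) / (c k * (cmod (of_real \<kappa> + Z k lam))^2 * (cmod (of_real \<mu> + Z k lam))^2) / pi else 0)"
  proof (cases "k = l")
    case True
    have AB: "complex_of_real ((cmod A)^2) = A * cnj A" "complex_of_real ((cmod B)^2) = B * cnj B" by (rule complex_norm_square)+
    have "complex_of_real (Im (Z k lam) / (c k * (cmod A)^2 * (cmod B)^2) / pi) =
       of_real (Im (Z k lam)) / (of_real (c k) * (A * cnj A) * (B * cnj B)) / of_real pi"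
      by (simp only: of_real_divide of_real_mult AB)
    also have "\<dots> = g k * X * Y / (of_real pi * (w * cnj w) * (cnj A * B))"
      using nz ck True by (simp add: g_def X_def Y_def field_simps)
    finally show ?thesis using True by (simp add: A_def B_def E_def)
  qed (simp add: E_def)
  finally show ?thesis by (simp add: A_def B_def w_def)
qed

end

section \<open>Integrals over the spectral parameter\<close>

lemma has_bochner_integral_FTC_Ioi:
  fixes f F :: "real \<Rightarrow> real"
  assumes F: "\<And>x. a < x \<Longrightarrow> DERIV F x :> f x" and f: "\<And>x. a < x \<Longrightarrow> isCont f x"
    and nn: "\<And>x. a < x \<Longrightarrow> 0 \<le> f x"
    and A: "(F \<longlongrightarrow> A) (at_right a)" and B: "(F \<longlongrightarrow> B) at_top"
  shows "has_bochner_integral lborel (\<lambda>x. indicator {a<..} x * f x) (B - A)"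
proof -
  have 1: "set_integrable lborel (einterval (ereal a) \<infinity>) f"
    and 2: "(LBINT x=ereal a..\<infinity>. f x) = B - A"
    by (rule interval_integral_FTC_nonneg[where F=F and A=A and B=B];
        use assms in \<open>auto simp: ereal_tendsto_simps\<close>)+
  have e: "einterval (ereal a) \<infinity> = {a<..}" by (auto simp: einterval_def)
  show ?thesis
    using 1 2 unfolding e interval_integral_to_infinity_eq
    by (simp add: set_integrable_def set_lebesgue_integral_def has_bochner_integral_iff)
qed

text \<open>Substitution y = sqrt ((x - a) / c), under which dx = 2 c y dy; G is a primitive of the
  transformed integrand.\<close>

lemma has_bochner_integral_sqrt_subst:
  fixes p G :: "real \<Rightarrow> real"
  assumes c: "c > 0"
    and G: "\<And>y. 0 < y \<Longrightarrow> DERIV G y :> 2 * c * y * p y" and p: "\<And>y. 0 < y \<Longrightarrow> isCont p y"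
    and nn: "\<And>y. 0 < y \<Longrightarrow> 0 \<le> p y"
    and A: "(G \<longlongrightarrow> A) (at_right 0)" and B: "(G \<longlongrightarrow> B) at_top"
  shows "has_bochner_integral lborel (\<lambda>x. indicator {a<..} x * p (sqrt ((x - a) / c))) (B - A)"
proof (rule has_bochner_integral_FTC_Ioi[where F="\<lambda>x. G (sqrt ((x - a) / c))"])
  fix x assume x: "a < x"
  define y where "y = sqrt ((x - a) / c)"
  have y: "y > 0" using x c by (simp add: y_def)
  have "((\<lambda>x. sqrt ((x - a) / c)) has_real_derivative (1 / (2 * c * y))) (at x)"
    unfolding y_def using x c by (auto intro!: derivative_eq_intros simp: field_simps)
  from DERIV_chain2[OF G[OF y, unfolded y_def] this]
  show "DERIV (\<lambda>x. G (sqrt ((x - a) / c))) x :> p (sqrt ((x - a) / c))"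
    using y c by (simp add: y_def[symmetric])
  have "isCont (\<lambda>x. sqrt ((x - a) / c)) x" using x c by (intro continuous_intros) auto
  then show "isCont (\<lambda>x. p (sqrt ((x - a) / c))) x"
    by (rule isCont_o2[where g=p]) (rule p[OF y, unfolded y_def])
  show "0 \<le> p (sqrt ((x - a) / c))" using nn[OF y] by (simp add: y_def)
next
  have "filterlim (\<lambda>x. sqrt ((x - a) / c)) (at_right 0) (at_right a)"
    unfolding filterlim_at
  proof (intro conjI)
    show "\<forall>\<^sub>F x in at_right a. sqrt ((x - a) / c) \<in> {0<..} \<and> sqrt ((x - a) / c) \<noteq> 0"
      using c by (auto simp: eventually_at_filter)
    have "((\<lambda>x. sqrt ((x - a) / c)) \<longlongrightarrow> sqrt ((a - a) / c)) (at_right a)"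
      by (intro tendsto_intros) (use c in auto)
    then show "((\<lambda>x. sqrt ((x - a) / c)) \<longlongrightarrow> 0) (at_right a)" by simp
  qed
  then show "((\<lambda>x. G (sqrt ((x - a) / c))) \<longlongrightarrow> A) (at_right a)" by (rule filterlim_compose[OF A])
  have "filterlim (\<lambda>x. sqrt ((x - a) / c)) at_top at_top" using c by real_asymp
  then show "((\<lambda>x. G (sqrt ((x - a) / c))) \<longlongrightarrow> B) at_top" by (rule filterlim_compose[OF B])
qed

lemma arctan_scaled_DERIV:
  assumes "\<kappa> > 0" shows "((\<lambda>y. arctan (y / \<kappa>)) has_real_derivative (\<kappa> / (\<kappa>^2 + y^2))) (at y)"
proof -
  have "((\<lambda>y. arctan (y / \<kappa>)) has_real_derivative (inverse (1 + (y / \<kappa>)^2) * (1 / \<kappa>))) (at y)"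
    by (intro DERIV_chain2[OF DERIV_arctan] DERIV_cdivide DERIV_ident)
  moreover have "1 + (y / \<kappa>)^2 = (\<kappa>^2 + y^2) / \<kappa>^2" using assms by (simp add: field_simps)
  ultimately show ?thesis using assms by (simp add: power2_eq_square)
qed

text \<open>Up to the factor pi the value is the inner product of exp (-\<kappa> x) and exp (-\<mu>
  x). After the substitution the integrand is 2 y^2 / ((\<kappa>^2 + y^2) (\<mu>^2 + y^2)).\<close>

lemma diag_integral:
  assumes c: "c > 0" and \<kappa>: "\<kappa> > 0" and \<mu>: "\<mu> > (0::real)"
  shows "has_bochner_integral lborel (\<lambda>x. indicator {a<..} x *
     (sqrt ((x - a) / c) / (c * (\<kappa>^2 + (sqrt ((x - a) / c))^2) * (\<mu>^2 + (sqrt ((x - a) / c))^2)))) (pi / (\<kappa> + \<mu>))"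
proof -
  define p where "p = (\<lambda>y. y / (c * (\<kappa>^2 + y^2) * (\<mu>^2 + y^2)))"
  have pos: "\<kappa>^2 + y^2 > 0" "\<mu>^2 + y^2 > 0" for y using \<kappa> \<mu> by (auto intro: add_pos_nonneg)
  have nz: "\<kappa>^2 + y^2 \<noteq> 0" "\<mu>^2 + y^2 \<noteq> 0" for y using pos[of y] by auto
  have pc: "isCont p y" for y unfolding p_def by (intro continuous_intros) (use nz[of y] c in auto)
  have p0: "0 < y \<Longrightarrow> 0 \<le> p y" for y unfolding p_def using c by auto
  have "has_bochner_integral lborel (\<lambda>x. indicator {a<..} x * p (sqrt ((x - a) / c))) (pi / (\<kappa> + \<mu>))"
  proof (cases "\<kappa> = \<mu>")
    case False
    then have d: "\<kappa>^2 - \<mu>^2 \<noteq> 0" using \<kappa> \<mu> by (simp add: power2_eq_iff)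
    \<comment> \<open>Primitive by partial fractions; its denominator \<kappa>^2 - \<mu>^2 forces a
      separate primitive when \<kappa> = \<mu>.\<close>
    define G where "G = (\<lambda>y. 2 / (\<kappa>^2 - \<mu>^2) * (\<kappa> * arctan (y / \<kappa>) - \<mu> * arctan (y / \<mu>)))"
    have "has_bochner_integral lborel (\<lambda>x. indicator {a<..} x * p (sqrt ((x - a) / c))) (pi / (\<kappa> + \<mu>) - 0)"
    proof (rule has_bochner_integral_sqrt_subst[where G=G, OF c _ pc p0])
      fix y :: real assume y: "0 < y"
      have "(G has_real_derivative 2 / (\<kappa>^2 - \<mu>^2) * (\<kappa> * (\<kappa> / (\<kappa>^2 + y^2)) - \<mu> * (\<mu> / (\<mu>^2 + y^2)))) (at y)"
        unfolding G_def by (intro DERIV_cmult DERIV_diff arctan_scaled_DERIV \<kappa> \<mu>)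
      moreover have "2 / (\<kappa>^2 - \<mu>^2) * (\<kappa> * (\<kappa> / (\<kappa>^2 + y^2)) - \<mu> * (\<mu> / (\<mu>^2 + y^2))) = 2 * c * y * p y"
      proof -
        have "\<kappa> * (\<kappa> / (\<kappa>^2 + y^2)) - \<mu> * (\<mu> / (\<mu>^2 + y^2)) = (\<kappa>^2 - \<mu>^2) * y^2 / ((\<kappa>^2 + y^2) * (\<mu>^2 + y^2))"
          using nz[of y] by (simp add: divide_simps) (simp add: algebra_simps power2_eq_square)
        then show ?thesis using d c by (simp add: p_def power2_eq_square)
      qed
      ultimately show "DERIV G y :> 2 * c * y * p y" by simp
    next
      have "isCont G 0" unfolding G_def by (intro continuous_intros) (use \<kappa> \<mu> in auto)
      then have "(G \<longlongrightarrow> G 0) (at_right 0)" by (simp add: continuous_within filterlim_at_split)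
      then show "(G \<longlongrightarrow> 0) (at_right 0)" by (simp add: G_def)
      have t: "((\<lambda>y. arctan (y / r)) \<longlongrightarrow> pi / 2) at_top" if "r > 0" for r
        by (rule filterlim_compose[OF tendsto_arctan_at_top]) (use that in real_asymp)
      have "(G \<longlongrightarrow> 2 / (\<kappa>^2 - \<mu>^2) * (\<kappa> * (pi / 2) - \<mu> * (pi / 2))) at_top"
        unfolding G_def by (intro tendsto_intros t \<kappa> \<mu>)
      also have "2 / (\<kappa>^2 - \<mu>^2) * (\<kappa> * (pi / 2) - \<mu> * (pi / 2)) = pi / (\<kappa> + \<mu>)"
        using d \<kappa> \<mu> by (simp add: divide_simps) (simp add: algebra_simps power2_eq_square)
      finally show "(G \<longlongrightarrow> pi / (\<kappa> + \<mu>)) at_top" .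
    qed
    then show ?thesis by simp
  next
    case True
    define G where "G = (\<lambda>y. arctan (y / \<kappa>) / \<kappa> - y / (\<kappa>^2 + y^2))"
    have "has_bochner_integral lborel (\<lambda>x. indicator {a<..} x * p (sqrt ((x - a) / c))) (pi / (\<kappa> + \<mu>) - 0)"
    proof (rule has_bochner_integral_sqrt_subst[where G=G, OF c _ pc p0])
      fix y :: real assume y: "0 < y"
      have d2: "((\<lambda>y. y / (\<kappa>^2 + y^2)) has_real_derivative (\<kappa>^2 - y^2) / (\<kappa>^2 + y^2)^2) (at y)"
        using nz[of y] by (auto intro!: derivative_eq_intros simp: power2_eq_square)
      have "(G has_real_derivative (\<kappa> / (\<kappa>^2 + y^2)) / \<kappa> - (\<kappa>^2 - y^2) / (\<kappa>^2 + y^2)^2) (at y)"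
        unfolding G_def by (intro DERIV_diff DERIV_cdivide d2 arctan_scaled_DERIV \<kappa>)
      moreover have "(\<kappa> / (\<kappa>^2 + y^2)) / \<kappa> - (\<kappa>^2 - y^2) / (\<kappa>^2 + y^2)^2 = 2 * c * y * p y"
        using nz[of y] \<kappa> c unfolding p_def True[symmetric]
        by (simp add: divide_simps) (simp add: algebra_simps power2_eq_square)
      ultimately show "DERIV G y :> 2 * c * y * p y" by simp
    next
      have "isCont G 0" unfolding G_def by (intro continuous_intros) (use \<kappa> \<mu> in auto)
      then have "(G \<longlongrightarrow> G 0) (at_right 0)" by (simp add: continuous_within filterlim_at_split)
      then show "(G \<longlongrightarrow> 0) (at_right 0)" by (simp add: G_def)
      have t: "((\<lambda>y. arctan (y / \<kappa>)) \<longlongrightarrow> pi / 2) at_top"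
        by (rule filterlim_compose[OF tendsto_arctan_at_top]) (use \<kappa> in real_asymp)
      have t2: "((\<lambda>y. y / (\<kappa>^2 + y^2)) \<longlongrightarrow> 0) at_top" by real_asymp
      have "(G \<longlongrightarrow> (pi / 2) / \<kappa> - 0) at_top"
        unfolding G_def by (intro tendsto_diff tendsto_divide t t2 tendsto_const) (use \<kappa> in auto)
      then show "(G \<longlongrightarrow> pi / (\<kappa> + \<mu>)) at_top" by (simp add: True[symmetric])
    qed
    then show ?thesis by simp
  qed
  then show ?thesis by (simp add: p_def)
qed

text \<open>An inverse square-root singularity at a and decay like |x|^(-3/2) are both integrable.
  The function serves as a majorant that is independent of the distance between the line of
  integration and the real axis.\<close>

lemma dominator_integrable:
  assumes c: "c > 0" and \<kappa>: "\<kappa> > 0"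
  shows "integrable lborel (\<lambda>x. 1 / (c * sqrt (\<bar>x - a\<bar> / c) * (\<kappa>^2 + \<bar>x - a\<bar> / c)))"
proof -
  define p where "p = (\<lambda>y. 1 / (c * y * (\<kappa>^2 + y^2)))"
  have pos: "\<kappa>^2 + y^2 > 0" for y using \<kappa> by (auto intro: add_pos_nonneg)
  have nz: "\<kappa>^2 + y^2 \<noteq> 0" for y using pos[of y] by auto
  define G where "G = (\<lambda>y. 2 / \<kappa> * arctan (y / \<kappa>))"
  have "has_bochner_integral lborel (\<lambda>x. indicator {a<..} x * p (sqrt ((x - a) / c))) (2 / \<kappa> * (pi / 2) - 0)"
  proof (rule has_bochner_integral_sqrt_subst[where G=G, OF c])
    fix y :: real assume y: "0 < y"
    have "(G has_real_derivative 2 / \<kappa> * (\<kappa> / (\<kappa>^2 + y^2))) (at y)"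
      unfolding G_def by (intro DERIV_cmult arctan_scaled_DERIV \<kappa>)
    moreover have "2 / \<kappa> * (\<kappa> / (\<kappa>^2 + y^2)) = 2 * c * y * p y" using c y \<kappa> by (simp add: p_def)
    ultimately show "DERIV G y :> 2 * c * y * p y" by simp
    show "isCont p y" unfolding p_def by (intro continuous_intros) (use nz[of y] c y in auto)
    show "0 \<le> p y" unfolding p_def using c y pos[of y] by auto
  next
    have "isCont G 0" unfolding G_def by (intro continuous_intros) (use \<kappa> in auto)
    then have "(G \<longlongrightarrow> G 0) (at_right 0)" by (simp add: continuous_within filterlim_at_split)
    then show "(G \<longlongrightarrow> 0) (at_right 0)" by (simp add: G_def)
    have t: "((\<lambda>y. arctan (y / \<kappa>)) \<longlongrightarrow> pi / 2) at_top"
      by (rule filterlim_compose[OF tendsto_arctan_at_top]) (use \<kappa> in real_asymp)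
    show "(G \<longlongrightarrow> 2 / \<kappa> * (pi / 2)) at_top" unfolding G_def by (intro tendsto_intros t)
  qed
  then have i: "integrable lborel (\<lambda>x. indicator {a<..} x * p (sqrt ((x - a) / c)))"
    by (simp add: has_bochner_integral_iff)
  \<comment> \<open>The half-line to the left of a is obtained by reflection at a.\<close>
  have i2: "integrable lborel (\<lambda>x. indicator {a<..} (2 * a + (-1) * x) * p (sqrt ((2 * a + (-1) * x - a) / c)))"
    by (rule lborel_integrable_real_affine[OF i]) simp
  have eq: "indicator {a<..} x * p (sqrt ((x - a) / c)) + indicator {a<..} (2 * a + (-1) * x) * p (sqrt ((2 * a + (-1) * x - a) / c))
     = 1 / (c * sqrt (\<bar>x - a\<bar> / c) * (\<kappa>^2 + \<bar>x - a\<bar> / c))" for x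
    using c by (cases x a rule: linorder_cases) (auto simp: p_def)
  from Bochner_Integration.integrable_add[OF i i2] show ?thesis unfolding eq .
qed


text \<open>Numbers in the closed first quadrant cannot cancel each other. This bounds W from below
  by each of its terms, and so keeps it away from zero.\<close>

lemma norm_le_norm_sum_quadrant:
  assumes "finite I" "k \<in> I" "\<And>l. l \<in> I \<Longrightarrow> 0 \<le> Re (f l) \<and> 0 \<le> Im (f l)"
  shows "cmod (f k) \<le> cmod (sum f I)"
proof -
  have "Re (f k) \<le> (\<Sum>l\<in>I. Re (f l))" "Im (f k) \<le> (\<Sum>l\<in>I. Im (f l))"
    using assms by (auto intro!: member_le_sum)
  then show ?thesis using assms(3)[OF assms(2)] unfolding cmod_def Re_sum Im_sum
    by (intro real_sqrt_le_mono add_mono power_mono) auto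
qed

lemma norm_add_sq: assumes "0 \<le> Re z" "0 < \<kappa>" shows "\<kappa>^2 + (cmod z)^2 \<le> (cmod (of_real \<kappa> + z))^2"
  using assms by (simp add: cmod_power2 power2_sum)

text \<open>The inequality 1 / (A B) <= 1 / A^2 + 1 / B^2 separates the two edges; in each summand W
  is then estimated by the term of the same edge, so only one branch point occurs per
  summand.\<close>

lemma kernel_bound:
  fixes w z1 z2 :: complex
  assumes z: "0 \<le> Re z1" "0 \<le> Re z2" and s: "0 < s1" "s1 \<le> cmod z1" "0 < s2" "s2 \<le> cmod z2"
    and c: "0 < c1" "0 < c2" and w: "c1 * cmod z1 \<le> cmod w" "c2 * cmod z2 \<le> cmod w" and k: "0 < \<kappa>" "0 < \<mu>"
  shows "cmod (1 / (w * (of_real \<kappa> + z1) * (of_real \<mu> + z2)))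
     \<le> 1 / (c1 * s1 * (\<kappa>^2 + s1^2)) + 1 / (c2 * s2 * (\<mu>^2 + s2^2))"
proof -
  define A where "A = cmod (of_real \<kappa> + z1)"
  define B where "B = cmod (of_real \<mu> + z2)"
  define d where "d = cmod w"
  have A: "\<kappa>^2 + s1^2 \<le> A^2"
    using norm_add_sq[OF z(1) k(1)] power_mono[OF s(2), of 2] s unfolding A_def by linarith
  have B: "\<mu>^2 + s2^2 \<le> B^2"
    using norm_add_sq[OF z(2) k(2)] power_mono[OF s(4), of 2] s unfolding B_def by linarith
  have A0: "A > 0" using norm_add_pos(1)[OF z(1) k(1)] k unfolding A_def by linarith
  have B0: "B > 0" using norm_add_pos(1)[OF z(2) k(2)] k unfolding B_def by linarith
  have d1: "c1 * s1 \<le> d" using w(1) mult_left_mono[OF s(2), of c1] c unfolding d_def by linarith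
  have d2: "c2 * s2 \<le> d" using w(2) mult_left_mono[OF s(4), of c2] c unfolding d_def by linarith
  have d0: "d > 0" using d1 c s by (meson less_le_trans mult_pos_pos)
  have pos: "0 < c1 * s1 * (\<kappa>^2 + s1^2)" "0 < c2 * s2 * (\<mu>^2 + s2^2)"
    using c s k by (auto intro!: mult_pos_pos add_pos_nonneg)
  have "1 / (A * B) \<le> 1 / A^2 + 1 / B^2"
  proof -
    have "2 * (1/A) * (1/B) \<le> (1/A)^2 + (1/B)^2" by (rule sum_squares_bound)
    moreover have "0 < (1/A) * (1/B)" using A0 B0 by simp
    ultimately have "(1/A) * (1/B) \<le> (1/A)^2 + (1/B)^2" by linarith
    then show ?thesis by (simp add: power_one_over)
  qed
  then have "1 / d * (1 / (A * B)) \<le> 1 / d * (1 / A^2 + 1 / B^2)" using d0 by (intro mult_left_mono) auto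
  also have "\<dots> = 1 / (d * A^2) + 1 / (d * B^2)" by (simp add: distrib_left)
  also have "\<dots> \<le> 1 / (c1 * s1 * (\<kappa>^2 + s1^2)) + 1 / (c2 * s2 * (\<mu>^2 + s2^2))"
    by (intro add_mono frac_le mult_mono d1 d2 A B pos) (use d0 in auto)
  finally show ?thesis by (simp add: norm_divide norm_mult A_def B_def d_def mult.assoc)
qed

text \<open>The continuation of $\<zeta>_k$ to the lower half-plane, where it stays in the first quadrant, so that the denominators below do not vanish.\<close>
definition zeta_lower :: "(nat \<Rightarrow> real) \<Rightarrow> (nat \<Rightarrow> real) \<Rightarrow> nat \<Rightarrow> complex \<Rightarrow> complex" where
  "zeta_lower c a k z = csqrt ((of_real (a k) - z) / of_real (c k))"

definition zeta_sum_lower :: "nat \<Rightarrow> (nat \<Rightarrow> real) \<Rightarrow> (nat \<Rightarrow> real) \<Rightarrow> complex \<Rightarrow> complex" where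
  "zeta_sum_lower n c a z = (\<Sum>l\<in>{1..n}. of_real (c l) * zeta_lower c a l z)"

definition kernel_lower :: "nat \<Rightarrow> (nat \<Rightarrow> real) \<Rightarrow> (nat \<Rightarrow> real) \<Rightarrow> real \<Rightarrow> real \<Rightarrow> nat \<Rightarrow> nat \<Rightarrow> complex \<Rightarrow> complex" where
  "kernel_lower n c a \<kappa> \<mu> k l z = 1 / (zeta_sum_lower n c a z * (of_real \<kappa> + zeta_lower c a k z) * (of_real \<mu> + zeta_lower c a l z))"

section \<open>The contour integral in the lower half-plane\<close>

context star begin

text \<open>For Im z <= 0 the radicand lies in the closed upper half-plane, which the principal root
  maps into the first quadrant.\<close>

lemma zeta_lower_quadrant: assumes "k \<in> {1..n}" "Im z \<le> 0" shows "0 \<le> Re (zeta_lower c a k z) \<and> 0 \<le> Im (zeta_lower c a k z)"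
proof -
  define y where "y = (of_real (a k) - z) / of_real (c k)"
  have "Im y \<ge> 0"
    using assms c_pos[OF assms(1)] by (simp add: y_def divide_simps)
  then have "0 \<le> Im (csqrt y)" using complex_Re_le_cmod[of y] by (simp add: sgn_if)
  then show ?thesis unfolding zeta_lower_def y_def[symmetric] using Re_csqrt[of y] by simp
qed

lemma norm_zeta_lower: "cmod (zeta_lower c a k z) = sqrt (cmod (of_real (a k) - z) / \<bar>c k\<bar>)"
  by (simp add: zeta_lower_def norm_csqrt norm_divide)

lemma zeta_sum_lower_ge: assumes "k \<in> {1..n}" "Im z \<le> 0" shows "c k * cmod (zeta_lower c a k z) \<le> cmod (zeta_sum_lower n c a z)"
proof -
  have "cmod (of_real (c k) * zeta_lower c a k z) \<le> cmod (zeta_sum_lower n c a z)"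
    unfolding zeta_sum_lower_def
  proof (rule norm_le_norm_sum_quadrant)
    fix l assume "l \<in> {1..n}"
    then show "0 \<le> Re (of_real (c l) * zeta_lower c a l z) \<and> 0 \<le> Im (of_real (c l) * zeta_lower c a l z)"
      using zeta_lower_quadrant[of l z] c_pos[of l] assms by simp
  qed (use assms in auto)
  then show ?thesis using c_pos[OF assms(1)] by (simp add: norm_mult)
qed

lemma kernel_lower_bound:
  assumes k: "k \<in> {1..n}" and l: "l \<in> {1..n}" and \<kappa>: "0 < \<kappa>" "0 < \<mu>" and z: "Im z \<le> 0"
    and d: "0 < d1" "d1 \<le> cmod (of_real (a k) - z)" "0 < d2" "d2 \<le> cmod (of_real (a l) - z)"
  shows "cmod (kernel_lower n c a \<kappa> \<mu> k l z) \<le> 1 / (c k * sqrt (d1 / c k) * (\<kappa>^2 + d1 / c k)) + 1 / (c l * sqrt (d2 / c l) * (\<mu>^2 + d2 / c l))"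
proof -
  have c: "c k > 0" "c l > 0" using c_pos k l by auto
  have "cmod (kernel_lower n c a \<kappa> \<mu> k l z) \<le> 1 / (c k * sqrt (d1 / c k) * (\<kappa>^2 + (sqrt (d1 / c k))^2)) + 1 / (c l * sqrt (d2 / c l) * (\<mu>^2 + (sqrt (d2 / c l))^2))"
    unfolding kernel_lower_def
    by (rule kernel_bound) (use c d \<kappa> zeta_lower_quadrant[OF k z] zeta_lower_quadrant[OF l z] zeta_sum_lower_ge[OF k z] zeta_sum_lower_ge[OF l z] in
      \<open>auto simp: norm_zeta_lower intro!: real_sqrt_le_mono divide_right_mono\<close>)
  then show ?thesis using c d by simp
qed

lemma zeta_lower_holomorphic: assumes "k \<in> {1..n}" shows "zeta_lower c a k holomorphic_on {z. Im z < 0}"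
  unfolding zeta_lower_def
proof (intro holomorphic_intros)
  show "complex_of_real (c k) \<noteq> 0" for z :: complex using c_pos[OF assms] by simp
  fix z assume "z \<in> {z. Im z < 0}"
  then have "Im ((of_real (a k) - z) / of_real (c k)) > 0" using c_pos[OF assms] by (simp add: divide_simps)
  then show "(of_real (a k) - z) / of_real (c k) \<notin> \<real>\<^sub>\<le>\<^sub>0"
    unfolding complex_nonpos_Reals_iff by linarith
qed

lemma zeta_lower_nz: assumes "k \<in> {1..n}" "Im z < 0" shows "zeta_lower c a k z \<noteq> 0"
  using assms c_pos[OF assms(1)] by (auto simp: zeta_lower_def complex_eq_iff)

lemma zeta_sum_lower_nz: assumes "Im z < 0" shows "zeta_sum_lower n c a z \<noteq> 0"
proof -
  have "0 < c 1 * cmod (zeta_lower c a 1 z)" using zeta_lower_nz[of 1 z] c_pos[of 1] n1 assms by simp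
  also have "\<dots> \<le> cmod (zeta_sum_lower n c a z)" using zeta_sum_lower_ge[of 1 z] n1 assms by simp
  finally show ?thesis by auto
qed

lemma kernel_lower_holomorphic: assumes "k \<in> {1..n}" "l \<in> {1..n}" "0 < \<kappa>" "0 < \<mu>"
  shows "kernel_lower n c a \<kappa> \<mu> k l holomorphic_on {z. Im z < 0}"
  unfolding kernel_lower_def[abs_def] zeta_sum_lower_def
proof (intro holomorphic_intros zeta_lower_holomorphic assms)
  show "l \<in> {1..n} \<Longrightarrow> l \<in> {1..n}" for l .
  fix z assume "z \<in> {z. Im z < 0}"
  then show "(\<Sum>l = 1..n. of_real (c l) * zeta_lower c a l z) * (of_real \<kappa> + zeta_lower c a k z) * (of_real \<mu> + zeta_lower c a l z) \<noteq> 0"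
    using zeta_sum_lower_nz[of z, unfolded zeta_sum_lower_def] zeta_lower_quadrant[of k z] zeta_lower_quadrant[of l z] norm_add_pos(3)[of "zeta_lower c a k z" \<kappa>] norm_add_pos(3)[of "zeta_lower c a l z" \<mu>] assms
    by auto
qed

lemma zeta_lower_tendsto: assumes "k \<in> {1..n}"
  shows "(\<lambda>m. zeta_lower c a k (of_real lam - \<i> * of_real (inverse (real (Suc m))))) \<longlonglongrightarrow> Z k lam"
proof -
  have c: "c k > 0" using c_pos assms by auto
  define y where "y = (\<lambda>m. Complex ((a k - lam) / c k) (inverse (real (Suc m)) / c k))"
  have y: "(of_real (a k) - (of_real lam - \<i> * of_real (inverse (real (Suc m))))) / of_real (c k) = y m" for m
    using c by (intro complex_eqI) (simp_all add: y_def del: of_real_inverse of_nat_Suc)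
  have lim: "y \<longlonglongrightarrow> Complex ((a k - lam) / c k) (0 / c k)"
    unfolding y_def by (intro tendsto_Complex tendsto_intros LIMSEQ_inverse_real_of_nat) (use c in auto)
  \<comment> \<open>For lam > a k the limit lies on the branch cut. All the points
    \<open>y m\<close> are in the open upper half-plane, where the sign in the formula for the root
    is constant; the remaining expressions in modulus and real part are continuous up to the
    cut.\<close>
  have cs: "csqrt (y m) = Complex (sqrt ((cmod (y m) + Re (y m)) / 2)) (sqrt ((cmod (y m) - Re (y m)) / 2))" for m
    using c by (simp add: complex_eq_iff y_def)
  have "(\<lambda>m. csqrt (y m)) \<longlonglongrightarrow> Complex (sqrt ((cmod (Complex ((a k - lam) / c k) (0 / c k)) + Re (Complex ((a k - lam) / c k) (0 / c k))) / 2))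
      (sqrt ((cmod (Complex ((a k - lam) / c k) (0 / c k)) - Re (Complex ((a k - lam) / c k) (0 / c k))) / 2))"
    unfolding cs by (intro tendsto_Complex tendsto_real_sqrt tendsto_divide tendsto_add tendsto_diff tendsto_norm tendsto_Re lim tendsto_const) auto
  also have "Complex (sqrt ((cmod (Complex ((a k - lam) / c k) (0 / c k)) + Re (Complex ((a k - lam) / c k) (0 / c k))) / 2))
      (sqrt ((cmod (Complex ((a k - lam) / c k) (0 / c k)) - Re (Complex ((a k - lam) / c k) (0 / c k))) / 2)) = Z k lam"
  proof -
    define r where "r = (a k - lam) / c k"
    have r: "(lam - a k) / c k = - r" by (simp add: r_def minus_divide_left)
    have "(\<bar>r\<bar> + r) / 2 = max 0 r" "(\<bar>r\<bar> - r) / 2 = max 0 (- r)" by auto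
    then show ?thesis unfolding zeta_def r r_def[symmetric] by (simp add: complex_norm)
  qed
  finally show ?thesis unfolding zeta_lower_def y .
qed

lemma zeta_continuous: "k \<in> {1..n} \<Longrightarrow> continuous_on UNIV (Z k)"
  using c_pos[of k] unfolding zeta_def by (intro continuous_intros continuous_on_max) auto

definition cross_bound :: "real \<Rightarrow> real \<Rightarrow> nat \<Rightarrow> nat \<Rightarrow> real \<Rightarrow> real" where
  "cross_bound \<kappa> \<mu> k l x = 1 / (c k * sqrt (\<bar>x - a k\<bar> / c k) * (\<kappa>^2 + \<bar>x - a k\<bar> / c k))
     + 1 / (c l * sqrt (\<bar>x - a l\<bar> / c l) * (\<mu>^2 + \<bar>x - a l\<bar> / c l))"

lemma cross_bound_integrable:
  "k \<in> {1..n} \<Longrightarrow> l \<in> {1..n} \<Longrightarrow> 0 < \<kappa> \<Longrightarrow> 0 < \<mu> \<Longrightarrow> integrable lborel (cross_bound \<kappa> \<mu> k l)"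
  unfolding cross_bound_def by (intro Bochner_Integration.integrable_add dominator_integrable c_pos)

lemma AE_neq: "AE x in lborel. x \<noteq> (b::real)"
  using AE_lborel_singleton[of b] .

lemma kernel_lower_line_bound:
  assumes k: "k \<in> {1..n}" and l: "l \<in> {1..n}" and \<kappa>: "0 < \<kappa>" and \<mu>: "0 < \<mu>" and e: "0 < e"
    and x: "x \<noteq> a k" "x \<noteq> a l"
  shows "cmod (kernel_lower n c a \<kappa> \<mu> k l (of_real x - \<i> * of_real e)) \<le> cross_bound \<kappa> \<mu> k l x"
proof -
  have "\<bar>x - a j\<bar> \<le> cmod (of_real (a j) - (of_real x - \<i> * of_real e))" for j
    using abs_Re_le_cmod[of "of_real (a j) - (of_real x - \<i> * of_real e)"] by simp
  then show ?thesis unfolding cross_bound_def using x e by (intro kernel_lower_bound[OF k l \<kappa> \<mu>]) auto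
qed

text \<open>Cauchy's theorem on a lower half-disc: the kernel decays like |z|^(-3/2), so the arc of
  radius R contributes O(R^(-1/2)), and the integral over [-R, R], which has the same value, tends
  to 0.\<close>

lemma kernel_lower_line_integral:
  assumes k: "k \<in> {1..n}" and l: "l \<in> {1..n}" and \<kappa>: "0 < \<kappa>" and \<mu>: "0 < \<mu>" and e: "0 < e"
  shows "(\<lambda>x. kernel_lower n c a \<kappa> \<mu> k l (of_real x - \<i> * of_real e)) \<in> borel_measurable lborel"
    "(LINT x|lborel. kernel_lower n c a \<kappa> \<mu> k l (of_real x - \<i> * of_real e)) = 0"
proof -
  define S where "S = {z. Im z < e}"
  \<comment> \<open>Translation turns the line into the real axis, which is interior to the
    half-plane \<open>S\<close> of holomorphy.\<close>
  define f where "f = (\<lambda>z. kernel_lower n c a \<kappa> \<mu> k l (z - \<i> * of_real e))"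
  have "(kernel_lower n c a \<kappa> \<mu> k l \<circ> (\<lambda>z. z - \<i> * of_real e)) holomorphic_on S"
    by (rule holomorphic_on_compose_gen[OF _ kernel_lower_holomorphic[OF k l \<kappa> \<mu>]])
       (auto simp: S_def intro!: holomorphic_intros)
  then have f: "f holomorphic_on S" by (simp add: f_def o_def)
  have S: "convex S" unfolding S_def by (rule convex_halfspace_Im_lt)
  have contS: "continuous_on S f" by (rule holomorphic_on_imp_continuous_on[OF f])
  have cont: "continuous_on UNIV (\<lambda>x. f (of_real x))"
    by (rule continuous_on_compose2[OF contS]) (use e in \<open>auto simp: S_def intro!: continuous_intros\<close>)
  then have meas: "(\<lambda>x. f (of_real x)) \<in> borel_measurable lborel"
    by (simp add: borel_measurable_continuous_onI)
  then show "(\<lambda>x. kernel_lower n c a \<kappa> \<mu> k l (of_real x - \<i> * of_real e)) \<in> borel_measurable lborel"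
    by (simp add: f_def)
  have bd: "AE x in lborel. norm (f (of_real x)) \<le> cross_bound \<kappa> \<mu> k l x"
    using AE_neq[of "a k"] AE_neq[of "a l"]
  proof eventually_elim
    case (elim x)
    show ?case unfolding f_def by (rule kernel_lower_line_bound[OF k l \<kappa> \<mu> e elim])
  qed
  have int: "integrable lborel (\<lambda>x. f (of_real x))"
    by (rule Bochner_Integration.integrable_bound[OF cross_bound_integrable[OF k l \<kappa> \<mu>] meas])
       (use bd in eventually_elim, auto)
  \<comment> \<open>Bound on the arc, where the shifted branch points a j + \<i> e are at distance
    at least R - e - a j.\<close>
  define B where "B = (\<lambda>R. 1 / (c k * sqrt ((R - e - a k) / c k) * (\<kappa>^2 + (R - e - a k) / c k))
     + 1 / (c l * sqrt ((R - e - a l) / c l) * (\<mu>^2 + (R - e - a l) / c l)))"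
  have main: "cmod (LINT x:{-R..R}|lborel. f (of_real x)) \<le> B R * R * pi"
    if R: "R > e + a k" "R > e + a l" for R
  proof -
    have R0: "R > 0" using R e a_nonneg[OF k] by linarith
    \<comment> \<open>The arc runs from -R through the lower half-plane to R, and \<open>lin\<close>
      leads back along the real axis.\<close>
    define arc where "arc = part_circlepath 0 R (-pi) 0"
    define lin where "lin = linepath (complex_of_real R) (of_real (-R))"
    have arcS: "path_image arc \<subseteq> S"
      unfolding arc_def path_image_part_circlepath'
    proof clarify
      fix t assume "t \<in> closed_segment (-pi) (0::real)"
      then have "- pi \<le> t" "t \<le> 0" by (auto simp: closed_segment_eq_real_ivl)
      then have "sin t \<le> 0" using sin_ge_zero[of "-t"] by simp
      then have "R * sin t \<le> 0" using R0 by (simp add: mult_nonneg_nonpos)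
      then show "0 + of_real R * cis t \<in> S" using e by (simp add: S_def)
    qed
    have linS: "path_image lin \<subseteq> S"
      unfolding lin_def path_image_linepath
      by (intro closed_segment_subset S) (use e in \<open>auto simp: S_def\<close>)
    have "(f has_contour_integral 0) (arc +++ lin)"
    proof (rule Cauchy_theorem_convex_simple[OF f S])
      show "valid_path (arc +++ lin)" by (intro valid_path_join) (auto simp: arc_def lin_def exp_eq_polar)
      show "path_image (arc +++ lin) \<subseteq> S" using arcS linS path_image_join_subset[of arc lin] by auto
      show "pathfinish (arc +++ lin) = pathstart (arc +++ lin)"
        by (simp add: arc_def lin_def exp_minus)
    qed
    moreover have i1: "f contour_integrable_on arc"
      unfolding arc_def by (rule contour_integrable_continuous_part_circlepath)
        (use continuous_on_subset[OF contS arcS] in \<open>simp add: arc_def\<close>)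
    moreover have i2: "f contour_integrable_on lin"
      unfolding lin_def by (rule contour_integrable_continuous_linepath)
        (use continuous_on_subset[OF contS linS] in \<open>simp add: lin_def\<close>)
    ultimately have "contour_integral arc f + contour_integral lin f = 0"
      using contour_integral_join[of f arc lin] contour_integral_unique by (fastforce simp: arc_def lin_def)
    moreover have "contour_integral lin f = - contour_integral (linepath (of_real (-R)) (of_real R)) f"
      unfolding lin_def by (rule contour_integral_reverse_linepath)
        (use continuous_on_subset[OF contS linS] in \<open>simp add: lin_def\<close>)
    moreover have "contour_integral (linepath (of_real (-R)) (of_real R)) f = integral {-R..R} (\<lambda>x. f (of_real x))"
      by (subst contour_integral_linepath_Reals_eq) (use R0 in auto)
    moreover have "(LINT x:{-R..R}|lborel. f (of_real x)) = integral {-R..R} (\<lambda>x. f (of_real x))"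
      by (rule set_borel_integral_eq_integral(2))
         (use int in \<open>auto simp: set_integrable_def intro!: integrable_mult_indicator\<close>)
    ultimately have eq: "(LINT x:{-R..R}|lborel. f (of_real x)) = contour_integral arc f" by simp
    have "cmod (contour_integral arc f) \<le> B R * R * \<bar>0 - (-pi)\<bar>"
      unfolding arc_def
    proof (rule contour_integral_bound_part_circlepath)
      show "f contour_integrable_on part_circlepath 0 R (- pi) 0" using i1 by (simp add: arc_def)
      show "0 \<le> B R" unfolding B_def using R c_pos[OF k] c_pos[OF l] by (intro add_nonneg_nonneg divide_nonneg_nonneg mult_nonneg_nonneg) auto
      show "0 \<le> R" using R0 by simp
      fix z assume z: "z \<in> path_image (part_circlepath 0 R (- pi) 0)"
      have nz: "cmod z = R" using in_path_image_part_circlepath[OF z] R0 by simp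
      have "z \<in> S" using z arcS by (auto simp: arc_def)
      have lb: "R - e - a j \<le> cmod (of_real (a j) - (z - \<i> * of_real e))" if "j \<in> {1..n}" for j
      proof -
        have "cmod z \<le> cmod (of_real (a j) - (z - \<i> * of_real e)) + cmod (of_real (a j) + \<i> * of_real e)"
          using norm_triangle_ineq4[of "of_real (a j) + \<i> * of_real e" "of_real (a j) - (z - \<i> * of_real e)"] by (simp add: algebra_simps)
        moreover have "cmod (of_real (a j) + \<i> * of_real e) \<le> a j + e"
          using norm_triangle_ineq[of "of_real (a j)" "\<i> * of_real e"] a_nonneg[OF that] e by (simp add: norm_mult)
        ultimately show ?thesis using nz by simp
      qed
      show "cmod (f z) \<le> B R"
        unfolding f_def B_def
        by (rule kernel_lower_bound[OF k l \<kappa> \<mu>]) (use R lb[OF k] lb[OF l] \<open>z \<in> S\<close> in \<open>auto simp: S_def\<close>)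
    qed
    then show ?thesis using eq by simp
  qed
  have "((\<lambda>R. B R * R * pi) \<longlongrightarrow> 0) at_top"
    unfolding B_def using c_pos[OF k] c_pos[OF l] by real_asymp
  then have "(\<lambda>i. B (real i) * real i * pi) \<longlonglongrightarrow> 0"
    by (rule filterlim_compose[OF _ filterlim_real_sequentially])
  then have l0: "(\<lambda>i. LINT x:{-real i..real i}|lborel. f (of_real x)) \<longlonglongrightarrow> 0"
  proof (rule Lim_null_comparison[rotated])
    show "\<forall>\<^sub>F i in sequentially. norm (LINT x:{-real i..real i}|lborel. f (of_real x)) \<le> B (real i) * real i * pi"
      using eventually_gt_at_top[of "nat \<lceil>e + a k\<rceil>"] eventually_gt_at_top[of "nat \<lceil>e + a l\<rceil>"]
    proof eventually_elim
      case (elim i)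
      then have "e + a k < real i" "e + a l < real i" by linarith+
      then show ?case using main by simp
    qed
  qed
  have "(\<lambda>i. LINT x:{-real i..real i}|lborel. f (of_real x)) \<longlonglongrightarrow> (LINT x|lborel. f (of_real x))"
    unfolding set_lebesgue_integral_def
  proof (rule integral_dominated_convergence[where w = "\<lambda>x. norm (f (of_real x))"])
    show "AE x in lborel. (\<lambda>i. indicat_real {- real i..real i} x *\<^sub>R f (of_real x)) \<longlonglongrightarrow> f (of_real x)"
    proof (rule AE_I2)
      fix x :: real
      have "\<forall>\<^sub>F i in sequentially. indicat_real {- real i..real i} x *\<^sub>R f (of_real x) = f (of_real x)"
        using eventually_gt_at_top[of "nat \<lceil>\<bar>x\<bar>\<rceil>"]
      proof eventually_elim
        case (elim i)
        then have "\<bar>x\<bar> < real i" by linarith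
        then show ?case by (auto simp: indicator_def)
      qed
      then show "(\<lambda>i. indicat_real {- real i..real i} x *\<^sub>R f (of_real x)) \<longlonglongrightarrow> f (of_real x)"
        by (rule tendsto_eventually)
    qed
  qed (use int meas in \<open>auto intro!: AE_I2 simp: indicator_def\<close>)
  then have "(LINT x|lborel. f (of_real x)) = 0" using l0 LIMSEQ_unique by blast
  then show "(LINT x|lborel. kernel_lower n c a \<kappa> \<mu> k l (of_real x - \<i> * of_real e)) = 0" by (simp add: f_def)
qed

definition cross_kernel :: "real \<Rightarrow> real \<Rightarrow> nat \<Rightarrow> nat \<Rightarrow> real \<Rightarrow> complex" where
  "cross_kernel \<kappa> \<mu> k l x = 1 / (W x * (of_real \<kappa> + Z k x) * (of_real \<mu> + Z l x))"

lemma zeta_measurable [measurable]: "k \<in> {1..n} \<Longrightarrow> Z k \<in> borel_measurable borel"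
  using zeta_continuous by (simp add: borel_measurable_continuous_onI)

lemma W_measurable [measurable]: "W \<in> borel_measurable borel"
  unfolding zeta_sum_def by (intro borel_measurable_sum) (auto intro!: borel_measurable_times)

lemma weight_measurable [measurable]: "k \<in> {1..n} \<Longrightarrow> weight k \<in> borel_measurable borel"
  unfolding weight_def by measurable

lemma edge_exp_transform_measurable [measurable]: "k \<in> {1..n} \<Longrightarrow> vv \<kappa> k j \<in> borel_measurable borel"
proof -
  assume k: "k \<in> {1..n}"
  have c: "cnj \<in> borel_measurable borel" by (intro borel_measurable_continuous_onI continuous_intros)
  show ?thesis unfolding edge_exp_transform_def
    by (intro borel_measurable_divide borel_measurable_add measurable_If borel_measurable_times measurable_compose[OF zeta_measurable[OF k] c]
       measurable_compose[OF W_measurable c] zeta_measurable k) auto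
qed

lemma cross_kernel_measurable [measurable]: "k \<in> {1..n} \<Longrightarrow> l \<in> {1..n} \<Longrightarrow> cross_kernel \<kappa> \<mu> k l \<in> borel_measurable borel"
  unfolding cross_kernel_def by measurable

lemma W_nz: assumes "x \<noteq> a 1" shows "W x \<noteq> 0"
proof -
  have 1: "1 \<in> {1..n}" using n1 by auto
  have "cmod (of_real (c 1) * Z 1 x) \<le> cmod (W x)"
    unfolding zeta_sum_def
    by (rule norm_le_norm_sum_quadrant) (use 1 in \<open>auto simp: Re_zeta Im_zeta c_pos less_imp_le\<close>)
  moreover have "cmod (of_real (c 1) * Z 1 x) > 0"
    using c_pos[OF 1] assms by (simp add: norm_mult norm_zeta[OF 1, simplified])
  ultimately show ?thesis by auto
qed

text \<open>Passage to the real axis from below, at depths 1 / (m + 1). Dominated convergence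
  applies because \<open>cross_bound\<close> majorizes the kernel at every depth.\<close>

lemma cross_kernel_integral:
  assumes k: "k \<in> {1..n}" and l: "l \<in> {1..n}" and \<kappa>: "0 < \<kappa>" and \<mu>: "0 < \<mu>"
  shows "has_bochner_integral lborel (cross_kernel \<kappa> \<mu> k l) 0"
proof -
  define s where "s = (\<lambda>m x. kernel_lower n c a \<kappa> \<mu> k l (of_real x - \<i> * of_real (inverse (real (Suc m)))))"
  have lim: "AE x in lborel. (\<lambda>m. s m x) \<longlonglongrightarrow> cross_kernel \<kappa> \<mu> k l x"
    using AE_neq[of "a 1"]
  proof eventually_elim
    case (elim x)
    show ?case unfolding s_def kernel_lower_def zeta_sum_lower_def cross_kernel_def zeta_sum_def
      by (intro tendsto_divide tendsto_mult tendsto_sum tendsto_add tendsto_const zeta_lower_tendsto k l)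
         (use W_nz[OF elim] zeta_nz \<kappa> \<mu> in \<open>auto simp: zeta_sum_def\<close>)
  qed
  have bd: "AE x in lborel. norm (s m x) \<le> cross_bound \<kappa> \<mu> k l x" for m
    using AE_neq[of "a k"] AE_neq[of "a l"]
  proof eventually_elim
    case (elim x)
    show ?case unfolding s_def using elim by (intro kernel_lower_line_bound k l \<kappa> \<mu>) auto
  qed
  have m: "s m \<in> borel_measurable lborel" for m
    unfolding s_def by (rule kernel_lower_line_integral(1)[OF k l \<kappa> \<mu>]) simp
  have z: "(LINT x|lborel. s m x) = 0" for m
    unfolding s_def by (rule kernel_lower_line_integral(2)[OF k l \<kappa> \<mu>]) simp
  have m0: "cross_kernel \<kappa> \<mu> k l \<in> borel_measurable lborel" using k l by simp
  have "integrable lborel (cross_kernel \<kappa> \<mu> k l)"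
    by (rule integrable_dominated_convergence[OF m0 m cross_bound_integrable[OF k l \<kappa> \<mu>] lim bd])
  moreover have "(\<lambda>m. LINT x|lborel. s m x) \<longlonglongrightarrow> (LINT x|lborel. cross_kernel \<kappa> \<mu> k l x)"
    by (rule integral_dominated_convergence[OF m0 m cross_bound_integrable[OF k l \<kappa> \<mu>] lim bd])
  ultimately show ?thesis by (simp add: z has_bochner_integral_iff LIMSEQ_const_iff)
qed

abbreviation "Q \<equiv> qmeasure n c a"

end

section \<open>Exponentials, their transforms and their Gram matrices\<close>

lemma borel_imp_lebesgue_on: "f \<in> borel_measurable borel \<Longrightarrow> f \<in> borel_measurable (lebesgue_on S)"
  by (intro measurable_restrict_space1 measurable_completion) simp

text \<open>Bridge between Lebesgue measure on a set, used in the definitions, and Borel measure on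
  the line, where primitives, substitutions and contour integrals are evaluated.\<close>

lemma integral_lebesgue_on_borel:
  fixes f :: "real \<Rightarrow> 'b::{banach, second_countable_topology}"
  assumes S: "S \<in> sets borel" and f: "f \<in> borel_measurable borel"
  shows "integrable (lebesgue_on S) f \<longleftrightarrow> integrable lborel (\<lambda>x. indicator S x *\<^sub>R f x)"
    "integral\<^sup>L (lebesgue_on S) f = (LINT x|lborel. indicator S x *\<^sub>R f x)"
proof -
  have m: "(\<lambda>x. indicator S x *\<^sub>R f x) \<in> borel_measurable lborel"
    using S f by (intro borel_measurable_scaleR borel_measurable_indicator) auto
  have S': "S \<inter> space lebesgue \<in> sets lebesgue" using S by auto
  show "integrable (lebesgue_on S) f \<longleftrightarrow> integrable lborel (\<lambda>x. indicator S x *\<^sub>R f x)"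
    by (subst integrable_restrict_space[OF S']) (rule integrable_completion[OF m])
  show "integral\<^sup>L (lebesgue_on S) f = (LINT x|lborel. indicator S x *\<^sub>R f x)"
    by (subst integral_restrict_space[OF S']) (rule integral_completion[OF m])
qed

lemma exp_decay_integral:
  assumes \<alpha>: "0 < Re \<alpha>"
  shows "has_bochner_integral (lebesgue_on {0<..}) (\<lambda>x::real. exp (- \<alpha> * of_real x)) (1 / \<alpha>)"
proof -
  define f where "f = (\<lambda>x::real. exp (- \<alpha> * of_real x))"
  define F where "F = (\<lambda>x::real. - exp (- \<alpha> * of_real x) / \<alpha>)"
  have nz: "\<alpha> \<noteq> 0" using \<alpha> by auto
  have fc: "continuous_on UNIV f" unfolding f_def by (intro continuous_intros)
  have fm: "f \<in> borel_measurable borel" using fc by (rule borel_measurable_continuous_onI)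
  have nf: "norm (f x) = exp (- Re \<alpha> * x)" for x by (simp add: f_def)
  have "has_bochner_integral lborel (\<lambda>x. indicator {0<..} x * exp (- Re \<alpha> * x)) (0 - (- 1 / Re \<alpha>))"
  proof (rule has_bochner_integral_FTC_Ioi[where F="\<lambda>x. - exp (- Re \<alpha> * x) / Re \<alpha>"])
    show "((\<lambda>x. - exp (- Re \<alpha> * x) / Re \<alpha>) \<longlongrightarrow> 0) at_top" using \<alpha> by real_asymp
    have "((\<lambda>x. - exp (- Re \<alpha> * x) / Re \<alpha>) \<longlongrightarrow> - exp (- Re \<alpha> * 0) / Re \<alpha>) (at_right 0)"
      by (intro tendsto_intros) (use \<alpha> in auto)
    then show "((\<lambda>x. - exp (- Re \<alpha> * x) / Re \<alpha>) \<longlongrightarrow> - 1 / Re \<alpha>) (at_right 0)" by simp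
  qed (use \<alpha> in \<open>auto intro!: derivative_eq_intros continuous_intros\<close>)
  then have "integrable lborel (\<lambda>x. indicator {0<..} x * exp (- Re \<alpha> * x))" by (simp add: has_bochner_integral_iff)
  then have i: "integrable lborel (\<lambda>x. indicator {0<..} x *\<^sub>R f x)"
    by (rule Bochner_Integration.integrable_bound) (use fm in \<open>auto simp: nf indicator_def intro!: AE_I2\<close>)
  have e: "einterval 0 \<infinity> = {0<..}" by (auto simp: einterval_def zero_ereal_def)
  have lim: "((\<lambda>x. exp (- \<alpha> * of_real x)) \<longlongrightarrow> 0) at_top"
  proof (rule Lim_null_comparison[OF always_eventually])
    show "((\<lambda>x. exp (- Re \<alpha> * x)) \<longlongrightarrow> 0) at_top" using \<alpha> by real_asymp
  qed simp
  have "(LBINT x=0..\<infinity>. f x) = 0 - (- 1 / \<alpha>)"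
  proof (rule interval_integral_FTC_integrable[where F=F])
    show "set_integrable lborel (einterval 0 \<infinity>) f" using i by (simp add: e set_integrable_def)
    show "\<And>x. 0 < ereal x \<Longrightarrow> ereal x < \<infinity> \<Longrightarrow> (F has_vector_derivative f x) (at x)"
      unfolding F_def f_def by (rule has_vector_derivative_real_field) (use nz in \<open>auto intro!: derivative_eq_intros\<close>)
    show "\<And>x. 0 < ereal x \<Longrightarrow> ereal x < \<infinity> \<Longrightarrow> isCont f x"
      using fc by (simp add: continuous_on_eq_continuous_at)
    have "(F \<longlongrightarrow> - exp (- \<alpha> * of_real 0) / \<alpha>) (at_right 0)"
      unfolding F_def by (intro tendsto_intros) (use nz in auto)
    then show "((F \<circ> real_of_ereal) \<longlongrightarrow> - 1 / \<alpha>) (at_right 0)"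
      by (simp add: zero_ereal_def ereal_tendsto_simps)
    have "(F \<longlongrightarrow> - 0 / \<alpha>) at_top" unfolding F_def by (intro tendsto_divide tendsto_minus lim tendsto_const nz)
    then show "((F \<circ> real_of_ereal) \<longlongrightarrow> 0) (at_left \<infinity>)"
      by (simp add: ereal_tendsto_simps)
  qed simp
  moreover have "(LBINT x=ereal 0..\<infinity>. f x) = (LINT x:{0<..}|lborel. f x)"
    by (rule interval_integral_to_infinity_eq)
  ultimately have "(LINT x|lborel. indicator {0<..} x *\<^sub>R f x) = 1 / \<alpha>"
    by (simp add: set_lebesgue_integral_def zero_ereal_def)
  then show ?thesis using i integral_lebesgue_on_borel[OF _ fm, of "{0<..}"]
    by (simp add: has_bochner_integral_iff f_def)
qed

lemma exp_decay_integral_real: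
  assumes "0 < \<kappa>" shows "has_bochner_integral (lebesgue_on {0<..}) (\<lambda>x::real. exp (- \<kappa> * x)) (1 / \<kappa>)"
proof -
  have "has_bochner_integral (lebesgue_on {0<..}) (\<lambda>x::real. Re (exp (- of_real \<kappa> * of_real x))) (Re (1 / of_real \<kappa>))"
    by (rule has_bochner_integral_Re) (rule exp_decay_integral, use assms in simp)
  then show ?thesis using assms by (simp flip: of_real_minus of_real_mult exp_of_real of_real_divide add: Re_exp)
qed

abbreviation Hm :: "nat \<Rightarrow> real measure" where "Hm \<equiv> \<lambda>_. lebesgue_on {0<..}"

lemma edge_exp_integral:
  assumes "0 < \<kappa>" "0 < \<mu>"
  shows "has_bochner_integral (lebesgue_on {0<..}) (\<lambda>x. edge_exp \<kappa> k j x * cnj (edge_exp \<mu> l j x)) (if j = k \<and> j = l then 1 / of_real (\<kappa> + \<mu>) else 0)"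
proof -
  have "has_bochner_integral (lebesgue_on {0<..}) (\<lambda>x::real. exp (- complex_of_real (\<kappa> + \<mu>) * of_real x)) (1 / of_real (\<kappa> + \<mu>))"
    by (rule exp_decay_integral) (use assms in simp)
  moreover have "exp (- of_real (\<kappa> + \<mu>) * complex_of_real x) = of_real (exp (- \<kappa> * x)) * of_real (exp (- \<mu> * x))" for x
    by (simp del: exp_of_real add: exp_of_real[symmetric] exp_add[symmetric] algebra_simps)
  ultimately have E: "has_bochner_integral (lebesgue_on {0<..}) (\<lambda>x::real. of_real (exp (- \<kappa> * x)) * complex_of_real (exp (- \<mu> * x))) (1 / of_real (\<kappa> + \<mu>))"
    by simp
  show ?thesis
  proof (cases "j = k \<and> j = l")
    case True
    then show ?thesis using E by (simp add: edge_exp_def)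
  next
    case False
    then have "(\<lambda>x. edge_exp \<kappa> k j x * cnj (edge_exp \<mu> l j x)) = (\<lambda>x. 0)" by (auto simp: edge_exp_def)
    with False show ?thesis by auto
  qed
qed

lemma edge_exp_measurable [measurable]: "edge_exp \<kappa> k j \<in> borel_measurable borel"
  unfolding edge_exp_def by measurable

lemma edge_exp_L2: assumes "0 < \<kappa>" shows "L2 (lebesgue_on {0<..}) (edge_exp \<kappa> k j)"
proof -
  have "integrable (lebesgue_on {0<..}) (\<lambda>x. Re (edge_exp \<kappa> k j x * cnj (edge_exp \<kappa> k j x)))"
    using edge_exp_integral[OF assms assms, of k j k] by (intro integrable_Re) (auto simp: has_bochner_integral_iff)
  moreover have "Re (edge_exp \<kappa> k j x * cnj (edge_exp \<kappa> k j x)) = (cmod (edge_exp \<kappa> k j x))^2" for x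
    by (simp add: complex_mult_cnj cmod_power2)
  ultimately show ?thesis by (simp add: L2_def borel_imp_lebesgue_on)
qed

lemma edge_exp_tuple_inner:
  assumes "0 < \<kappa>" "0 < \<mu>" "k \<in> {1..n}" "l \<in> {1..n}"
  shows "tuple_inner n Hm (edge_exp \<kappa> k) (edge_exp \<mu> l) = (if k = l then 1 / of_real (\<kappa> + \<mu>) else 0)"
proof -
  have "tuple_inner n Hm (edge_exp \<kappa> k) (edge_exp \<mu> l) = (\<Sum>j\<in>{1..n}. if j = k then (if k = l then 1 / of_real (\<kappa> + \<mu>) else 0) else 0)"
    unfolding tuple_inner_def using edge_exp_integral[OF assms(1,2)] by (intro sum.cong refl) (auto simp: has_bochner_integral_iff)
  then show ?thesis using assms by simp
qed

context star begin

lemma Q_eq: "j \<in> {1..n} \<Longrightarrow> Q j = density (lebesgue_on {a j<..}) (\<lambda>x. ennreal (weight j x))"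
  unfolding qmeasure_def by (simp add: q_weight)

lemma borel_imp_Q: "f \<in> borel_measurable borel \<Longrightarrow> f \<in> borel_measurable (Q j)"
  unfolding qmeasure_def
  by (subst measurable_cong_sets[OF sets_density refl]) (rule borel_imp_lebesgue_on)

text \<open>The indicator of the band is absorbed by \<open>weight j\<close>, which vanishes outside
  it.\<close>

lemma Q_integral:
  fixes f :: "real \<Rightarrow> 'b::{banach, second_countable_topology}"
  assumes j: "j \<in> {1..n}" and f: "f \<in> borel_measurable borel"
  shows "integrable (Q j) f \<longleftrightarrow> integrable lborel (\<lambda>x. weight j x *\<^sub>R f x)"
    "integral\<^sup>L (Q j) f = (LINT x|lborel. weight j x *\<^sub>R f x)"
proof -
  have m: "f \<in> borel_measurable (lebesgue_on {a j<..})" "weight j \<in> borel_measurable (lebesgue_on {a j<..})"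
    using f j by (auto intro!: borel_imp_lebesgue_on)
  have nn: "AE x in lebesgue_on {a j<..}. 0 \<le> weight j x" using weight_nonneg[OF j] by auto
  have m2: "(\<lambda>x. weight j x *\<^sub>R f x) \<in> borel_measurable borel" using f j by simp
  have ind: "indicator {a j<..} x *\<^sub>R (weight j x *\<^sub>R f x) = weight j x *\<^sub>R f x" for x
    using Im_zeta_eq_0[OF j, of x] by (cases "x \<le> a j") (auto simp: indicator_def weight_def)
  have S: "{a j<..} \<in> sets borel" by simp
  show "integrable (Q j) f \<longleftrightarrow> integrable lborel (\<lambda>x. weight j x *\<^sub>R f x)"
    unfolding Q_eq[OF j] by (simp only: integrable_density[OF m nn] integral_lebesgue_on_borel(1)[OF S m2] ind)
  show "integral\<^sup>L (Q j) f = (LINT x|lborel. weight j x *\<^sub>R f x)"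
    unfolding Q_eq[OF j] by (simp only: integral_density[OF m nn] integral_lebesgue_on_borel(2)[OF S m2] ind)
qed

definition gram_density :: "real \<Rightarrow> real \<Rightarrow> nat \<Rightarrow> nat \<Rightarrow> real \<Rightarrow> real" where
  "gram_density \<kappa> \<mu> k l x = - Im (cross_kernel \<kappa> \<mu> k l x) / pi
      + (if k = l then Im (Z k x) / (c k * (cmod (of_real \<kappa> + Z k x))^2 * (cmod (of_real \<mu> + Z k x))^2) / pi else 0)"

text \<open>The contour argument annihilates the part with the cross kernel, so only the diagonal
  part contributes.\<close>

lemma gram_density_integral:
  assumes k: "k \<in> {1..n}" and l: "l \<in> {1..n}" and \<kappa>: "0 < \<kappa>" and \<mu>: "0 < \<mu>"
  shows "has_bochner_integral lborel (gram_density \<kappa> \<mu> k l) (if k = l then 1 / (\<kappa> + \<mu>) else 0)"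
proof -
  have 1: "has_bochner_integral lborel (\<lambda>x. - Im (cross_kernel \<kappa> \<mu> k l x) / pi) (- Im 0 / pi)"
    by (intro has_bochner_integral_divide_zero has_bochner_integral_minus has_bochner_integral_Im cross_kernel_integral assms)
  have "indicator {a k<..} x * (sqrt ((x - a k) / c k) / (c k * (\<kappa>^2 + (sqrt ((x - a k) / c k))^2) * (\<mu>^2 + (sqrt ((x - a k) / c k))^2)))
      = Im (Z k x) / (c k * (cmod (of_real \<kappa> + Z k x))^2 * (cmod (of_real \<mu> + Z k x))^2)" for x
    using Im_zeta_eq_0[OF k, of x] Im_zeta_pos[OF k, of x] by (cases "a k < x") (auto simp: cmod_power2)
  then have 2: "has_bochner_integral lborel (\<lambda>x. Im (Z k x) / (c k * (cmod (of_real \<kappa> + Z k x))^2 * (cmod (of_real \<mu> + Z k x))^2)) (pi / (\<kappa> + \<mu>))"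
    using diag_integral[OF c_pos[OF k] \<kappa> \<mu>, of "a k"] by simp
  show ?thesis
  proof (cases "k = l")
    case True
    from has_bochner_integral_add[OF 1 has_bochner_integral_divide_zero[OF 2, of pi]] show ?thesis
      using True by (simp add: gram_density_def[abs_def])
  next
    case False
    then show ?thesis using 1 by (simp add: gram_density_def[abs_def])
  qed
qed

lemma gram_AE:
  assumes "k \<in> {1..n}" "l \<in> {1..n}" "0 < \<kappa>" "0 < \<mu>"
  shows "AE x in lborel. (\<Sum>j\<in>{1..n}. of_real (weight j x) * (vv \<kappa> k j x * cnj (vv \<mu> l j x))) = of_real (gram_density \<kappa> \<mu> k l x)"
  using AE_neq[of "a 1"]
proof eventually_elim
  case (elim x)
  show ?case unfolding gram_pointwise[OF assms W_nz[OF elim]] gram_density_def cross_kernel_def ..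
qed

text \<open>For equal functions the Gram sum consists of nonnegative terms and has an integrable
  value, so each of its terms is integrable.\<close>

lemma edge_exp_transform_L2: assumes k: "k \<in> {1..n}" and j: "j \<in> {1..n}" and \<kappa>: "0 < \<kappa>"
  shows "L2 (Q j) (vv \<kappa> k j)"
proof -
  have vm: "vv \<kappa> k j \<in> borel_measurable borel" using k by simp
  have "integrable lborel (\<lambda>x. weight j x *\<^sub>R (cmod (vv \<kappa> k j x))^2)"
  proof (rule Bochner_Integration.integrable_bound)
    show "integrable lborel (gram_density \<kappa> \<kappa> k k)" using gram_density_integral[OF k k \<kappa> \<kappa>] by (simp add: has_bochner_integral_iff)
    show "(\<lambda>x. weight j x *\<^sub>R (cmod (vv \<kappa> k j x))^2) \<in> borel_measurable lborel" using vm j by simp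
    show "AE x in lborel. norm (weight j x *\<^sub>R (cmod (vv \<kappa> k j x))^2) \<le> norm (gram_density \<kappa> \<kappa> k k x)"
      using gram_AE[OF k k \<kappa> \<kappa>]
    proof eventually_elim
      case (elim x)
      have "(\<Sum>i\<in>{1..n}. of_real (weight i x) * (vv \<kappa> k i x * cnj (vv \<kappa> k i x))) = complex_of_real (\<Sum>i\<in>{1..n}. weight i x * (cmod (vv \<kappa> k i x))^2)"
        by (simp add: complex_norm_square[symmetric] del: of_real_power)
      then have "gram_density \<kappa> \<kappa> k k x = (\<Sum>i\<in>{1..n}. weight i x * (cmod (vv \<kappa> k i x))^2)" using elim by (metis of_real_eq_iff)
      moreover have "weight j x * (cmod (vv \<kappa> k j x))^2 \<le> (\<Sum>i\<in>{1..n}. weight i x * (cmod (vv \<kappa> k i x))^2)"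
        by (rule member_le_sum[OF j]) (auto simp: weight_nonneg)
      ultimately show ?case using weight_nonneg[OF j, of x] by simp
    qed
  qed
  then have "integrable (Q j) (\<lambda>x. (cmod (vv \<kappa> k j x))^2)"
    using Q_integral(1)[OF j, of "\<lambda>x. (cmod (vv \<kappa> k j x))^2"] vm by simp
  then show ?thesis using borel_imp_Q[OF vm] by (simp add: L2_def)
qed

lemma edge_exp_transform_tuple_L2: "k \<in> {1..n} \<Longrightarrow> 0 < \<kappa> \<Longrightarrow> tuple_L2 n Q (vv \<kappa> k)"
  by (simp add: tuple_L2_def edge_exp_transform_L2)

lemma edge_exp_tuple_L2: "0 < \<kappa> \<Longrightarrow> tuple_L2 n Hm (edge_exp \<kappa> k)"
  by (simp add: tuple_L2_def edge_exp_L2)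

lemma edge_exp_transform_tuple_inner:
  assumes k: "k \<in> {1..n}" and l: "l \<in> {1..n}" and \<kappa>: "0 < \<kappa>" and \<mu>: "0 < \<mu>"
  shows "tuple_inner n Q (vv \<kappa> k) (vv \<mu> l) = tuple_inner n Hm (edge_exp \<kappa> k) (edge_exp \<mu> l)"
proof -
  have bm: "(\<lambda>x. vv \<kappa> k j x * cnj (vv \<mu> l j x)) \<in> borel_measurable borel" for j
  proof -
    have c: "cnj \<in> borel_measurable borel" by (intro borel_measurable_continuous_onI continuous_intros)
    show ?thesis using k l by (intro borel_measurable_times measurable_compose[OF _ c]) auto
  qed
  have i: "integrable lborel (\<lambda>x. weight j x *\<^sub>R (vv \<kappa> k j x * cnj (vv \<mu> l j x)))" if "j \<in> {1..n}" for j
    using Q_integral(1)[OF that bm[of j]] L2_integrable_mult[OF edge_exp_transform_L2[OF k that \<kappa>] edge_exp_transform_L2[OF l that \<mu>]] by simp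
  have "tuple_inner n Q (vv \<kappa> k) (vv \<mu> l) = (\<Sum>j\<in>{1..n}. LINT x|lborel. weight j x *\<^sub>R (vv \<kappa> k j x * cnj (vv \<mu> l j x)))"
    unfolding tuple_inner_def by (intro sum.cong refl Q_integral(2) bm)
  also have "\<dots> = (LINT x|lborel. (\<Sum>j\<in>{1..n}. weight j x *\<^sub>R (vv \<kappa> k j x * cnj (vv \<mu> l j x))))"
    by (rule Bochner_Integration.integral_sum[symmetric]) (rule i)
  also have "\<dots> = (LINT x|lborel. complex_of_real (gram_density \<kappa> \<mu> k l x))"
  proof (rule integral_cong_AE)
    show "AE x in lborel. (\<Sum>j\<in>{1..n}. weight j x *\<^sub>R (vv \<kappa> k j x * cnj (vv \<mu> l j x))) = complex_of_real (gram_density \<kappa> \<mu> k l x)"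
      using gram_AE[OF k l \<kappa> \<mu>] by (simp add: scaleR_conv_of_real)
    show "(\<lambda>x. \<Sum>j\<in>{1..n}. weight j x *\<^sub>R (vv \<kappa> k j x * cnj (vv \<mu> l j x))) \<in> borel_measurable lborel"
      using i by (intro borel_measurable_sum) (auto dest: borel_measurable_integrable)
    show "(\<lambda>x. complex_of_real (gram_density \<kappa> \<mu> k l x)) \<in> borel_measurable lborel"
      by (rule measurable_compose[OF _ borel_measurable_continuous_onI[OF continuous_on_of_real_id]])
        (use gram_density_integral[OF k l \<kappa> \<mu>] in \<open>auto simp: has_bochner_integral_iff\<close>)
  qed
  also have "\<dots> = of_real (if k = l then 1 / (\<kappa> + \<mu>) else 0)"
    using gram_density_integral[OF k l \<kappa> \<mu>] by (simp add: has_bochner_integral_iff)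
  finally show ?thesis using edge_exp_tuple_inner[OF \<kappa> \<mu> k l] by simp
qed

text \<open>Functions and transforms are generated together, so that a transform is attached to a
  combination without decomposing it. The exponents lie in K: the naturals in approximation
  arguments, all positive reals for the resolvent.\<close>

inductive exp_span :: "real set \<Rightarrow> (nat \<Rightarrow> real \<Rightarrow> complex) \<Rightarrow> (nat \<Rightarrow> real \<Rightarrow> complex) \<Rightarrow> bool" for K where
  zero: "exp_span K (\<lambda>k x. 0) (\<lambda>k x. 0)"
| step: "exp_span K e v \<Longrightarrow> \<kappa> \<in> K \<Longrightarrow> 0 < \<kappa> \<Longrightarrow> k \<in> {1..n} \<Longrightarrow>
     exp_span K (\<lambda>j x. e j x + b * edge_exp \<kappa> k j x) (\<lambda>j x. v j x + b * vv \<kappa> k j x)"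

lemma exp_span_L2: assumes "exp_span K e v" shows "tuple_L2 n Hm e \<and> tuple_L2 n Q v"
  using assms by induction (auto intro!: tuple_L2_add tuple_L2_scale edge_exp_tuple_L2 edge_exp_transform_tuple_L2)

lemma exp_span_add: assumes "exp_span K e' v'" "exp_span K e v"
  shows "exp_span K (\<lambda>k x. e k x + e' k x) (\<lambda>k x. v k x + v' k x)"
  using assms(1)
proof induction
  case zero
  then show ?case using assms(2) by simp
next
  case (step e' v' \<kappa> k b)
  from exp_span.step[OF step(5,2,3,4), of b] show ?case by (simp add: add.assoc)
qed

lemma exp_span_scale: assumes "exp_span K e v" shows "exp_span K (\<lambda>k x. b * e k x) (\<lambda>k x. b * v k x)"
  using assms
proof induction
  case zero
  then show ?case using exp_span.zero by simp
next
  case (step e' v' \<kappa> k b')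
  from exp_span.step[OF step(5,2,3,4), of "b * b'"] show ?case by (simp add: algebra_simps)
qed

lemma exp_span_single: "\<kappa> \<in> K \<Longrightarrow> 0 < \<kappa> \<Longrightarrow> k \<in> {1..n} \<Longrightarrow> exp_span K (edge_exp \<kappa> k) (vv \<kappa> k)"
  using exp_span.step[OF exp_span.zero, of \<kappa> K k 1] by simp

lemma exp_span_ip1: assumes "exp_span K e v" "0 < \<mu>" "l \<in> {1..n}"
  shows "tuple_inner n Hm e (edge_exp \<mu> l) = tuple_inner n Q v (vv \<mu> l)"
  using assms(1)
proof induction
  case zero
  then show ?case by (simp add: tuple_inner_def)
next
  case (step e v \<kappa> k b)
  have L: "tuple_L2 n Hm e" "tuple_L2 n Q v" using exp_span_L2[OF step(1)] by auto
  show ?case using step assms L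
    by (simp add: tuple_inner_add_left tuple_L2_scale edge_exp_tuple_L2 edge_exp_transform_tuple_L2 tuple_inner_scale_left edge_exp_transform_tuple_inner)
qed

lemma exp_span_tuple_inner: assumes "exp_span K e v" "exp_span K' e' v'"
  shows "tuple_inner n Hm e e' = tuple_inner n Q v v'"
  using assms(2)
proof induction
  case zero
  then show ?case by (simp add: tuple_inner_def)
next
  case (step e' v' \<kappa> k b)
  have L: "tuple_L2 n Hm e" "tuple_L2 n Q v" "tuple_L2 n Hm e'" "tuple_L2 n Q v'" using exp_span_L2[OF step(1)] exp_span_L2[OF assms(1)] by auto
  show ?case using step L
    by (simp add: tuple_inner_add_right tuple_L2_scale edge_exp_tuple_L2 edge_exp_transform_tuple_L2 tuple_inner_scale_right exp_span_ip1[OF assms(1)])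
qed

sublocale isometric_span n Hm Q "exp_span {0<..}"
proof
  show "exp_span {0<..} e v \<Longrightarrow> tuple_norm2 n Hm e = tuple_norm2 n Q v" for e v
    using exp_span_tuple_inner[of _ e v _ e v] by (simp add: tuple_inner_self)
qed (use exp_span_L2 exp_span_add exp_span_scale in auto)

end

section \<open>Density of exponentials\<close>

text \<open>In the variable y = exp (-x) the function is divided by y before it is approximated.
  This leaves a factor exp (-x) in the error, which is therefore small in L1 and in L2 at once, and
  makes every exponent at least 1.\<close>

lemma exp_poly_approx_real:
  fixes g :: "real \<Rightarrow> real"
  assumes g: "continuous_on UNIV g" and M: "0 < M" "\<And>x. M \<le> x \<Longrightarrow> g x = 0" and e: "0 < e"
  shows "\<exists>N b. \<forall>x\<ge>0. \<bar>g x - (\<Sum>i\<le>N. b i * exp (- real (Suc i) * x))\<bar> \<le> e * exp (- x)"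
proof -
  \<comment> \<open>Below this value of y the function g has already vanished; replacing y by max y
    d keeps the logarithm and the quotient continuous at 0.\<close>
  define d where "d = exp (- M)"
  have d: "d > 0" by (simp add: d_def)
  define h where "h = (\<lambda>y. g (- ln (max y d)) / max y d)"
  have pos: "max y d > 0" for y using d by (simp add: less_max_iff_disj)
  have nz: "max y d \<noteq> 0" for y using pos[of y] by linarith
  have "continuous_on UNIV h"
    unfolding h_def
    by (intro continuous_intros continuous_on_compose2[OF g] continuous_on_max) (use nz in auto)
  then have "continuous_on {0..1} h" by (rule continuous_on_subset) simp
  then obtain p where p: "real_polynomial_function p" "\<And>y. y \<in> {0..1} \<Longrightarrow> \<bar>h y - p y\<bar> < e"
    using Stone_Weierstrass_real_polynomial_function[of "{0..1::real}" h e] e by auto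
  obtain b N where b: "p = (\<lambda>x. \<Sum>i\<le>N. b i * x^i)"
    using p(1) unfolding real_polynomial_function_iff_sum by auto
  have "\<bar>g x - (\<Sum>i\<le>N. b i * exp (- real (Suc i) * x))\<bar> \<le> e * exp (- x)" if x: "x \<ge> 0" for x
  proof -
    have hx: "g x = exp (- x) * h (exp (- x))"
    proof (cases "x \<le> M")
      case True
      then have "max (exp (- x)) d = exp (- x)" by (simp add: d_def max_def)
      then show ?thesis by (simp add: h_def)
    next
      case False
      then have "max (exp (- x)) d = d" by (simp add: d_def max_def)
      then show ?thesis using M False by (simp add: h_def d_def)
    qed
    have "(\<Sum>i\<le>N. b i * exp (- real (Suc i) * x)) = exp (- x) * p (exp (- x))"
      unfolding b sum_distrib_left
      by (intro sum.cong refl) (simp add: exp_of_nat_mult[symmetric] exp_add[symmetric] algebra_simps)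
    then have "g x - (\<Sum>i\<le>N. b i * exp (- real (Suc i) * x)) = exp (- x) * (h (exp (- x)) - p (exp (- x)))"
      by (simp add: hx right_diff_distrib)
    moreover have "\<bar>h (exp (- x)) - p (exp (- x))\<bar> \<le> e" using p(2)[of "exp (- x)"] x by simp
    ultimately show ?thesis by (simp add: abs_mult mult.commute)
  qed
  then show ?thesis by blast
qed

context star begin

lemma exp_span_sum: assumes "finite I" "\<And>i. i \<in> I \<Longrightarrow> exp_span K (e i) (v i)"
  shows "exp_span K (\<lambda>k x. \<Sum>i\<in>I. e i k x) (\<lambda>k x. \<Sum>i\<in>I. v i k x)"
  using assms
proof (induction I rule: finite_induct)
  case empty
  then show ?case using exp_span.zero by simp
next
  case (insert i I)
  then show ?case using exp_span_add[of K "\<lambda>k x. \<Sum>i\<in>I. e i k x" "\<lambda>k x. \<Sum>i\<in>I. v i k x" "e i" "v i"] by simp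
qed

lemma exp_span_pos: "exp_span K e v \<Longrightarrow> exp_span {0<..} e v"
  by (induction rule: exp_span.induct) (auto intro: exp_span.intros)

lemma exp_span_approx:
  fixes g :: "nat \<Rightarrow> real \<Rightarrow> complex"
  assumes g: "\<And>k. k \<in> {1..n} \<Longrightarrow> continuous_on UNIV (g k)"
    and M: "\<And>k. k \<in> {1..n} \<Longrightarrow> \<exists>M>0. \<forall>x\<ge>M. g k x = 0" and e: "0 < e"
  shows "\<exists>f v. exp_span \<nat> f v \<and> (\<forall>k\<in>{1..n}. \<forall>x\<ge>0. cmod (g k x - f k x) \<le> e * exp (- x))"
proof -
  have "\<exists>N b. \<forall>x\<ge>0. cmod (g k x - (\<Sum>i\<le>N. b i * of_real (exp (- real (Suc i) * x)))) \<le> e * exp (- x)"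
    if k: "k \<in> {1..n}" for k
  proof -
    obtain m where m: "m > 0" "\<forall>x\<ge>m. g k x = 0" using M[OF k] by auto
    obtain N1 b1 where 1: "\<forall>x\<ge>0. \<bar>Re (g k x) - (\<Sum>i\<le>N1. b1 i * exp (- real (Suc i) * x))\<bar> \<le> (e/2) * exp (- x)"
      using exp_poly_approx_real[of "\<lambda>x. Re (g k x)" m "e/2"] g[OF k] m e by (auto intro: continuous_intros)
    obtain N2 b2 where 2: "\<forall>x\<ge>0. \<bar>Im (g k x) - (\<Sum>i\<le>N2. b2 i * exp (- real (Suc i) * x))\<bar> \<le> (e/2) * exp (- x)"
      using exp_poly_approx_real[of "\<lambda>x. Im (g k x)" m "e/2"] g[OF k] m e by (auto intro: continuous_intros)
    \<comment> \<open>Padding with zero coefficients gives the real and the imaginary part the same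
      number of terms.\<close>
    define N where "N = max N1 N2"
    define b where "b = (\<lambda>i. Complex (if i \<le> N1 then b1 i else 0) (if i \<le> N2 then b2 i else 0))"
    have ext: "(\<Sum>i\<le>N. (if i \<le> N' then b' i else 0) * c' i) = (\<Sum>i\<le>N'. b' i * c' i)" if "N' \<le> N" for N' and b' c' :: "nat \<Rightarrow> real"
    proof -
      have "(\<Sum>i\<le>N. (if i \<le> N' then b' i else 0) * c' i) = (\<Sum>i\<le>N. if i \<in> {..N'} then b' i * c' i else 0)"
        by (intro sum.cong) auto
      also have "\<dots> = sum (\<lambda>i. b' i * c' i) ({..N} \<inter> {..N'})" by (subst sum.inter_restrict) auto
      also have "{..N} \<inter> {..N'} = {..N'}" using that by auto
      finally show ?thesis .
    qed
    have "cmod (g k x - (\<Sum>i\<le>N. b i * of_real (exp (- real (Suc i) * x)))) \<le> e * exp (- x)" if x: "x \<ge> 0" for x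
    proof -
      define y where "y = g k x - (\<Sum>i\<le>N. b i * of_real (exp (- real (Suc i) * x)))"
      have "Re y = Re (g k x) - (\<Sum>i\<le>N1. b1 i * exp (- real (Suc i) * x))"
        unfolding y_def using ext[of N1 b1 "\<lambda>i. exp (- real (Suc i) * x)"] by (simp add: b_def N_def)
      moreover have "Im y = Im (g k x) - (\<Sum>i\<le>N2. b2 i * exp (- real (Suc i) * x))"
        unfolding y_def using ext[of N2 b2 "\<lambda>i. exp (- real (Suc i) * x)"] by (simp add: b_def N_def)
      ultimately have "\<bar>Re y\<bar> \<le> (e/2) * exp (- x)" "\<bar>Im y\<bar> \<le> (e/2) * exp (- x)" using 1 2 x by auto
      then have "cmod y \<le> e * exp (- x)" using cmod_le[of y] by simp
      then show ?thesis by (simp add: y_def)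
    qed
    then show ?thesis by blast
  qed
  then obtain N b where b: "\<And>k x. k \<in> {1..n} \<Longrightarrow> x \<ge> 0 \<Longrightarrow> cmod (g k x - (\<Sum>i\<le>N k. b k i * of_real (exp (- real (Suc i) * x)))) \<le> e * exp (- x)"
    by metis
  define f where "f = (\<lambda>j x. \<Sum>k\<in>{1..n}. \<Sum>i\<le>N k. b k i * edge_exp (real (Suc i)) k j x)"
  define v where "v = (\<lambda>j x. \<Sum>k\<in>{1..n}. \<Sum>i\<le>N k. b k i * vv (real (Suc i)) k j x)"
  have "exp_span \<nat> f v" unfolding f_def v_def
    by (intro exp_span_sum exp_span_scale exp_span_single) (auto simp del: of_nat_Suc)
  moreover have "f j x = (\<Sum>i\<le>N j. b j i * of_real (exp (- real (Suc i) * x)))" if j: "j \<in> {1..n}" for j x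
  proof -
    have "f j x = (\<Sum>k\<in>{1..n}. if k = j then (\<Sum>i\<le>N j. b j i * of_real (exp (- real (Suc i) * x))) else 0)"
      unfolding f_def by (intro sum.cong refl) (auto simp: edge_exp_def)
    then show ?thesis using j by simp
  qed
  ultimately show ?thesis using b by (intro exI[of _ f] exI[of _ v]) auto
qed

end

section \<open>Approximation in L2 by continuous functions of bounded support\<close>

lemma L2_approx_truncated:
  fixes f :: "real \<Rightarrow> complex"
  assumes f: "L2 (lebesgue_on {0<..}) f" and e: "0 < e"
  shows "\<exists>N>0. \<exists>h. h \<in> borel_measurable (lebesgue_on {0<..}) \<and> (\<forall>x. cmod (h x) \<le> N) \<and> (\<forall>x>N. h x = 0) \<and>
     (LINT x|lebesgue_on {0<..}. (cmod (f x - h x))^2) < e"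
proof -
  define h where "h = (\<lambda>i x. if cmod (f x) \<le> real i \<and> x \<le> real i then f x else 0)"
  have fm[measurable]: "f \<in> borel_measurable (lebesgue_on {0<..})" using f by (simp add: L2_def)
  have idm[measurable]: "(\<lambda>x. x) \<in> borel_measurable (lebesgue_on {0::real<..})" by (rule borel_imp_lebesgue_on) simp
  have hm: "h i \<in> borel_measurable (lebesgue_on {0<..})" for i
    unfolding h_def by measurable
  have "(\<lambda>i. LINT x|lebesgue_on {0<..}. (cmod (f x - h i x))^2) \<longlonglongrightarrow> (LINT x|lebesgue_on {0::real<..}. 0)"
  proof (rule integral_dominated_convergence[where w="\<lambda>x. (cmod (f x))^2"])
    show "AE x in lebesgue_on {0<..}. (\<lambda>i. (cmod (f x - h i x))^2) \<longlonglongrightarrow> 0"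
    proof (rule AE_I2)
      fix x :: real
      have "\<forall>\<^sub>F i in sequentially. (cmod (f x - h i x))^2 = 0"
        using eventually_ge_at_top[of "nat \<lceil>max (cmod (f x)) x\<rceil>"]
      proof eventually_elim
        case (elim i)
        then have "max (cmod (f x)) x \<le> real i" by linarith
        then show ?case by (simp add: h_def)
      qed
      then show "(\<lambda>i. (cmod (f x - h i x))^2) \<longlonglongrightarrow> 0" by (rule tendsto_eventually)
    qed
    show "AE x in lebesgue_on {0<..}. norm ((cmod (f x - h i x))^2) \<le> (cmod (f x))^2" for i
      by (auto simp: h_def)
  qed (use f hm in \<open>auto simp: L2_def\<close>)
  then have "(\<lambda>i. LINT x|lebesgue_on {0<..}. (cmod (f x - h i x))^2) \<longlonglongrightarrow> 0" by simp
  from order_tendstoD(2)[OF this e] have "\<forall>\<^sub>F i in sequentially. (LINT x|lebesgue_on {0<..}. (cmod (f x - h i x))^2) < e \<and> i \<ge> 1"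
    using eventually_ge_at_top[of 1] by eventually_elim auto
  then obtain i where i: "(LINT x|lebesgue_on {0<..}. (cmod (f x - h i x))^2) < e" "i \<ge> 1"
    using eventually_happens'[OF sequentially_bot] by blast
  have "real i > 0" using i by simp
  moreover have "\<forall>x. cmod (h i x) \<le> real i" "\<forall>x>real i. h i x = 0" by (auto simp: h_def)
  ultimately show ?thesis using i(1) hm[of i] by blast
qed

lemma integrable_indicator_Ioc: "integrable (lebesgue_on {0<..}) (\<lambda>x::real. C * indicator {..b} x :: real)"
proof -
  have "integrable lborel (\<lambda>x::real. C * indicator {0<..b} x)"
    by (intro integrable_mult_right integrable_real_indicator) (use emeasure_bounded_finite[of "{0<..b}"] in auto)
  moreover have "indicator {0<..} x *\<^sub>R (C * indicator {..b} x) = C * indicator {0<..b} x" for x :: real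
    by (auto simp: indicator_def)
  moreover have "(\<lambda>x::real. C * indicator {..b} x) \<in> borel_measurable borel" by simp
  ultimately show ?thesis by (subst integral_lebesgue_on_borel(1)) (simp_all only: greaterThan_borel)
qed

text \<open>A Lebesgue measurable function is almost everywhere a limit of continuous ones. The
  truncated function is bounded by N and vanishes beyond N, so clipping the approximants at N and
  cutting them off between N and N + 1 leaves the limit unchanged and makes the convergence
  dominated.\<close>

lemma L2_approx_continuous:
  fixes f :: "real \<Rightarrow> complex"
  assumes f: "L2 (lebesgue_on {0<..}) f" and e: "0 < e"
  shows "\<exists>g M. continuous_on UNIV g \<and> 0 < M \<and> (\<forall>x\<ge>M. g x = 0) \<and> L2 (lebesgue_on {0<..}) g \<and>
     (LINT x|lebesgue_on {0<..}. (cmod (f x - g x))^2) < e"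
proof -
  obtain N :: real and h :: "real \<Rightarrow> complex" where N: "N > 0" and hm[measurable]: "h \<in> borel_measurable (lebesgue_on {0<..})" and hb: "\<And>x::real. cmod (h x) \<le> N"
    and h0: "\<And>x::real. x > N \<Longrightarrow> h x = 0" and he: "(LINT x|lebesgue_on {0<..}. (cmod (f x - h x))^2) < e/4"
    using L2_approx_truncated[OF f, of "e/4"] e by auto
  have "(\<lambda>x. if x \<in> {0<..} then h x else 0) \<in> borel_measurable lebesgue"
    using hm by (subst borel_measurable_if) auto
  then have "(\<lambda>x. if x \<in> {0<..} then h x else 0) measurable_on UNIV"
    by (rule lebesgue_measurable_imp_measurable_on) simp
  then obtain Nn g where g: "negligible Nn" "\<And>i. continuous_on UNIV (g i)"
      "\<And>x. x \<notin> Nn \<Longrightarrow> (\<lambda>i. g i x) \<longlonglongrightarrow> (if x \<in> {0<..} then h x else 0)"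
    unfolding measurable_on_def by auto
  \<comment> \<open>Retraction onto the disc of radius N, written with a maximum to make continuity
    visible.\<close>
  define cl where "cl = (\<lambda>z::complex. z / of_real (max 1 (cmod z / N)))"
  define cut where "cut = (\<lambda>x::real. max 0 (min 1 (N + 1 - x)))"
  define G where "G = (\<lambda>i x. cl (g i x) * of_real (cut x))"
  have mx: "max 1 (cmod z / N) > 0" for z by (simp add: less_max_iff_disj)
  have clc: "continuous_on UNIV cl" unfolding cl_def
    by (intro continuous_intros continuous_on_max) (use N mx in \<open>auto simp: less_le\<close>)
  have clb: "cmod (cl z) \<le> N" for z
  proof -
    have "cmod z \<le> N * max 1 (cmod z / N)" using N by (auto simp: max_def field_simps)
    then show ?thesis using mx[of z] by (simp add: cl_def norm_divide field_simps)
  qed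
  have clid: "cl z = z" if "cmod z \<le> N" for z
  proof -
    have "max 1 (cmod z / N) = 1" using that N by (auto simp: max_def field_simps)
    then show ?thesis by (simp add: cl_def)
  qed
  have cutc: "continuous_on UNIV cut" unfolding cut_def by (intro continuous_intros continuous_on_max continuous_on_min)
  have cutb: "0 \<le> cut x" "cut x \<le> 1" for x by (auto simp: cut_def)
  have Gc: "continuous_on UNIV (G i)" for i
    unfolding G_def by (intro continuous_intros continuous_on_compose2[OF clc g(2)] cutc) auto
  have Gm: "G i \<in> borel_measurable (lebesgue_on {0<..})" for i
    by (intro borel_imp_lebesgue_on borel_measurable_continuous_onI Gc)
  have Gb: "cmod (G i x) \<le> N * indicator {..N+1} x" for i x
  proof -
    have "cmod (G i x) \<le> N * cut x"
      unfolding G_def norm_mult using clb[of "g i x"] cutb[of x] by (auto intro!: mult_right_mono)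
    also have "\<dots> \<le> N * indicator {..N+1} x"
      using N cutb[of x] by (intro mult_left_mono) (auto simp: cut_def indicator_def)
    finally show ?thesis .
  qed
  have Gsq: "(cmod (G i x))^2 \<le> N^2 * indicator {..N+1} x" for i x
    using power_mono[OF Gb[of i x], of 2] by (cases "x \<le> N + 1") (simp_all add: power_mult_distrib)
  have hb': "cmod (h x) \<le> N * indicator {..N+1} x" for x
    using hb[of x] h0[of x] by (auto simp: indicator_def)
  have hsq: "(cmod (h x))^2 \<le> N^2 * indicator {..N+1} x" for x
    using power_mono[OF hb'[of x], of 2] by (cases "x \<le> N + 1") (simp_all add: power_mult_distrib)
  have GL: "L2 (lebesgue_on {0<..}) (G i)" for i
    by (rule L2_bound[OF Gm integrable_indicator_Ioc[of "N^2" "N+1"]]) (rule Gsq)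
  have hL: "L2 (lebesgue_on {0<..}) h"
    by (rule L2_bound[OF hm integrable_indicator_Ioc[of "N^2" "N+1"]]) (rule hsq)
  have "(\<lambda>i. LINT x|lebesgue_on {0<..}. (cmod (h x - G i x))^2) \<longlonglongrightarrow> (LINT x|lebesgue_on {0::real<..}. 0)"
  proof (rule integral_dominated_convergence[where w="\<lambda>x. (4 * N^2) * indicator {..N+1} x"])
    have "AE x in lebesgue. x \<notin> Nn" using g(1) by (intro AE_not_in) (simp add: negligible_iff_null_sets)
    then have "AE x in lebesgue_on {0<..}. x \<notin> Nn" by (subst AE_restrict_space_iff) auto
    moreover have "AE x in lebesgue_on {0<..}. (0::real) < x" by (rule AE_I2) auto
    ultimately show "AE x in lebesgue_on {0<..}. (\<lambda>i. (cmod (h x - G i x))^2) \<longlonglongrightarrow> 0"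
    proof eventually_elim
      case (elim x)
      have "(\<lambda>i. g i x) \<longlonglongrightarrow> h x" using g(3)[OF elim(1)] elim(2) by simp
      moreover have "isCont cl (h x)" using clc by (simp add: continuous_on_eq_continuous_at)
      ultimately have "(\<lambda>i. cl (g i x)) \<longlonglongrightarrow> cl (h x)" by (rule isCont_tendsto_compose[rotated])
      then have "(\<lambda>i. G i x) \<longlonglongrightarrow> h x * of_real (cut x)"
        unfolding G_def clid[OF hb] by (intro tendsto_mult tendsto_const)
      also have "h x * of_real (cut x) = h x" using h0[of x] by (cases "x > N") (auto simp: cut_def)
      finally have "(\<lambda>i. (cmod (h x - G i x))^2) \<longlonglongrightarrow> (cmod (h x - h x))^2"
        by (intro tendsto_power tendsto_norm tendsto_diff tendsto_const)
      then show ?case by simp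
    qed
    show "AE x in lebesgue_on {0<..}. norm ((cmod (h x - G i x))^2) \<le> (4 * N^2) * indicator {..N+1} x" for i
    proof (rule AE_I2)
      fix x :: real
      have "(cmod (h x - G i x))^2 \<le> 2 * (cmod (h x))^2 + 2 * (cmod (- G i x))^2"
        using cmod_add_sq_le[of "h x" "- G i x"] by simp
      then show "norm ((cmod (h x - G i x))^2) \<le> (4 * N^2) * indicator {..N+1} x"
        using Gsq[of i x] hsq[of x] by simp
    qed
  qed (use hm Gm integrable_indicator_Ioc in auto)
  then have "(\<lambda>i. LINT x|lebesgue_on {0<..}. (cmod (h x - G i x))^2) \<longlonglongrightarrow> 0" by simp
  from order_tendstoD(2)[OF this, of "e/4"] e have "\<forall>\<^sub>F i in sequentially. (LINT x|lebesgue_on {0<..}. (cmod (h x - G i x))^2) < e/4"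
    by simp
  then obtain i where i: "(LINT x|lebesgue_on {0<..}. (cmod (h x - G i x))^2) < e/4"
    using eventually_happens'[OF sequentially_bot] by blast
  have "(LINT x|lebesgue_on {0<..}. (cmod (f x - G i x))^2) \<le>
     (LINT x|lebesgue_on {0<..}. 2 * (cmod (f x - h x))^2 + 2 * (cmod (h x - G i x))^2)"
  proof (rule integral_mono)
    show "(cmod (f x - G i x))^2 \<le> 2 * (cmod (f x - h x))^2 + 2 * (cmod (h x - G i x))^2" for x
      using cmod_add_sq_le[of "f x - h x" "h x - G i x"] by simp
  qed (use f hL GL[of i] L2_diff L2_integrable in \<open>auto intro!: L2_integrable L2_diff\<close>)
  also have "\<dots> = 2 * (LINT x|lebesgue_on {0<..}. (cmod (f x - h x))^2) + 2 * (LINT x|lebesgue_on {0<..}. (cmod (h x - G i x))^2)"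
    using L2_integrable[OF L2_diff[OF f hL]] L2_integrable[OF L2_diff[OF hL GL[of i]]] by simp
  also have "\<dots> < e" using he i by simp
  finally have "(LINT x|lebesgue_on {0<..}. (cmod (f x - G i x))^2) < e" .
  moreover have "\<forall>x\<ge>N+1. G i x = 0" by (auto simp: G_def cut_def)
  ultimately show ?thesis using Gc[of i] GL[of i] N by (intro exI[of _ "G i"] exI[of _ "N+1"]) auto
qed

lemma tuple_L2_measurable: "tuple_L2 n M u \<Longrightarrow> k \<in> {1..n} \<Longrightarrow> u k \<in> borel_measurable (M k)"
  by (auto simp: tuple_L2_def L2_def)

lemma tuple_norm2_Hm_le:
  assumes "\<And>k. k \<in> {1..n} \<Longrightarrow> f k \<in> borel_measurable (lebesgue_on {0<..})"
    and b: "\<And>k x. k \<in> {1..n} \<Longrightarrow> 0 < x \<Longrightarrow> cmod (f k x) \<le> e * exp (- x)" and e: "0 \<le> e"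
  shows "tuple_L2 n Hm f" "tuple_norm2 n Hm f \<le> real n * e^2"
proof -
  have h: "has_bochner_integral (lebesgue_on {0<..}) (\<lambda>x::real. e^2 * exp (- 2 * x)) (e^2 * (1/2))"
    by (intro has_bochner_integral_mult_right exp_decay_integral_real) simp
  then have hi: "integrable (lebesgue_on {0<..}) (\<lambda>x::real. e^2 * exp (- 2 * x))"
    by (simp only: has_bochner_integral_iff)
  have sq: "(cmod (f k x))^2 \<le> e^2 * exp (- 2 * x)" if "k \<in> {1..n}" "0 < x" for k x
    using power_mono[OF b[OF that], of 2] by (simp add: power_mult_distrib exp_double[symmetric])
  have L: "L2 (lebesgue_on {0<..}) (f k)" if "k \<in> {1..n}" for k
    by (rule L2_bound[OF assms(1)[OF that] hi]) (use sq[OF that] in auto)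
  then show "tuple_L2 n Hm f" by (simp add: tuple_L2_def)
  have "(LINT x|lebesgue_on {0<..}. (cmod (f k x))^2) \<le> e^2" if "k \<in> {1..n}" for k
  proof -
    have "(LINT x|lebesgue_on {0<..}. (cmod (f k x))^2) \<le> (LINT x|lebesgue_on {0::real<..}. e^2 * exp (- 2 * x))"
      by (rule integral_mono[OF L2_integrable[OF L[OF that]] hi]) (use sq[OF that] in auto)
    also have "\<dots> = e^2 * (1/2)" using h by (simp add: has_bochner_integral_iff)
    also have "\<dots> \<le> e^2" by simp
    finally show ?thesis .
  qed
  then have "tuple_norm2 n Hm f \<le> (\<Sum>k\<in>{1..n}. e^2)" unfolding tuple_norm2_def by (intro sum_mono) auto
  then show "tuple_norm2 n Hm f \<le> real n * e^2" by simp
qed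

section \<open>The transform of exponentials and of test functions\<close>

context star begin

text \<open>The eigenfunction is the decaying (or oscillating) exponential on every edge, corrected
  on edge j by a multiple of a function that vanishes at the vertex. The multiple compensates the
  total derivative -W, so that the Kirchhoff condition holds.\<close>

lemma F_eq:
  assumes j: "j \<in> {1..n}" and m: "m \<in> {1..n}" and lam: "a j < lam"
  shows "F n c a j (of_real lam) m x = exp (- Z m lam * of_real x) +
    (if m = j then W lam / (2 * of_real (c j) * Z j lam) * (exp (Z j lam * of_real x) - exp (- Z j lam * of_real x)) else 0)"
proof (cases "m = j")
  case False
  then show ?thesis by (simp add: F_def xi_zeta[OF m] mult.assoc)
next
  case True
  have zn: "Z j lam \<noteq> 0" using Im_zeta_pos[OF j lam] by auto
  have cn: "c j \<noteq> 0" using c_pos[OF j] by simp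
  define z where "z = Z j lam"
  have xi: "xi c a j (of_real lam) = - \<i> * z" using xi_zeta[OF j] by (simp add: z_def)
  have "(\<Sum>l\<in>{1..n}-{j}. of_real (c l) * xi c a l (of_real lam)) = (\<Sum>l\<in>{1..n}-{j}. - \<i> * (of_real (c l) * Z l lam))"
    by (intro sum.cong refl) (simp add: xi_zeta)
  also have "\<dots> = - \<i> * (W lam - of_real (c j) * z)"
    unfolding sum_distrib_left[symmetric] zeta_sum_def using j by (simp add: sum_diff1 z_def)
  finally have ss: "(\<Sum>l\<in>{1..n}-{j}. of_real (c l) * xi c a l (of_real lam)) = - \<i> * (W lam - of_real (c j) * z)" .
  have s: "s_fun n c a j (of_real lam) = - (W lam - of_real (c j) * z) / (of_real (c j) * z)"
    unfolding s_fun_def ss xi using cn zn by (simp add: z_def[symmetric] field_simps)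
  have "F n c a j (of_real lam) m x = cos (- \<i> * z * of_real x) - \<i> * (- (W lam - of_real (c j) * z) / (of_real (c j) * z)) * sin (- \<i> * z * of_real x)"
    using True by (simp add: F_def xi s)
  also have "cos (- \<i> * z * of_real x) = (exp (z * of_real x) + exp (- z * of_real x)) / 2"
    by (simp add: cos_exp_eq mult.assoc[symmetric])
  also have "sin (- \<i> * z * of_real x) = (exp (z * of_real x) - exp (- z * of_real x)) / (2 * \<i>)"
    by (simp add: sin_exp_eq mult.assoc[symmetric])
  also have "(exp (z * of_real x) + exp (- z * of_real x)) / 2 - \<i> * (- (W lam - of_real (c j) * z) / (of_real (c j) * z)) * ((exp (z * of_real x) - exp (- z * of_real x)) / (2 * \<i>))
     = exp (- z * of_real x) + W lam / (2 * of_real (c j) * z) * (exp (z * of_real x) - exp (- z * of_real x))"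
    using cn zn by (simp add: z_def[symmetric] field_simps)
  finally show ?thesis using True by (simp add: z_def)
qed

lemma F_continuous: "continuous_on UNIV (F n c a j lam m)"
  unfolding F_def by (cases "m = j") (auto intro!: continuous_intros)

lemma cnj_F_measurable: "(\<lambda>x. cnj (F n c a j lam m x)) \<in> borel_measurable (lebesgue_on S)"
  by (intro borel_imp_lebesgue_on borel_measurable_continuous_onI continuous_intros F_continuous)

text \<open>Above a j the root \<open>Z j lam\<close> is imaginary, so the added terms only
  oscillate; on the other edges the real part of the root is nonnegative. A bounded kernel lets V
  act on all integrable functions.\<close>

lemma F_bound:
  assumes j: "j \<in> {1..n}" and lam: "a j < lam"
  shows "\<exists>C\<ge>0. \<forall>m\<in>{1..n}. \<forall>x\<ge>0. cmod (F n c a j (of_real lam) m x) \<le> C"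
proof -
  define \<sigma> where "\<sigma> = cmod (W lam / (2 * of_real (c j) * Z j lam))"
  have "cmod (F n c a j (of_real lam) m x) \<le> 1 + \<sigma> * 2" if m: "m \<in> {1..n}" and x: "x \<ge> 0" for m x
  proof -
    have e1: "cmod (exp (- Z m lam * of_real x)) \<le> 1" using Re_zeta[of m lam] x by simp
    have e2: "cmod (exp (Z j lam * of_real x)) = 1" "cmod (exp (- Z j lam * of_real x)) = 1"
      using Im_zeta_pos[OF j lam] by simp_all
    have "cmod (exp (Z j lam * of_real x) - exp (- Z j lam * of_real x)) \<le> 2"
      by (rule order_trans[OF norm_triangle_ineq4]) (simp only: e2)
    then have "cmod (W lam / (2 * of_real (c j) * Z j lam) * (exp (Z j lam * of_real x) - exp (- Z j lam * of_real x))) \<le> \<sigma> * 2"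
      unfolding norm_mult[of "W lam / (2 * of_real (c j) * Z j lam)"] \<sigma>_def by (intro mult_left_mono) auto
    then have e3: "cmod (if m = j then W lam / (2 * of_real (c j) * Z j lam) * (exp (Z j lam * of_real x) - exp (- Z j lam * of_real x)) else 0) \<le> \<sigma> * 2"
      by (auto simp: \<sigma>_def)
    show ?thesis unfolding F_eq[OF j m lam] by (rule norm_triangle_mono[OF e1 e3])
  qed
  moreover have "0 \<le> 1 + \<sigma> * 2" by (simp add: \<sigma>_def)
  ultimately show ?thesis by blast
qed

lemma V_integrable:
  assumes j: "j \<in> {1..n}" and lam: "a j < lam" and m: "m \<in> {1..n}" and f: "integrable (lebesgue_on {0<..}) f"
  shows "integrable (lebesgue_on {0<..}) (\<lambda>x. f x * cnj (F n c a j (of_real lam) m x))"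
proof -
  obtain C where C: "C \<ge> 0" "\<And>m x. m \<in> {1..n} \<Longrightarrow> x \<ge> 0 \<Longrightarrow> cmod (F n c a j (of_real lam) m x) \<le> C"
    using F_bound[OF j lam] by blast
  have "integrable (lebesgue_on {0<..}) (\<lambda>x. C * norm (f x))" using f by simp
  then show ?thesis
  proof (rule Bochner_Integration.integrable_bound)
    show "(\<lambda>x. f x * cnj (F n c a j (of_real lam) m x)) \<in> borel_measurable (lebesgue_on {0<..})"
      using f by (intro borel_measurable_times cnj_F_measurable) auto
    show "AE x in lebesgue_on {0<..}. norm (f x * cnj (F n c a j (of_real lam) m x)) \<le> norm (C * norm (f x))"
    proof (rule AE_I2)
      fix x :: real assume "x \<in> space (lebesgue_on {0<..})"
      then have "cmod (F n c a j (of_real lam) m x) \<le> C" using C(2)[OF m] by auto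
      then have "cmod (f x) * cmod (F n c a j (of_real lam) m x) \<le> cmod (f x) * C" by (intro mult_left_mono) auto
      then show "norm (f x * cnj (F n c a j (of_real lam) m x)) \<le> norm (C * norm (f x))"
        using C(1) by (simp add: norm_mult mult.commute)
    qed
  qed
qed

lemma V_edge_exp:
  assumes \<kappa>: "0 < \<kappa>" and k: "k \<in> {1..n}" and j: "j \<in> {1..n}" and lam: "a j < lam"
  shows "V n c a (edge_exp \<kappa> k) j lam = vv \<kappa> k j lam"
proof -
  have ex: "has_bochner_integral (lebesgue_on {0<..}) (\<lambda>x. of_real (exp (- \<kappa> * x)) * exp (- w * of_real x)) (1 / (of_real \<kappa> + w))"
    if "0 \<le> Re w" for w
  proof -
    have "has_bochner_integral (lebesgue_on {0<..}) (\<lambda>x::real. exp (- (of_real \<kappa> + w) * of_real x)) (1 / (of_real \<kappa> + w))"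
      by (rule exp_decay_integral) (use that \<kappa> in simp)
    moreover have "exp (- (of_real \<kappa> + w) * of_real x) = of_real (exp (- \<kappa> * x)) * exp (- w * of_real x)" for x
      by (simp del: exp_of_real add: exp_of_real[symmetric] exp_add[symmetric] algebra_simps)
    ultimately show ?thesis by simp
  qed
  define z where "z = Z j lam"
  have zi: "z \<noteq> 0" "Re z = 0" using Im_zeta_pos[OF j lam] by (auto simp: z_def)
  then have zeta_lower: "cnj z = - z" by (simp add: complex_eq_iff)
  have cn: "c j \<noteq> 0" using c_pos[OF j] by simp
  have nz: "of_real \<kappa> + z \<noteq> 0" "of_real \<kappa> - z \<noteq> 0"
    using zi \<kappa> by (auto simp: complex_eq_iff)
  have "V n c a (edge_exp \<kappa> k) j lam = (\<Sum>m\<in>{1..n}. if m = k then (LINT x|lebesgue_on {0<..}. of_real (exp (- \<kappa> * x)) * cnj (F n c a j (of_real lam) k x)) else 0)"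
    unfolding V_def by (intro sum.cong refl) (auto simp: edge_exp_def)
  also have "\<dots> = (LINT x|lebesgue_on {0<..}. of_real (exp (- \<kappa> * x)) * cnj (F n c a j (of_real lam) k x))"
    using k by simp
  also have "\<dots> = vv \<kappa> k j lam"
  proof (cases "j = k")
    case False
    have "cnj (F n c a j (of_real lam) k x) = exp (- cnj (Z k lam) * of_real x)" for x
      unfolding F_eq[OF j k lam] using False by (simp add: exp_cnj)
    then show ?thesis using ex[of "cnj (Z k lam)"] Re_zeta[of k lam] False
      by (simp add: has_bochner_integral_iff edge_exp_transform_def)
  next
    case True
    have zk: "Z k lam = z" using True by (simp add: z_def)
    define s where "s = cnj (W lam) / (2 * of_real (c j) * (- z))"
    have F: "cnj (F n c a j (of_real lam) k x) = exp (- (- z) * of_real x) + s * (exp (- z * of_real x) - exp (- (- z) * of_real x))" for x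
      unfolding F_eq[OF j k lam] using True zeta_lower zk by (simp add: exp_cnj s_def)
    have "has_bochner_integral (lebesgue_on {0<..}) (\<lambda>x. of_real (exp (- \<kappa> * x)) * exp (- (- z) * of_real x) + s * (of_real (exp (- \<kappa> * x)) * exp (- z * of_real x) - of_real (exp (- \<kappa> * x)) * exp (- (- z) * of_real x)))
      (1 / (of_real \<kappa> + - z) + s * (1 / (of_real \<kappa> + z) - 1 / (of_real \<kappa> + - z)))"
      by (intro has_bochner_integral_add has_bochner_integral_diff has_bochner_integral_mult_right ex) (use zi in auto)
    moreover have "of_real (exp (- \<kappa> * x)) * exp (- (- z) * of_real x) + s * (of_real (exp (- \<kappa> * x)) * exp (- z * of_real x) - of_real (exp (- \<kappa> * x)) * exp (- (- z) * of_real x))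
        = of_real (exp (- \<kappa> * x)) * cnj (F n c a j (of_real lam) k x)" for x
      unfolding F by (simp add: algebra_simps)
    ultimately have "(LINT x|lebesgue_on {0<..}. of_real (exp (- \<kappa> * x)) * cnj (F n c a j (of_real lam) k x)) =
        1 / (of_real \<kappa> + - z) + s * (1 / (of_real \<kappa> + z) - 1 / (of_real \<kappa> + - z))"
      by (simp add: has_bochner_integral_iff)
    also have "1 / (of_real \<kappa> + z) - 1 / (of_real \<kappa> + - z) = - 2 * z / ((of_real \<kappa> + z) * (of_real \<kappa> - z))"
      using nz by (simp add: field_simps)
    also have "1 / (of_real \<kappa> + - z) + s * (- 2 * z / ((of_real \<kappa> + z) * (of_real \<kappa> - z))) = vv \<kappa> k j lam"
      using nz zi cn True by (simp add: edge_exp_transform_def zk zeta_lower s_def divide_simps)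
    finally show ?thesis .
  qed
  finally show ?thesis .
qed

lemma exp_span_integrable: "exp_span K e v \<Longrightarrow> integrable (lebesgue_on {0<..}) (e m)"
proof (induction rule: exp_span.induct)
  case (step e v \<kappa> k b)
  have "integrable (lebesgue_on {0<..}) (edge_exp \<kappa> k m)"
  proof (cases "m = k")
    case True
    then show ?thesis using exp_decay_integral_real[OF step(3)]
      by (simp add: edge_exp_def[abs_def] has_bochner_integral_iff integrable_of_real)
  next
    case False
    then show ?thesis by (simp add: edge_exp_def[abs_def])
  qed
  then show ?case using step by simp
qed simp

lemma exp_span_V: assumes "exp_span K e v" and j: "j \<in> {1..n}" and lam: "a j < lam"
  shows "V n c a e j lam = v j lam"
  using assms(1)
proof induction
  case zero
  then show ?case by (simp add: V_def)
next
  case (step e v \<kappa> k b)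
  have "V n c a (\<lambda>j x. e j x + b * edge_exp \<kappa> k j x) j lam = V n c a e j lam + b * V n c a (edge_exp \<kappa> k) j lam"
  proof -
    have i: "integrable (lebesgue_on {0<..}) (\<lambda>x. e m x * cnj (F n c a j (of_real lam) m x))"
       "integrable (lebesgue_on {0<..}) (\<lambda>x. edge_exp \<kappa> k m x * cnj (F n c a j (of_real lam) m x))" if "m \<in> {1..n}" for m
      by (intro V_integrable[OF j lam that] exp_span_integrable[OF step(1)] exp_span_integrable[OF exp_span_single[OF step(2,3,4)]])+
    show ?thesis unfolding V_def sum_distrib_left sum.distrib[symmetric]
      using i by (intro sum.cong refl) (simp add: distrib_right mult.assoc)
  qed
  then show ?case using step V_edge_exp[OF step(3,4) j lam] by simp
qed

text \<open>An error of at most exp (-x) / (i + 1) is small in L2, so the originals converge, and in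
  L1, so their integrals against the bounded kernel converge at every lam. The pointwise limit is
  the integral that defines V.\<close>

lemma graph_test:
  assumes t: "\<And>k. k \<in> {1..n} \<Longrightarrow> test_fun (\<phi> k)"
  shows "graph \<phi> (V n c a \<phi>)"
proof -
  have cont: "continuous_on UNIV (\<phi> k)" if k: "k \<in> {1..n}" for k
  proof -
    obtain D :: "nat \<Rightarrow> real \<Rightarrow> complex" where "D 0 = \<phi> k" "\<And>m x. (D m has_vector_derivative D (Suc m) x) (at x)"
      using t[OF k] unfolding test_fun_def by blast
    then have "isCont (\<phi> k) x" for x using has_vector_derivative_continuous by metis
    then show ?thesis by (simp add: continuous_at_imp_continuous_on)
  qed
  have supp: "\<exists>M>0. \<forall>x\<ge>M. \<phi> k x = 0" if k: "k \<in> {1..n}" for k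
  proof -
    obtain s t where "0 < s" "s \<le> t" "\<forall>x. x \<notin> {s..t} \<longrightarrow> \<phi> k x = 0"
      using t[OF k] unfolding test_fun_def by blast
    then show ?thesis by (intro exI[of _ "t + 1"]) auto
  qed
  have "\<exists>f v. exp_span \<nat> f v \<and> (\<forall>k\<in>{1..n}. \<forall>x\<ge>0. cmod (\<phi> k x - f k x) \<le> inverse (real (Suc i)) * exp (- x))" for i
    by (rule exp_span_approx[OF cont supp]) auto
  then have "\<forall>i. \<exists>p. exp_span \<nat> (fst p) (snd p) \<and> (\<forall>k\<in>{1..n}. \<forall>x\<ge>0. cmod (\<phi> k x - fst p k x) \<le> inverse (real (Suc i)) * exp (- x))"
    by (simp only: split_paired_Ex fst_conv snd_conv) blast
  from choice[OF this] obtain p where p: "\<forall>i. exp_span \<nat> (fst (p i)) (snd (p i)) \<and>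
     (\<forall>k\<in>{1..n}. \<forall>x\<ge>0. cmod (\<phi> k x - fst (p i) k x) \<le> inverse (real (Suc i)) * exp (- x))" ..
  define f where "f = (\<lambda>i. fst (p i))"
  define v where "v = (\<lambda>i. snd (p i))"
  have fv: "exp_span \<nat> (f i) (v i)" and b: "k \<in> {1..n} \<Longrightarrow> x \<ge> 0 \<Longrightarrow> cmod (\<phi> k x - f i k x) \<le> inverse (real (Suc i)) * exp (- x)" for i k x
    using p unfolding f_def v_def by blast+
  have \<phi>m: "\<phi> k \<in> borel_measurable (lebesgue_on {0<..})" if "k \<in> {1..n}" for k
    by (intro borel_imp_lebesgue_on borel_measurable_continuous_onI cont that)
  have fL: "tuple_L2 n Hm (f i)" for i using exp_span_L2[OF fv] by simp
  have dm: "(\<lambda>x. \<phi> k x - f i k x) \<in> borel_measurable (lebesgue_on {0<..})" if "k \<in> {1..n}" for k i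
    by (intro borel_measurable_diff \<phi>m[OF that] tuple_L2_measurable[OF fL that])
  have dL: "tuple_L2 n Hm (\<lambda>k x. \<phi> k x - f i k x)" for i
    by (rule tuple_norm2_Hm_le(1)[OF dm b]) auto
  have dn: "tuple_norm2 n Hm (\<lambda>k x. \<phi> k x - f i k x) \<le> real n * (inverse (real (Suc i)))^2" for i
    by (rule tuple_norm2_Hm_le(2)[OF dm b]) auto
  have \<phi>L: "tuple_L2 n Hm \<phi>" using tuple_L2_add[OF dL[of 0] fL[of 0]] by simp
  show ?thesis
  proof (rule graph_pointwise[OF graph_S[OF exp_span_pos[OF fv]] \<phi>L])
    have "(\<lambda>i. real n * (inverse (real (Suc i)))^2) \<longlonglongrightarrow> real n * 0^2"
      by (intro tendsto_mult tendsto_power tendsto_const LIMSEQ_inverse_real_of_nat)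
    then have z: "(\<lambda>i. real n * (inverse (real (Suc i)))^2) \<longlonglongrightarrow> 0" by simp
    show "(\<lambda>i. tuple_norm2 n Hm (\<lambda>k x. f i k x - \<phi> k x)) \<longlonglongrightarrow> 0"
      unfolding tuple_norm2_minus_commute[of n Hm "f _" \<phi>]
      by (rule Lim_null_comparison[OF always_eventually z]) (use dn in simp)
    have lim: "(\<lambda>i. v i j lam) \<longlonglongrightarrow> V n c a \<phi> j lam" if j: "j \<in> {1..n}" and lam: "a j < lam" for j lam
    proof -
      obtain C where C: "C \<ge> 0" "\<And>m x. m \<in> {1..n} \<Longrightarrow> x \<ge> 0 \<Longrightarrow> cmod (F n c a j (of_real lam) m x) \<le> C"
        using F_bound[OF j lam] by blast
      have E: "has_bochner_integral (lebesgue_on {0<..}) (\<lambda>x::real. inverse (real (Suc i)) * C * exp (- 1 * x)) (inverse (real (Suc i)) * C)" for i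
        using has_bochner_integral_mult_right[OF exp_decay_integral_real[of 1], of "inverse (real (Suc i)) * C"] by (simp del: of_nat_Suc)
      have di: "integrable (lebesgue_on {0<..}) (\<lambda>x. \<phi> m x - f i m x)" if m: "m \<in> {1..n}" for m i
        by (rule Bochner_Integration.integrable_bound[OF _ dm[OF m], of "\<lambda>x. inverse (real (Suc i)) * exp (- 1 * x)"])
           (use exp_decay_integral_real[of 1] b[OF m] in \<open>auto simp: has_bochner_integral_iff simp del: of_nat_Suc intro!: AE_I2\<close>)
      have "cmod (v i j lam - V n c a \<phi> j lam) \<le> (\<Sum>m\<in>{1..n}. inverse (real (Suc i)) * C)" for i
      proof -
        have "V n c a \<phi> j lam - V n c a (f i) j lam = (\<Sum>m\<in>{1..n}. LINT x|lebesgue_on {0<..}. (\<phi> m x - f i m x) * cnj (F n c a j (of_real lam) m x))"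
          unfolding V_def sum_subtractf[symmetric]
        proof (intro sum.cong refl)
          fix m assume m: "m \<in> {1..n}"
          have i1: "integrable (lebesgue_on {0<..}) (f i m)" by (rule exp_span_integrable[OF fv])
          have i2: "integrable (lebesgue_on {0<..}) (\<phi> m)"
            using Bochner_Integration.integrable_add[OF di[OF m, of i] i1] by simp
          show "(LINT x|lebesgue_on {0<..}. \<phi> m x * cnj (F n c a j (of_real lam) m x)) - (LINT x|lebesgue_on {0<..}. f i m x * cnj (F n c a j (of_real lam) m x)) =
             (LINT x|lebesgue_on {0<..}. (\<phi> m x - f i m x) * cnj (F n c a j (of_real lam) m x))"
            using V_integrable[OF j lam m i1] V_integrable[OF j lam m i2]
            by (subst Bochner_Integration.integral_diff[symmetric]) (auto simp: left_diff_distrib)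
        qed
        also have "cmod \<dots> \<le> (\<Sum>m\<in>{1..n}. inverse (real (Suc i)) * C)"
        proof (intro sum_norm_le)
          fix m assume m: "m \<in> {1..n}"
          have "cmod (LINT x|lebesgue_on {0<..}. (\<phi> m x - f i m x) * cnj (F n c a j (of_real lam) m x)) \<le> (LINT x|lebesgue_on {0<..}. inverse (real (Suc i)) * C * exp (- 1 * x))"
          proof (rule Bochner_Integration.integral_norm_bound_integral[OF V_integrable[OF j lam m di[OF m]]])
            show "integrable (lebesgue_on {0<..}) (\<lambda>x. inverse (real (Suc i)) * C * exp (- 1 * x))" using E by (simp only: has_bochner_integral_iff)
            fix x :: real assume "x \<in> space (lebesgue_on {0<..})"
            then have x: "x \<ge> 0" by auto
            have "cmod (\<phi> m x - f i m x) * cmod (F n c a j (of_real lam) m x) \<le> (inverse (real (Suc i)) * exp (- x)) * C"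
              by (intro mult_mono b[OF m x] C(2)[OF m x]) auto
            then show "cmod ((\<phi> m x - f i m x) * cnj (F n c a j (of_real lam) m x)) \<le> inverse (real (Suc i)) * C * exp (- 1 * x)"
              by (simp add: norm_mult mult_ac)
          qed
          also have "\<dots> = inverse (real (Suc i)) * C" using E[of i] by (simp only: has_bochner_integral_iff)
          finally show "cmod (LINT x|lebesgue_on {0<..}. (\<phi> m x - f i m x) * cnj (F n c a j (of_real lam) m x)) \<le> inverse (real (Suc i)) * C" .
        qed
        finally show ?thesis using exp_span_V[OF fv j lam, of i] by (simp only: norm_minus_commute)
      qed
      then have bb: "norm (v i j lam - V n c a \<phi> j lam) \<le> real n * C * inverse (real (Suc i))" for i by (simp add: mult_ac)
      have "(\<lambda>i. real n * C * inverse (real (Suc i))) \<longlonglongrightarrow> real n * C * 0"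
        by (intro tendsto_mult tendsto_const LIMSEQ_inverse_real_of_nat)
      then have "(\<lambda>i. v i j lam - V n c a \<phi> j lam) \<longlonglongrightarrow> 0"
        by (intro Lim_null_comparison[OF always_eventually[OF allI[OF bb]]]) simp
      then show ?thesis by (simp add: LIM_zero_iff)
    qed
    fix k assume k: "k \<in> {1..n}"
    have sp: "x \<in> space (Q k) \<Longrightarrow> a k < x" for x by (simp add: qmeasure_def)
    show "AE x in Q k. (\<lambda>i. v i k x) \<longlonglongrightarrow> V n c a \<phi> k x"
      by (rule AE_I2) (rule lim[OF k sp])
    show "V n c a \<phi> k \<in> borel_measurable (Q k)"
      by (rule borel_measurable_LIMSEQ_metric[where f="\<lambda>i. v i k"]) (use tuple_L2_measurable[OF conjunct2[OF exp_span_L2[OF fv]] k] lim[OF k] sp in auto)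
  qed
qed

lemma exp_span_dense:
  assumes u: "tuple_L2 n Hm u" and e: "0 < e"
  shows "\<exists>f v. exp_span \<nat> f v \<and> tuple_norm2 n Hm (\<lambda>k x. u k x - f k x) < e"
proof -
  \<comment> \<open>The two approximations cost 2 (n d) + 2 (n d) in squared norm, which is below
    e.\<close>
  define d where "d = e / (4 * real (Suc n))"
  have d: "d > 0" using e by (simp add: d_def)
  have "\<forall>k\<in>{1..n}. \<exists>g. continuous_on UNIV g \<and> (\<exists>M>0. \<forall>x\<ge>M. g x = 0) \<and> L2 (lebesgue_on {0<..}) g \<and>
     (LINT x|lebesgue_on {0<..}. (cmod (u k x - g x))^2) < d"
  proof
    fix k assume k: "k \<in> {1..n}"
    have "L2 (lebesgue_on {0<..}) (u k)" using u k by (simp add: tuple_L2_def)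
    from L2_approx_continuous[OF this d] show "\<exists>g. continuous_on UNIV g \<and> (\<exists>M>0. \<forall>x\<ge>M. g x = 0) \<and> L2 (lebesgue_on {0<..}) g \<and>
     (LINT x|lebesgue_on {0<..}. (cmod (u k x - g x))^2) < d" by blast
  qed
  from bchoice[OF this] obtain g where g': "\<forall>k\<in>{1..n}. continuous_on UNIV (g k) \<and> (\<exists>M>0. \<forall>x\<ge>M. g k x = 0) \<and> L2 (lebesgue_on {0<..}) (g k) \<and>
     (LINT x|lebesgue_on {0<..}. (cmod (u k x - g k x))^2) < d" ..
  have g: "\<And>k. k \<in> {1..n} \<Longrightarrow> continuous_on UNIV (g k)" "\<And>k. k \<in> {1..n} \<Longrightarrow> \<exists>M>0. \<forall>x\<ge>M. g k x = 0"
    "\<And>k. k \<in> {1..n} \<Longrightarrow> L2 (lebesgue_on {0<..}) (g k)" "\<And>k. k \<in> {1..n} \<Longrightarrow> (LINT x|lebesgue_on {0<..}. (cmod (u k x - g k x))^2) < d"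
    using g' by blast+
  have gL: "tuple_L2 n Hm g" using g(3) by (simp add: tuple_L2_def)
  have "tuple_norm2 n Hm (\<lambda>k x. u k x - g k x) \<le> (\<Sum>k\<in>{1..n}. d)"
    unfolding tuple_norm2_def by (intro sum_mono less_imp_le g(4))
  then have 1: "tuple_norm2 n Hm (\<lambda>k x. u k x - g k x) \<le> real n * d" by simp
  \<comment> \<open>Being at most 1, s satisfies s^2 <= s <= d.\<close>
  define s where "s = min 1 d"
  have s: "0 < s" "s^2 \<le> d" using d by (auto simp: s_def min_def power2_eq_square intro: order_trans[OF mult_left_le])
  have "\<exists>f v. exp_span \<nat> f v \<and> (\<forall>k\<in>{1..n}. \<forall>x\<ge>0. cmod (g k x - f k x) \<le> s * exp (- x))"
    by (rule exp_span_approx[OF g(1,2) s(1)])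
  then obtain f v where f: "exp_span \<nat> f v" "\<forall>k\<in>{1..n}. \<forall>x\<ge>0. cmod (g k x - f k x) \<le> s * exp (- x)"
    by blast
  have fL: "tuple_L2 n Hm f" using exp_span_L2[OF f(1)] by simp
  have "tuple_norm2 n Hm (\<lambda>k x. g k x - f k x) \<le> real n * s^2"
    by (rule tuple_norm2_Hm_le) (use f(2) s in \<open>auto intro!: borel_measurable_diff tuple_L2_measurable[OF gL] tuple_L2_measurable[OF fL]\<close>)
  also have "\<dots> \<le> real n * d" using s by (intro mult_left_mono) auto
  finally have 2: "tuple_norm2 n Hm (\<lambda>k x. g k x - f k x) \<le> real n * d" .
  have "tuple_norm2 n Hm (\<lambda>k x. u k x - f k x) \<le> 2 * (real n * d) + 2 * (real n * d)"
    using tuple_norm2_triangle[OF u gL fL] 1 2 by linarith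
  also have "\<dots> < e"
  proof -
    have "real (Suc n) \<noteq> 0" by simp
    then have "4 * (real (Suc n) * d) = e" unfolding d_def by (simp del: of_nat_Suc)
    moreover have "real n * d < real (Suc n) * d" using d by simp
    ultimately show ?thesis by linarith
  qed
  finally show ?thesis using f(1) by blast
qed

end

section \<open>Weak derivatives\<close>

definition flat_fun :: "real poly \<Rightarrow> real \<Rightarrow> real" where
  "flat_fun p x = (if x > 0 then poly p (1 / x) * exp (- (1 / x)) else 0)"

text \<open>With y = 1 / x, the derivative of p(y) exp (-y) with respect to x is y^2 (p(y) - p'(y))
  exp (-y).\<close>

definition flat_next :: "real poly \<Rightarrow> real poly" where
  "flat_next p = [:0, 0, 1:] * (p - pderiv p)"

lemma poly_exp_decay: "((\<lambda>y. poly (p :: real poly) y * exp (- y)) \<longlongrightarrow> 0) at_top"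
proof -
  have "((\<lambda>y. \<Sum>i\<le>degree p. coeff p i * (y ^ i / exp y)) \<longlongrightarrow> (\<Sum>i\<le>degree p. coeff p i * 0)) at_top"
    by (intro tendsto_sum tendsto_mult tendsto_const tendsto_power_div_exp_0)
  moreover have "(\<Sum>i\<le>degree p. coeff p i * (y ^ i / exp y)) = poly p y * exp (- y)" for y
    by (simp add: poly_altdef exp_minus sum_distrib_right divide_inverse mult.assoc)
  ultimately show ?thesis by simp
qed

lemma flat_fun_deriv: "(flat_fun p has_real_derivative flat_fun (flat_next p) x) (at x)"
proof (cases x "0::real" rule: linorder_cases)
  case less
  have "(flat_fun p has_real_derivative 0) (at x)"
    by (rule has_field_derivative_transform_within_open[where f="\<lambda>_. 0" and S="{..<0}"])
       (use less in \<open>auto simp: flat_fun_def\<close>)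
  then show ?thesis using less by (simp add: flat_fun_def)
next
  case greater
  have "((\<lambda>x. poly p (1 / x) * exp (- (1 / x))) has_real_derivative flat_fun (flat_next p) x) (at x)"
  proof -
    have "((\<lambda>x. 1 / x) has_real_derivative (- 1 / x^2)) (at x)"
      using greater by (auto intro!: derivative_eq_intros simp: power2_eq_square)
    note d = this
    have "((\<lambda>x. poly p (1 / x)) has_real_derivative poly (pderiv p) (1 / x) * (- 1 / x^2)) (at x)"
      by (rule DERIV_chain2[OF poly_DERIV d])
    moreover have "((\<lambda>x. exp (- (1 / x))) has_real_derivative exp (- (1 / x)) * (- (- 1 / x^2))) (at x)"
      by (rule DERIV_chain2[OF DERIV_exp DERIV_minus[OF d]])
    ultimately have "((\<lambda>x. poly p (1 / x) * exp (- (1 / x))) has_real_derivative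
       poly (pderiv p) (1 / x) * (- 1 / x^2) * exp (- (1 / x)) + exp (- (1 / x)) * (- (- 1 / x^2)) * poly p (1 / x)) (at x)"
      by (rule DERIV_mult)
    moreover have "poly (pderiv p) (1 / x) * (- 1 / x^2) * exp (- (1 / x)) + exp (- (1 / x)) * (- (- 1 / x^2)) * poly p (1 / x) = flat_fun (flat_next p) x"
      using greater by (simp add: flat_fun_def flat_next_def field_simps power2_eq_square)
    ultimately show ?thesis by simp
  qed
  then show ?thesis
    by (rule has_field_derivative_transform_within_open[where S="{0<..}"])
       (use greater in \<open>auto simp: flat_fun_def\<close>)
next
  case equal
  have l: "((\<lambda>h. flat_fun p h / h) \<longlongrightarrow> 0) (at_left 0)"
    by (rule tendsto_eventually) (auto simp: eventually_at_filter flat_fun_def)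
  \<comment> \<open>The difference quotient at 0 is of the same form as the function, with y p(y) in
    place of p(y).\<close>
  have "((\<lambda>h. poly (pCons 0 p) (inverse h) * exp (- inverse h)) \<longlongrightarrow> 0) (at_right 0)"
    by (rule filterlim_compose[OF poly_exp_decay filterlim_inverse_at_top_right])
  then have r: "((\<lambda>h. flat_fun p h / h) \<longlongrightarrow> 0) (at_right 0)"
    by (rule Lim_transform_eventually) (auto simp: eventually_at_filter flat_fun_def divide_inverse)
  have "((\<lambda>h. flat_fun p h / h) \<longlongrightarrow> 0) (at 0)" using l r by (simp add: filterlim_split_at)
  then show ?thesis using equal by (simp add: DERIV_def flat_fun_def)
qed

text \<open>Sums over lists of polynomials make the family closed under differentiation, which gives smoothness by iteration.\<close>
definition bump_fun :: "(real poly \<times> real poly) list \<Rightarrow> real \<Rightarrow> real" where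
  "bump_fun L x = (\<Sum>(p, r)\<leftarrow>L. flat_fun p x * flat_fun r (1 - x))"

text \<open>Product rule on each pair; the sign is the inner derivative of 1 - x.\<close>

definition bump_next :: "(real poly \<times> real poly) list \<Rightarrow> (real poly \<times> real poly) list" where
  "bump_next L = concat (map (\<lambda>(p, r). [(flat_next p, r), (p, - flat_next r)]) L)"

lemma bump_fun_deriv: "(bump_fun L has_real_derivative bump_fun (bump_next L) x) (at x)"
proof (induction L)
  case Nil
  then show ?case by (simp add: bump_fun_def[abs_def] bump_next_def)
next
  case (Cons a L)
  obtain p r where a: "a = (p, r)" by force
  have "((\<lambda>x. flat_fun r (1 - x)) has_real_derivative flat_fun (flat_next r) (1 - x) * (0 - 1)) (at x)"
    by (rule DERIV_chain2[OF flat_fun_deriv]) (intro DERIV_diff DERIV_const DERIV_ident)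
  note d = DERIV_add[OF DERIV_mult[OF flat_fun_deriv[of p x] this] Cons]
  have e1: "(\<lambda>x. flat_fun p x * flat_fun r (1 - x) + bump_fun L x) = bump_fun (a # L)" by (simp add: fun_eq_iff bump_fun_def a)
  have e2: "flat_fun (flat_next p) x * flat_fun r (1 - x) + flat_fun (flat_next r) (1 - x) * (0 - 1) * flat_fun p x + bump_fun (bump_next L) x = bump_fun (bump_next (a # L)) x"
    by (simp add: bump_fun_def bump_next_def a flat_fun_def)
  show ?case using d unfolding e1 e2 .
qed

text \<open>Normalized primitive of a bump supported in [0, 1]. Rescaled steps give the test
  functions that approximate the indicator of an interval, and their derivatives are approximations
  of the identity.\<close>

lemma smooth_step_exists:
  "\<exists>(\<theta> :: real \<Rightarrow> real) (\<eta> :: nat \<Rightarrow> real \<Rightarrow> real).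
    (\<forall>x. (\<theta> has_real_derivative \<eta> 0 x) (at x)) \<and>
    (\<forall>m x. (\<eta> m has_real_derivative \<eta> (Suc m) x) (at x)) \<and>
    (\<forall>x\<le>0. \<theta> x = 0) \<and> (\<forall>x\<ge>1. \<theta> x = 1) \<and> (\<forall>x. 0 \<le> \<theta> x \<and> \<theta> x \<le> 1) \<and>
    (\<forall>x. x \<notin> {0..1} \<longrightarrow> \<eta> 0 x = 0) \<and> (\<forall>x. 0 \<le> \<eta> 0 x)"
proof -
  define \<rho> where "\<rho> = (\<lambda>m. bump_fun ((bump_next ^^ m) [(1, 1)]))"
  have \<rho>d: "(\<rho> m has_real_derivative \<rho> (Suc m) x) (at x)" for m x
    unfolding \<rho>_def by (simp add: bump_fun_deriv)
  have \<rho>0: "\<rho> 0 x = flat_fun 1 x * flat_fun 1 (1 - x)" for x by (simp add: \<rho>_def bump_fun_def)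
  have nn: "0 \<le> \<rho> 0 x" and pos: "0 < x \<Longrightarrow> x < 1 \<Longrightarrow> 0 < \<rho> 0 x" and z: "x \<le> 0 \<or> 1 \<le> x \<Longrightarrow> \<rho> 0 x = 0" for x
    by (auto simp: \<rho>0 flat_fun_def)
  have cont: "continuous_on S (\<rho> 0)" for S
    using \<rho>d[of 0] by (meson DERIV_isCont continuous_at_imp_continuous_on)
  \<comment> \<open>The integral starts to the left of the support, so that 0 is an interior point
    and the derivative there is two-sided.\<close>
  define \<Phi> where "\<Phi> = (\<lambda>x. integral {-1..x} (\<rho> 0))"
  have \<Phi>0: "\<Phi> x = 0" if "x \<le> 0" for x
  proof -
    have "integral {-1..x} (\<rho> 0) = integral {-1..x} (\<lambda>_. 0)"
      by (rule Henstock_Kurzweil_Integration.integral_cong) (use z that in auto)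
    then show ?thesis by (simp add: \<Phi>_def)
  qed
  have \<Phi>d: "(\<Phi> has_real_derivative \<rho> 0 x) (at x)" for x
  proof (cases "x < 0")
    case True
    have "(\<Phi> has_real_derivative 0) (at x)"
      by (rule has_field_derivative_transform_within_open[where f="\<lambda>_. 0" and S="{..<0}"])
        (use True \<Phi>0 in auto)
    then show ?thesis using z[of x] True by simp
  next
    case False
    have "((\<lambda>x. integral {-1..x} (\<rho> 0)) has_real_derivative \<rho> 0 x) (at x within {-1..x + 1})"
      by (rule integral_has_real_derivative[OF cont]) (use False in auto)
    moreover have "at x within {-1..x + 1} = at x" by (rule at_within_Icc_at) (use False in auto)
    ultimately show ?thesis by (simp add: \<Phi>_def)
  qed
  have mono: "\<Phi> x \<le> \<Phi> y" if "x \<le> y" for x y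
    by (rule DERIV_nonneg_imp_nondecreasing[where f=\<Phi>, OF that]) (use \<Phi>d nn in blast)
  have \<Phi>1: "\<Phi> x = \<Phi> 1" if "1 \<le> x" for x
  proof (rule antisym)
    show "\<Phi> x \<le> \<Phi> 1"
    proof (rule DERIV_nonpos_imp_nonincreasing[where f=\<Phi>, OF that])
      fix y assume "1 \<le> y" "y \<le> x"
      then show "\<exists>d. DERIV \<Phi> y :> d \<and> d \<le> 0" using \<Phi>d[of y] z[of y] by (intro exI[of _ 0]) auto
    qed
  qed (rule mono[OF that])
  \<comment> \<open>Strict growth on a part of the support makes the normalizing constant
    positive.\<close>
  have "\<Phi> (1/4) < \<Phi> (3/4)"
  proof (rule DERIV_pos_imp_increasing[where f=\<Phi>])
    fix y :: real assume "1/4 \<le> y" "y \<le> 3/4"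
    then show "\<exists>d. DERIV \<Phi> y :> d \<and> 0 < d" using \<Phi>d[of y] pos[of y] by (intro exI[of _ "\<rho> 0 y"]) auto
  qed simp
  then have c0: "\<Phi> 1 > 0" using mono[of "3/4" 1] mono[of 0 "1/4"] \<Phi>0[of 0] by simp
  have b: "0 \<le> \<Phi> x \<and> \<Phi> x \<le> \<Phi> 1" for x
  proof
    show "0 \<le> \<Phi> x" using \<Phi>0[of x] \<Phi>0[of 0] mono[of 0 x] by (cases "x \<le> 0") simp_all
    show "\<Phi> x \<le> \<Phi> 1" using \<Phi>1[of x] mono[of x 1] by (cases "1 \<le> x") simp_all
  qed
  show ?thesis
  proof (intro exI[of _ "\<lambda>x. \<Phi> x / \<Phi> 1"] exI[of _ "\<lambda>m x. \<rho> m x / \<Phi> 1"] conjI allI impI)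
    fix x
    show "0 \<le> \<Phi> x / \<Phi> 1" "\<Phi> x / \<Phi> 1 \<le> 1" "0 \<le> \<rho> 0 x / \<Phi> 1" using b[of x] c0 nn[of x] by auto
    show "((\<lambda>x. \<Phi> x / \<Phi> 1) has_real_derivative \<rho> 0 x / \<Phi> 1) (at x)" by (intro DERIV_cdivide \<Phi>d)
    show "((\<lambda>x. \<rho> m x / \<Phi> 1) has_real_derivative \<rho> (Suc m) x / \<Phi> 1) (at x)" for m by (intro DERIV_cdivide \<rho>d)
    show "x \<le> 0 \<Longrightarrow> \<Phi> x / \<Phi> 1 = 0" by (simp add: \<Phi>0)
    show "1 \<le> x \<Longrightarrow> \<Phi> x / \<Phi> 1 = 1" using \<Phi>1[of x] c0 by simp
    show "x \<notin> {0..1} \<Longrightarrow> \<rho> 0 x / \<Phi> 1 = 0" using z[of x] by auto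
  qed
qed

section \<open>Weak derivatives and increments of the continuous representative\<close>

lemma integrable_L2_truncated:
  assumes g: "L2 (lebesgue_on {0<..}) g"
  shows "integrable (lebesgue_on {0<..}) (\<lambda>x::real. norm (g x) * indicator {..b} x)"
proof (rule Bochner_Integration.integrable_bound)
  have gm[measurable]: "g \<in> borel_measurable (lebesgue_on {0<..})" using g by (simp add: L2_def)
  have [measurable]: "(\<lambda>x. indicator {..b} x :: real) \<in> borel_measurable (lebesgue_on {0<..})"
    by (rule borel_imp_lebesgue_on) simp
  show "integrable (lebesgue_on {0<..}) (\<lambda>x. (cmod (g x))^2 + 1 * indicator {..b} x)"
    by (intro Bochner_Integration.integrable_add L2_integrable[OF g] integrable_indicator_Ioc)
  show "(\<lambda>x. norm (g x) * indicator {..b} x) \<in> borel_measurable (lebesgue_on {0<..})" by measurable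
  show "AE x in lebesgue_on {0<..}. norm (norm (g x) * indicat_real {..b} x) \<le> norm ((cmod (g x))^2 + 1 * indicator {..b} x)"
  proof (rule AE_I2)
    fix x :: real
    have "cmod (g x) \<le> (cmod (g x))^2 + 1"
      using sum_squares_bound[of "cmod (g x)" 1] by (simp add: power2_eq_square) (smt (verit) zero_le_mult_iff norm_ge_zero)
    then show "norm (norm (g x) * indicat_real {..b} x) \<le> norm ((cmod (g x))^2 + 1 * indicator {..b} x)"
      by (cases "x \<le> b") (auto simp: indicator_def)
  qed
qed

text \<open>The weak derivative is tested with a smooth version of the indicator of (s, t]. The
  derivatives of its two ramps concentrate at s and at t and evaluate v there, while the other side
  tends to the integral of g.\<close>

lemma weak_deriv_increment:
  assumes f: "L2 (lebesgue_on {0<..}) f" and g: "L2 (lebesgue_on {0<..}) g" and wd: "weak_deriv f g"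
    and v: "continuous_on {0..} v" and vf: "AE x in lebesgue_on {0<..}. v x = f x" and st: "0 < s" "s < t"
  shows "v t - v s = (LINT x|lebesgue_on {0<..}. indicator {s<..t} x *\<^sub>R g x)"
proof -
  obtain \<theta> :: "real \<Rightarrow> real" and \<eta> :: "nat \<Rightarrow> real \<Rightarrow> real" where
    \<theta>d: "\<And>x. (\<theta> has_real_derivative \<eta> 0 x) (at x)"
    and \<eta>d: "\<And>m x. (\<eta> m has_real_derivative \<eta> (Suc m) x) (at x)"
    and \<theta>0: "\<And>x. x \<le> 0 \<Longrightarrow> \<theta> x = 0" and \<theta>1: "\<And>x. 1 \<le> x \<Longrightarrow> \<theta> x = 1" and \<theta>b: "\<And>x. 0 \<le> \<theta> x \<and> \<theta> x \<le> 1"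
    and \<eta>0: "\<And>x. x \<notin> {0..1} \<Longrightarrow> \<eta> 0 x = 0" and \<eta>nn: "\<And>x. 0 \<le> \<eta> 0 x"
    using smooth_step_exists by blast
  have gm[measurable]: "g \<in> borel_measurable (lebesgue_on {0<..})" using g by (simp add: L2_def)
  have \<eta>c: "continuous_on UNIV (\<eta> 0)"
    using \<eta>d[of 0] by (meson DERIV_isCont continuous_at_imp_continuous_on)
  then have [measurable]: "\<eta> 0 \<in> borel_measurable borel" by (rule borel_measurable_continuous_onI)
  have \<theta>c: "continuous_on UNIV \<theta>"
    using \<theta>d by (meson DERIV_isCont continuous_at_imp_continuous_on)
  define e where "e = (\<lambda>m::nat. inverse (real (Suc m)))"
  have e: "0 < e m" "e m \<le> 1" for m by (auto simp: e_def inverse_le_1_iff)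
  have elim: "e \<longlonglongrightarrow> 0" unfolding e_def by (rule LIMSEQ_inverse_real_of_nat)
  \<comment> \<open>Ramps of width \<open>e m\<close>, one rising from s and one falling from t; as
    \<open>e m\<close> is at most 1, the support lies in [s, t + 1].\<close>
  define \<phi> where "\<phi> = (\<lambda>m x. \<theta> ((x - s) / e m) - \<theta> ((x - t) / e m))"
  define \<phi>' where "\<phi>' = (\<lambda>m x. \<eta> 0 ((x - s) / e m) / e m - \<eta> 0 ((x - t) / e m) / e m)"
  have resc: "((\<lambda>x. h ((x - r) / e m)) has_real_derivative h' ((x - r) / e m) / e m) (at x)"
    if "\<And>x. (h has_real_derivative h' x) (at x)" for h h' r m x
  proof -
    have "((\<lambda>x. (x - r) / e m) has_real_derivative (1 - 0) / e m) (at x)"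
      by (intro DERIV_cdivide DERIV_diff DERIV_ident DERIV_const)
    from DERIV_chain2[OF that this] show ?thesis by simp
  qed
  have \<phi>d: "(\<phi> m has_real_derivative \<phi>' m x) (at x)" for m x
    unfolding \<phi>_def \<phi>'_def by (intro DERIV_diff resc \<theta>d)
  have test: "test_fun (\<lambda>x. complex_of_real (\<phi> m x))" for m
    unfolding test_fun_def
  proof
    define E where "E = (\<lambda>k x. (\<eta> k ((x - s) / e m) - \<eta> k ((x - t) / e m)) / e m ^ Suc k)"
    have Ed: "(E k has_real_derivative E (Suc k) x) (at x)" for k x
    proof -
      have "(E k has_real_derivative (\<eta> (Suc k) ((x - s) / e m) / e m - \<eta> (Suc k) ((x - t) / e m) / e m) / e m ^ Suc k) (at x)"
        unfolding E_def by (intro DERIV_cdivide DERIV_diff resc \<eta>d)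
      moreover have "(\<eta> (Suc k) ((x - s) / e m) / e m - \<eta> (Suc k) ((x - t) / e m) / e m) / e m ^ Suc k = E (Suc k) x"
        by (simp add: E_def diff_divide_distrib mult.commute)
      ultimately show ?thesis by simp
    qed
    have E0: "E 0 x = \<phi>' m x" for x by (simp add: E_def \<phi>'_def diff_divide_distrib)
    \<comment> \<open>The sequence of derivatives starts with \<phi> itself, followed by the
      rescaled derivatives of the bump, whose index is therefore shifted by one.\<close>
    define D where "D = (\<lambda>k x. complex_of_real (case k of 0 \<Rightarrow> \<phi> m x | Suc k \<Rightarrow> E k x))"
    have "(D k has_vector_derivative D (Suc k) x) (at x)" for k x
    proof (cases k)
      case 0
      then show ?thesis using has_vector_derivative_of_real[OF \<phi>d[of m x]] by (simp add: D_def E0)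
    next
      case (Suc k')
      then show ?thesis using has_vector_derivative_of_real[OF Ed[of k' x]] by (simp add: D_def)
    qed
    then show "\<exists>D. D 0 = (\<lambda>x. complex_of_real (\<phi> m x)) \<and> (\<forall>k x. (D k has_vector_derivative D (Suc k) x) (at x))"
      by (intro exI[of _ D]) (simp add: D_def)
    show "\<exists>s' t'. 0 < s' \<and> s' \<le> t' \<and> (\<forall>x. x \<notin> {s'..t'} \<longrightarrow> complex_of_real (\<phi> m x) = 0)"
    proof (rule exI[of _ s], rule exI[of _ "t + 1"], intro conjI allI impI)
      fix x assume "x \<notin> {s..t+1}"
      then consider "x < s" | "t + 1 < x" by force
      then show "complex_of_real (\<phi> m x) = 0"
      proof cases
        case 1
        then have "(x - s) / e m \<le> 0" "(x - t) / e m \<le> 0" using st e[of m] by (auto simp: divide_le_0_iff)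
        then show ?thesis by (simp add: \<phi>_def \<theta>0)
      next
        case 2
        then have "1 \<le> (x - s) / e m" "1 \<le> (x - t) / e m" using st e[of m] by (auto simp: le_divide_eq)
        then show ?thesis by (simp add: \<phi>_def \<theta>1)
      qed
    qed (use st in auto)
  qed
  have vd: "vector_derivative (\<lambda>x. complex_of_real (\<phi> m x)) (at x) = of_real (\<phi>' m x)" for m x
    by (rule vector_derivative_at) (rule has_vector_derivative_of_real[OF \<phi>d])
  have eq: "(LINT x|lebesgue_on {0<..}. v x * of_real (\<phi>' m x)) = - (LINT x|lebesgue_on {0<..}. g x * of_real (\<phi> m x))" for m
  proof -
    have "(LINT x|lebesgue_on {0<..}. f x * of_real (\<phi>' m x)) = - (LINT x|lebesgue_on {0<..}. g x * of_real (\<phi> m x))"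
      using wd[unfolded weak_deriv_def, rule_format, OF test[of m]] unfolding vd .
    moreover have "(LINT x|lebesgue_on {0<..}. v x * of_real (\<phi>' m x)) = (LINT x|lebesgue_on {0<..}. f x * of_real (\<phi>' m x))"
    proof (rule integral_cong_AE)
      have \<phi>'m: "(\<lambda>x. complex_of_real (\<phi>' m x)) \<in> borel_measurable (lebesgue_on {0<..})"
        unfolding \<phi>'_def by (rule borel_imp_lebesgue_on) measurable
      have "continuous_on {0<..} v" using v by (rule continuous_on_subset) auto
      then have vm: "v \<in> borel_measurable (lebesgue_on {0<..})"
        by (rule continuous_imp_measurable_on_sets_lebesgue) simp
      show "(\<lambda>x. v x * of_real (\<phi>' m x)) \<in> borel_measurable (lebesgue_on {0<..})"
        by (intro borel_measurable_times vm \<phi>'m)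
      show "(\<lambda>x. f x * of_real (\<phi>' m x)) \<in> borel_measurable (lebesgue_on {0<..})"
        using f by (intro borel_measurable_times \<phi>'m) (simp add: L2_def)
      show "AE x in lebesgue_on {0<..}. v x * of_real (\<phi>' m x) = f x * of_real (\<phi>' m x)"
        using vf by eventually_elim simp
    qed
    ultimately show ?thesis by simp
  qed
  have pt: "(\<lambda>m. LINT x|lebesgue_on {0<..}. v x * of_real (\<eta> 0 ((x - r) / e m) / e m)) \<longlonglongrightarrow> v r
     \<and> (\<forall>m. integrable (lebesgue_on {0<..}) (\<lambda>x. v x * of_real (\<eta> 0 ((x - r) / e m) / e m)))" if r: "0 < r" for r
  proof -
    \<comment> \<open>Continuation of v by a constant to the left of 0, which makes it continuous on
      the line; the kernel vanishes there.\<close>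
    define u where "u = (\<lambda>x. v (max 0 x))"
    have uc: "continuous_on UNIV u" unfolding u_def
      by (rule continuous_on_compose2[OF v]) (auto intro!: continuous_on_max continuous_intros)
    then have [measurable]: "u \<in> borel_measurable borel" by (rule borel_measurable_continuous_onI)
    define K where "K = (\<lambda>m x. u x * of_real (\<eta> 0 ((x - r) / e m) / e m))"
    have Km: "K m \<in> borel_measurable borel" for m unfolding K_def by measurable
    have Kind: "indicator {0<..} x *\<^sub>R K m x = K m x" for m x
    proof (cases "0 < x")
      case False
      then have "(x - r) / e m < 0" using r e[of m] by (simp add: divide_less_0_iff)
      then show ?thesis using False by (simp add: K_def \<eta>0)
    qed simp
    have vK: "v x * of_real (\<eta> 0 ((x - r) / e m) / e m) = K m x" if "x \<in> space (lebesgue_on {0<..})" for m x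
      using that by (simp add: K_def u_def max_def)
    have "compact (u ` {r..r+1})" by (rule compact_continuous_image) (auto intro: continuous_on_subset[OF uc])
    from compact_imp_bounded[OF this] obtain B where "\<forall>y\<in>u ` {r..r+1}. norm y \<le> B"
      unfolding bounded_iff by blast
    then have B: "norm (u x) \<le> B" if "x \<in> {r..r+1}" for x using that by blast
    have \<eta>int: "has_bochner_integral lborel (\<eta> 0) 1"
    proof -
      have "has_bochner_integral lborel (\<lambda>x. \<eta> 0 x * indicator {0..1} x) (\<theta> 1 - \<theta> 0)"
        by (rule has_bochner_integral_FTC_Icc_nonneg) (use \<theta>d \<eta>nn in auto)
      moreover have "\<eta> 0 x * indicator {0..1} x = \<eta> 0 x" for x using \<eta>0[of x] by (cases "x \<in> {0..1}") auto
      ultimately show ?thesis by (simp add: \<theta>0 \<theta>1)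
    qed
    \<comment> \<open>The substitution x = r + e m y moves the concentration into u and leaves the
      fixed density \<open>\<eta> 0\<close>.\<close>
    define w where "w = (\<lambda>m y. u (r + e m * y) * of_real (\<eta> 0 y))"
    have wm: "w m \<in> borel_measurable lborel" for m unfolding w_def by measurable
    have dom: "integrable lborel (\<lambda>y. B * \<eta> 0 y)" using \<eta>int by (simp add: has_bochner_integral_iff)
    have wb: "norm (w m y) \<le> B * \<eta> 0 y" for m y
    proof (cases "y \<in> {0..1}")
      case True
      then have "e m * y \<le> 1" "0 \<le> e m * y" using e[of m] by (auto intro: mult_le_one)
      then have "norm (u (r + e m * y)) \<le> B" by (intro B) auto
      then show ?thesis using \<eta>nn[of y] by (simp add: w_def norm_mult mult_right_mono)
    qed (simp add: w_def \<eta>0)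
    have wi: "integrable lborel (w m)" for m
      by (rule Bochner_Integration.integrable_bound[OF dom wm]) (use wb in \<open>auto intro!: AE_I2 intro: order_trans[OF _ abs_ge_self]\<close>)
    have Kw: "K m (r + e m * y) = of_real (inverse (e m)) * w m y" for m y
      using e[of m] by (simp add: K_def w_def divide_inverse mult_ac)
    have Ki: "integrable lborel (K m)" for m
      using lborel_integrable_real_affine_iff[of "e m" "K m" r] e[of m] wi[of m] by (simp add: Kw)
    have KI: "(LINT x|lborel. K m x) = (LINT y|lborel. w m y)" for m
      using lborel_integral_real_affine[of "e m" "K m" r] e[of m] by (simp add: Kw scaleR_conv_of_real)
    have "(\<lambda>m. LINT y|lborel. w m y) \<longlonglongrightarrow> (LINT y|lborel. u r * of_real (\<eta> 0 y))"
    proof (rule integral_dominated_convergence[OF _ wm dom])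
      show "(\<lambda>y. u r * of_real (\<eta> 0 y)) \<in> borel_measurable lborel" by measurable
      show "AE y in lborel. norm (w m y) \<le> B * \<eta> 0 y" for m using wb by auto
      have "(\<lambda>m. w m y) \<longlonglongrightarrow> u r * of_real (\<eta> 0 y)" for y
      proof -
        have l: "(\<lambda>m. r + e m * y) \<longlonglongrightarrow> r + 0 * y" by (intro tendsto_add tendsto_mult tendsto_const elim)
        have "isCont u (r + 0 * y)" using uc by (simp add: continuous_on_eq_continuous_at)
        from isCont_tendsto_compose[OF this l] have "(\<lambda>m. u (r + e m * y)) \<longlonglongrightarrow> u r" by simp
        then show ?thesis unfolding w_def by (intro tendsto_mult tendsto_const)
      qed
      then show "AE y in lborel. (\<lambda>m. w m y) \<longlonglongrightarrow> u r * of_real (\<eta> 0 y)" by auto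
    qed
    also have "(LINT y|lborel. u r * of_real (\<eta> 0 y)) = v r"
      using \<eta>int r by (simp add: has_bochner_integral_iff u_def max_def)
    finally have "(\<lambda>m. LINT x|lborel. K m x) \<longlonglongrightarrow> v r" by (simp add: KI)
    moreover have "(LINT x|lebesgue_on {0<..}. v x * of_real (\<eta> 0 ((x - r) / e m) / e m)) = (LINT x|lborel. K m x)" for m
    proof -
      have "(LINT x|lebesgue_on {0<..}. v x * of_real (\<eta> 0 ((x - r) / e m) / e m)) = (LINT x|lebesgue_on {0<..}. K m x)"
        by (rule Bochner_Integration.integral_cong[OF refl vK])
      also have "\<dots> = (LINT x|lborel. K m x)"
        using integral_lebesgue_on_borel(2)[of "{0<..}" "K m"] Km by (simp add: Kind)
      finally show ?thesis .
    qed
    moreover have "integrable (lebesgue_on {0<..}) (\<lambda>x. v x * of_real (\<eta> 0 ((x - r) / e m) / e m))" for m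
    proof -
      have "integrable (lebesgue_on {0<..}) (K m)"
        using integral_lebesgue_on_borel(1)[of "{0<..}" "K m"] Km Ki by (simp add: Kind)
      then show ?thesis by (subst Bochner_Integration.integrable_cong[OF refl vK])
    qed
    ultimately show ?thesis by simp
  qed
  have "(\<lambda>m. LINT x|lebesgue_on {0<..}. v x * of_real (\<phi>' m x)) \<longlonglongrightarrow> v s - v t"
  proof -
    have "(LINT x|lebesgue_on {0<..}. v x * of_real (\<phi>' m x)) = (LINT x|lebesgue_on {0<..}. v x * of_real (\<eta> 0 ((x - s) / e m) / e m)) - (LINT x|lebesgue_on {0<..}. v x * of_real (\<eta> 0 ((x - t) / e m) / e m))" for m
      unfolding \<phi>'_def of_real_diff right_diff_distrib
      using pt[of s] pt[of t] st by (intro Bochner_Integration.integral_diff) auto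
    then show ?thesis using tendsto_diff[OF conjunct1[OF pt[of s]] conjunct1[OF pt[of t]]] st by simp
  qed
  moreover have "(\<lambda>m. LINT x|lebesgue_on {0<..}. g x * of_real (\<phi> m x)) \<longlonglongrightarrow> (LINT x|lebesgue_on {0<..}. indicator {s<..t} x *\<^sub>R g x)"
  proof (rule integral_dominated_convergence[where w="\<lambda>x. norm (g x) * indicator {..t+1} x"])
    show "integrable (lebesgue_on {0<..}) (\<lambda>x. norm (g x) * indicator {..t+1} x)"
      by (rule integrable_L2_truncated[OF g])
    show "(\<lambda>x. indicat_real {s<..t} x *\<^sub>R g x) \<in> borel_measurable (lebesgue_on {0<..})"
      by (intro borel_measurable_scaleR gm borel_imp_lebesgue_on) simp
    have "\<phi> m \<in> borel_measurable borel" for m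
      unfolding \<phi>_def by (intro borel_measurable_continuous_onI continuous_intros continuous_on_compose2[OF \<theta>c]) (use e[of m] in auto)
    then show "(\<lambda>x. g x * of_real (\<phi> m x)) \<in> borel_measurable (lebesgue_on {0<..})" for m
      by (intro borel_measurable_times gm borel_imp_lebesgue_on) simp
    have th: "(\<lambda>m. \<theta> ((x - r) / e m)) \<longlonglongrightarrow> (if r < x then 1 else 0)" for x r
    proof (cases "r < x")
      case True
      have "\<forall>\<^sub>F m in sequentially. e m < x - r" using order_tendstoD(2)[OF elim, of "x - r"] True by simp
      then have "\<forall>\<^sub>F m in sequentially. \<theta> ((x - r) / e m) = 1"
      proof eventually_elim
        case (elim m)
        then have "1 \<le> (x - r) / e m" using e[of m] by (simp add: le_divide_eq)
        then show ?case by (rule \<theta>1)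
      qed
      then show ?thesis using True by (simp add: tendsto_eventually)
    next
      case False
      then have "\<theta> ((x - r) / e m) = 0" for m using e[of m] by (intro \<theta>0) (simp add: divide_le_0_iff)
      then show ?thesis using False by simp
    qed
    show "AE x in lebesgue_on {0<..}. (\<lambda>m. g x * of_real (\<phi> m x)) \<longlonglongrightarrow> indicat_real {s<..t} x *\<^sub>R g x"
    proof (rule AE_I2)
      fix x :: real
      have "(\<lambda>m. g x * of_real (\<phi> m x)) \<longlonglongrightarrow> g x * of_real ((if s < x then 1 else 0) - (if t < x then 1 else 0))"
        unfolding \<phi>_def by (intro tendsto_intros th)
      also have "g x * of_real ((if s < x then 1 else 0) - (if t < x then 1 else 0)) = indicat_real {s<..t} x *\<^sub>R g x"
        using st by (auto simp: indicator_def)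
      finally show "(\<lambda>m. g x * of_real (\<phi> m x)) \<longlonglongrightarrow> indicat_real {s<..t} x *\<^sub>R g x" .
    qed
    show "AE x in lebesgue_on {0<..}. norm (g x * of_real (\<phi> m x)) \<le> norm (g x) * indicator {..t+1} x" for m
    proof (rule AE_I2)
      fix x :: real
      have b1: "\<bar>\<phi> m x\<bar> \<le> 1" using \<theta>b[of "(x - s) / e m"] \<theta>b[of "(x - t) / e m"] by (auto simp: \<phi>_def)
      have "\<phi> m x = 0" if "\<not> x \<le> t + 1"
      proof -
        have "1 \<le> (x - s) / e m" "1 \<le> (x - t) / e m" using that st e[of m] by (auto simp: le_divide_eq)
        then show ?thesis by (simp add: \<phi>_def \<theta>1)
      qed
      then have "\<bar>\<phi> m x\<bar> \<le> indicator {..t+1} x" using b1 by (cases "x \<le> t + 1") auto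
      then show "norm (g x * of_real (\<phi> m x)) \<le> norm (g x) * indicator {..t+1} x"
        by (simp add: norm_mult mult_left_mono)
    qed
  qed
  ultimately have "v s - v t = - (LINT x|lebesgue_on {0<..}. indicator {s<..t} x *\<^sub>R g x)"
    using LIMSEQ_unique tendsto_minus unfolding eq by blast
  then show ?thesis by (simp add: algebra_simps)
qed

section \<open>Primitives, integration by parts and Laplace transforms\<close>

lemma sigma_finite_lebesgue: "sigma_finite_measure (lebesgue :: 'a::euclidean_space measure)"
proof
  obtain A :: "'a set set" where A: "countable A" "A \<subseteq> sets lborel" "\<Union>A = space lborel" "\<forall>a\<in>A. emeasure lborel a \<noteq> \<infinity>"
    using lborel.sigma_finite_countable by blast
  show "\<exists>A::'a set set. countable A \<and> A \<subseteq> sets lebesgue \<and> \<Union>A = space lebesgue \<and> (\<forall>a\<in>A. emeasure lebesgue a \<noteq> \<infinity>)"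
    by (rule exI[of _ A]) (use A in \<open>auto simp: emeasure_completion\<close>)
qed

abbreviation (input) HL :: "real measure" where "HL \<equiv> lebesgue_on {0<..}"

interpretation HL: sigma_finite_measure "lebesgue_on {0::real<..}"
  by (rule sigma_finite_measure_restrict_space[OF sigma_finite_lebesgue]) simp

interpretation HLP: pair_sigma_finite "lebesgue_on {0::real<..}" "lebesgue_on {0::real<..}" ..

lemma HL_ident: "(\<lambda>x. x) \<in> borel_measurable HL"
  by (rule borel_imp_lebesgue_on) simp

lemma AE_HL_neq: "AE x in HL. x \<noteq> b"
proof -
  have "AE x in lebesgue. x \<notin> {b}"
    by (rule AE_not_in) (simp add: negligible_iff_null_sets[symmetric])
  then show ?thesis by (subst AE_restrict_space_iff) auto
qed

lemma HL_measurable_continuous: "continuous_on {0..} (f :: real \<Rightarrow> complex) \<Longrightarrow> f \<in> borel_measurable HL"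
  by (rule continuous_imp_measurable_on_sets_lebesgue[OF continuous_on_subset]) auto

text \<open>The integral of g over (0, t), and 0 for t <= 0. The strict inequality is that of the
  kernel y < x in the Fubini argument.\<close>

definition primitive :: "(real \<Rightarrow> complex) \<Rightarrow> real \<Rightarrow> complex" where
  "primitive g t = (LINT x|HL. indicator {..<t} x *\<^sub>R g x)"

text \<open>Primitives of square-integrable functions may grow, so square integrability is not
  stable under integration. Integrability against exp (-\<kappa> x) is stable up to an increase of
  \<kappa>, and it is what a Laplace transform at \<kappa> asks for.\<close>

definition exp_weighted :: "real \<Rightarrow> (real \<Rightarrow> complex) \<Rightarrow> bool" where
  "exp_weighted \<kappa> g \<longleftrightarrow> g \<in> borel_measurable HL \<and> integrable HL (\<lambda>x. norm (g x) * exp (- \<kappa> * x))"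

lemma exp_integrable: "0 < \<kappa> \<Longrightarrow> integrable HL (\<lambda>x. exp (- \<kappa> * x))"
  using exp_decay_integral_real by (simp add: has_bochner_integral_iff)

lemma exp_HL_measurable [measurable]: "(\<lambda>x. exp (- \<kappa> * x)) \<in> borel_measurable HL"
  by (rule borel_imp_lebesgue_on) simp

lemma exp_weighted_L2: assumes "L2 HL g" "0 < \<kappa>" shows "exp_weighted \<kappa> g"
proof -
  have "integrable HL (\<lambda>x. norm (g x * cnj (edge_exp \<kappa> 1 1 x)))"
    by (intro integrable_norm L2_integrable_mult assms edge_exp_L2)
  then show ?thesis using assms by (simp add: exp_weighted_def L2_def edge_exp_def norm_mult)
qed

lemma exp_weighted_bounded:
  assumes "g \<in> borel_measurable HL" "\<And>x. 0 < x \<Longrightarrow> norm (g x) \<le> C * exp (\<mu> * x)" "\<mu> < \<kappa>"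
  shows "exp_weighted \<kappa> g"
  unfolding exp_weighted_def
proof
  have "integrable HL (\<lambda>x. C * exp (- (\<kappa> - \<mu>) * x))" using assms(3) by (intro integrable_mult_right exp_integrable) simp
  then show "integrable HL (\<lambda>x. norm (g x) * exp (- \<kappa> * x))"
  proof (rule Bochner_Integration.integrable_bound)
    show "(\<lambda>x. norm (g x) * exp (- \<kappa> * x)) \<in> borel_measurable HL" using assms(1) by measurable
    show "AE x in HL. norm (norm (g x) * exp (- \<kappa> * x)) \<le> norm (C * exp (- (\<kappa> - \<mu>) * x))"
    proof (rule AE_I2)
      fix x assume "x \<in> space HL"
      then have "norm (g x) * exp (- \<kappa> * x) \<le> C * exp (\<mu> * x) * exp (- \<kappa> * x)" using assms(2)[of x] by (intro mult_right_mono) auto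
      also have "\<dots> = C * exp (- (\<kappa> - \<mu>) * x)" by (simp add: mult.assoc exp_add[symmetric] algebra_simps)
      finally show "norm (norm (g x) * exp (- \<kappa> * x)) \<le> norm (C * exp (- (\<kappa> - \<mu>) * x))" by simp
    qed
  qed
qed (rule assms)

lemma exp_weighted_indicator_integrable:
  assumes "exp_weighted \<kappa> g" "0 < \<kappa>" shows "integrable HL (\<lambda>x. norm (g x) * indicator {..b} x)"
proof (rule Bochner_Integration.integrable_bound)
  have [measurable]: "g \<in> borel_measurable HL" using assms by (simp add: exp_weighted_def)
  have [measurable]: "(\<lambda>x. indicator {..b} x :: real) \<in> borel_measurable HL"
    by (rule borel_imp_lebesgue_on) simp
  show "integrable HL (\<lambda>x. exp (\<kappa> * b) * (norm (g x) * exp (- \<kappa> * x)))" using assms by (simp add: exp_weighted_def)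
  show "(\<lambda>x. norm (g x) * indicator {..b} x) \<in> borel_measurable HL" by measurable
  show "AE x in HL. norm (norm (g x) * indicat_real {..b} x) \<le> norm (exp (\<kappa> * b) * (norm (g x) * exp (- \<kappa> * x)))"
  proof (rule AE_I2)
    fix x :: real
    have "indicator {..b} x \<le> exp (\<kappa> * b) * exp (- \<kappa> * x)"
      using assms(2) by (cases "x \<le> b") (simp_all add: exp_add[symmetric])
    then have "norm (g x) * indicator {..b} x \<le> norm (g x) * (exp (\<kappa> * b) * exp (- \<kappa> * x))" by (intro mult_left_mono) auto
    then show "norm (norm (g x) * indicat_real {..b} x) \<le> norm (exp (\<kappa> * b) * (norm (g x) * exp (- \<kappa> * x)))"
      by (simp add: mult_ac abs_mult)
  qed
qed

lemma exp_weighted_primitive_integrable: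
  assumes "exp_weighted \<kappa> g" "0 < \<kappa>" shows "integrable HL (\<lambda>x. indicator {..<t} x *\<^sub>R g x)"
proof (rule Bochner_Integration.integrable_bound[OF exp_weighted_indicator_integrable[OF assms, of t]])
  have [measurable]: "g \<in> borel_measurable HL" using assms by (simp add: exp_weighted_def)
  have [measurable]: "(\<lambda>x. indicator {..<t} x :: real) \<in> borel_measurable HL"
    by (rule borel_imp_lebesgue_on) simp
  show "(\<lambda>x. indicator {..<t} x *\<^sub>R g x) \<in> borel_measurable HL" by measurable
qed (auto simp: indicator_def)

lemma primitive_bound:
  assumes "exp_weighted \<kappa> g" "0 < \<kappa>"
  shows "norm (primitive g t) \<le> (LINT x|HL. norm (g x) * exp (- \<kappa> * x)) * exp (\<kappa> * t)"
proof -
  have "norm (primitive g t) \<le> (LINT x|HL. norm (g x) * exp (- \<kappa> * x) * exp (\<kappa> * t))"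
    unfolding primitive_def
  proof (rule Bochner_Integration.integral_norm_bound_integral[OF exp_weighted_primitive_integrable[OF assms]])
    show "integrable HL (\<lambda>x. norm (g x) * exp (- \<kappa> * x) * exp (\<kappa> * t))" using assms by (simp add: exp_weighted_def)
    fix x :: real
    have "indicator {..<t} x \<le> exp (- \<kappa> * x) * exp (\<kappa> * t)"
      using assms(2) by (cases "x < t") (simp_all add: exp_add[symmetric])
    then have "norm (g x) * indicator {..<t} x \<le> norm (g x) * (exp (- \<kappa> * x) * exp (\<kappa> * t))" by (intro mult_left_mono) auto
    then show "norm (indicat_real {..<t} x *\<^sub>R g x) \<le> norm (g x) * exp (- \<kappa> * x) * exp (\<kappa> * t)" by (simp add: mult_ac)
  qed
  then show ?thesis by simp
qed

lemma primitive_0: "primitive g 0 = 0"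
proof -
  have "primitive g 0 = (LINT x|HL. 0)" unfolding primitive_def
    by (rule Bochner_Integration.integral_cong) auto
  then show ?thesis by simp
qed

lemma primitive_continuous:
  assumes "exp_weighted \<kappa> g" "0 < \<kappa>" shows "continuous_on S (primitive g)"
proof (rule continuous_on_subset[of UNIV])
  have gm[measurable]: "g \<in> borel_measurable HL" using assms by (simp add: exp_weighted_def)
  have [measurable]: "(\<lambda>x. indicator {..<t} x :: real) \<in> borel_measurable HL" for t
    by (rule borel_imp_lebesgue_on) simp
  show "continuous_on UNIV (primitive g)"
    unfolding continuous_on_sequentially
  proof clarify
    fix f :: "nat \<Rightarrow> real" and t assume f: "f \<longlonglongrightarrow> t"
    then have "Bseq f" by (rule convergentI[THEN convergent_imp_Bseq])
    then obtain b where b: "\<And>i. \<bar>f i\<bar> \<le> b" by (auto simp: Bseq_def)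
    show "(primitive g \<circ> f) \<longlonglongrightarrow> primitive g t"
      unfolding primitive_def o_def
    proof (rule integral_dominated_convergence[OF _ _ exp_weighted_indicator_integrable[OF assms, of b]])
      show "(\<lambda>x. indicator {..<t} x *\<^sub>R g x) \<in> borel_measurable HL" "(\<lambda>x. indicator {..<f i} x *\<^sub>R g x) \<in> borel_measurable HL" for i by measurable
      show "AE x in HL. norm (indicat_real {..<f i} x *\<^sub>R g x) \<le> norm (g x) * indicator {..b} x" for i
      proof (rule AE_I2)
        fix x show "norm (indicat_real {..<f i} x *\<^sub>R g x) \<le> norm (g x) * indicator {..b} x"
          using b[of i] by (auto simp: indicator_def)
      qed
      show "AE x in HL. (\<lambda>i. indicat_real {..<f i} x *\<^sub>R g x) \<longlonglongrightarrow> indicat_real {..<t} x *\<^sub>R g x"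
        using AE_HL_neq[of t]
      proof eventually_elim
        case (elim x)
        have "\<forall>\<^sub>F i in sequentially. indicat_real {..<f i} x = indicat_real {..<t} x"
        proof (cases "x < t")
          case True
          show ?thesis by (rule eventually_mono[OF order_tendstoD(1)[OF f True]]) (use True in simp)
        next
          case False
          then have tx: "t < x" using elim by simp
          show ?thesis by (rule eventually_mono[OF order_tendstoD(2)[OF f tx]]) (use tx in simp)
        qed
        then show ?case by (intro tendsto_eventually, elim eventually_mono) simp
      qed
    qed
  qed
qed simp

lemma tail_integral:
  fixes \<phi> \<phi>' :: "real \<Rightarrow> complex"
  assumes d: "\<And>x. (\<phi> has_vector_derivative \<phi>' x) (at x)" and c: "continuous_on UNIV \<phi>'"
    and b: "\<And>x. 0 < x \<Longrightarrow> norm (\<phi>' x) \<le> C * exp (- \<kappa> * x)" and \<kappa>: "0 < \<kappa>" and l: "(\<phi> \<longlongrightarrow> 0) at_top"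
    and y: "0 \<le> y"
  shows "integrable HL (\<lambda>x. indicator {y<..} x *\<^sub>R \<phi>' x)"
    "(LINT x|HL. indicator {y<..} x *\<^sub>R \<phi>' x) = - \<phi> y"
    "(LINT x|HL. norm (indicator {y<..} x *\<^sub>R \<phi>' x)) \<le> C / \<kappa> * exp (- \<kappa> * y)"
proof -
  have [measurable]: "\<phi>' \<in> borel_measurable borel" using c by (rule borel_measurable_continuous_onI)
  have bm: "(\<lambda>x. indicator {y<..} x *\<^sub>R \<phi>' x) \<in> borel_measurable borel" by measurable
  have C0: "0 \<le> C" using b[of 1] order_trans[OF norm_ge_zero b[of 1]] by (simp add: zero_le_mult_iff)
  have ind: "indicator {0<..} x *\<^sub>R indicator {y<..} x *\<^sub>R z = indicator {y<..} x *\<^sub>R (z :: 'z :: real_vector)" for x z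
    using y by (auto simp: indicator_def)
  have E: "has_bochner_integral lborel (\<lambda>x. indicator {y<..} x * (C * exp (- \<kappa> * x))) (0 - (- (C / \<kappa> * exp (- \<kappa> * y))))"
  proof (rule has_bochner_integral_FTC_Ioi[where F="\<lambda>x. - (C / \<kappa> * exp (- \<kappa> * x))"])
    show "((\<lambda>x. - (C / \<kappa> * exp (- \<kappa> * x))) \<longlongrightarrow> 0) at_top" using \<kappa> by real_asymp
    show "((\<lambda>x. - (C / \<kappa> * exp (- \<kappa> * x))) \<longlongrightarrow> - (C / \<kappa> * exp (- \<kappa> * y))) (at_right y)"
      by (intro tendsto_intros)
    show "0 \<le> C * exp (- \<kappa> * x)" for x using C0 by simp
  qed (use \<kappa> in \<open>auto intro!: derivative_eq_intros continuous_intros\<close>)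
  have nb: "norm (indicator {y<..} x *\<^sub>R \<phi>' x) \<le> indicator {y<..} x * (C * exp (- \<kappa> * x))" for x
    using b[of x] y by (auto simp: indicator_def)
  have i: "integrable lborel (\<lambda>x. indicator {y<..} x *\<^sub>R \<phi>' x)"
    by (rule Bochner_Integration.integrable_bound[of _ "\<lambda>x. indicator {y<..} x * (C * exp (- \<kappa> * x))"])
      (use E bm nb in \<open>auto simp: has_bochner_integral_iff intro!: AE_I2 intro: order_trans[OF _ abs_ge_self]\<close>)
  have S: "{0::real<..} \<in> sets borel" by simp
  show iH: "integrable HL (\<lambda>x. indicator {y<..} x *\<^sub>R \<phi>' x)"
    using i integral_lebesgue_on_borel(1)[OF S bm] by (simp only: ind)
  have e: "einterval (ereal y) \<infinity> = {y<..}" by (auto simp: einterval_def)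
  have "(LBINT x=ereal y..\<infinity>. \<phi>' x) = 0 - \<phi> y"
  proof (rule interval_integral_FTC_integrable[where F=\<phi>])
    show "set_integrable lborel (einterval (ereal y) \<infinity>) \<phi>'" using i by (simp add: e set_integrable_def)
    show "isCont \<phi>' x" for x using c by (simp add: continuous_on_eq_continuous_at)
    have "isCont \<phi> y" using d has_vector_derivative_continuous by blast
    then have "(\<phi> \<longlongrightarrow> \<phi> y) (at_right y)" by (simp add: continuous_within filterlim_at_split)
    then show "((\<phi> \<circ> real_of_ereal) \<longlongrightarrow> \<phi> y) (at_right (ereal y))" by (simp add: ereal_tendsto_simps)
    show "((\<phi> \<circ> real_of_ereal) \<longlongrightarrow> 0) (at_left \<infinity>)" using l by (simp add: ereal_tendsto_simps)
  qed (use d in auto)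
  moreover have "(LBINT x=ereal y..\<infinity>. \<phi>' x) = (LINT x:{y<..}|lborel. \<phi>' x)"
    by (rule interval_integral_to_infinity_eq)
  ultimately have "(LINT x|lborel. indicator {y<..} x *\<^sub>R \<phi>' x) = - \<phi> y" by (simp add: set_lebesgue_integral_def)
  then show "(LINT x|HL. indicator {y<..} x *\<^sub>R \<phi>' x) = - \<phi> y"
    using integral_lebesgue_on_borel(2)[OF S bm] by (simp only: ind)
  have bm2: "(\<lambda>x. indicator {y<..} x *\<^sub>R (C * exp (- \<kappa> * x))) \<in> borel_measurable borel" by simp
  have E2: "integrable HL (\<lambda>x. indicator {y<..} x *\<^sub>R (C * exp (- \<kappa> * x)))"
    "(LINT x|HL. indicator {y<..} x *\<^sub>R (C * exp (- \<kappa> * x))) = C / \<kappa> * exp (- \<kappa> * y)"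
    using E integral_lebesgue_on_borel[OF S bm2] unfolding ind by (simp_all add: has_bochner_integral_iff)
  have "(LINT x|HL. norm (indicator {y<..} x *\<^sub>R \<phi>' x)) \<le> (LINT x|HL. indicator {y<..} x *\<^sub>R (C * exp (- \<kappa> * x)))"
    by (rule integral_mono[OF integrable_norm[OF iH] E2(1)]) (use nb in simp)
  then show "(LINT x|HL. norm (indicator {y<..} x *\<^sub>R \<phi>' x)) \<le> C / \<kappa> * exp (- \<kappa> * y)" by (simp only: E2)
qed

text \<open>Fubini over the region y < x, where the inner integral of \<phi>' over x > y is
  -\<phi>(y). The decay hypothesis covers exponentials, for Laplace transforms of primitives, as
  well as test functions, for weak derivatives.\<close>

lemma integration_by_parts_primitive:
  fixes \<phi> \<phi>' :: "real \<Rightarrow> complex"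
  assumes g: "exp_weighted \<kappa> g"
    and d: "\<And>x. (\<phi> has_vector_derivative \<phi>' x) (at x)" and c: "continuous_on UNIV \<phi>'"
    and b: "\<And>x. 0 < x \<Longrightarrow> norm (\<phi>' x) \<le> C * exp (- \<kappa> * x)" and \<kappa>: "0 < \<kappa>" and l: "(\<phi> \<longlongrightarrow> 0) at_top"
  shows "integrable HL (\<lambda>x. (G0 + primitive g x) * \<phi>' x)"
    "(LINT x|HL. (G0 + primitive g x) * \<phi>' x) = - G0 * \<phi> 0 - (LINT x|HL. g x * \<phi> x)"
proof -
  have gm: "g \<in> borel_measurable HL" using g by (simp add: exp_weighted_def)
  have \<phi>'m: "\<phi>' \<in> borel_measurable HL" using c by (intro borel_imp_lebesgue_on borel_measurable_continuous_onI)
  define h where "h = (\<lambda>y x. if y < x then g y * \<phi>' x else 0)"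
  have hm: "case_prod h \<in> borel_measurable (HL \<Otimes>\<^sub>M HL)"
    unfolding h_def split_beta'
    by (intro measurable_If borel_measurable_times measurable_compose[OF measurable_fst gm] measurable_compose[OF measurable_snd \<phi>'m] borel_measurable_const
       borel_measurable_less measurable_compose[OF measurable_fst HL_ident] measurable_compose[OF measurable_snd HL_ident])
  have hy: "h y x = g y * (indicator {y<..} x *\<^sub>R \<phi>' x)" and hx: "h y x = (indicator {..<x} y *\<^sub>R g y) * \<phi>' x" for y x
    by (auto simp: h_def)
  note t = tail_integral[OF d c b \<kappa> l]
  have hint: "integrable (HL \<Otimes>\<^sub>M HL) (case_prod h)"
  proof (rule HLP.Fubini_integrable[OF hm])
    show "AE y in HL. integrable HL (\<lambda>x. case (y, x) of (y, x) \<Rightarrow> h y x)"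
      unfolding prod.case hy by (intro AE_I2 integrable_mult_right t(1)) auto
    have "integrable HL (\<lambda>y. (C / \<kappa>) * (norm (g y) * exp (- \<kappa> * y)))" using g by (simp add: exp_weighted_def)
    then show "integrable HL (\<lambda>y. LINT x|HL. norm (case (y, x) of (y, x) \<Rightarrow> h y x))"
    proof (rule Bochner_Integration.integrable_bound)
      have "(\<lambda>z. norm (case_prod h z)) \<in> borel_measurable (HL \<Otimes>\<^sub>M HL)" using hm by measurable
      then have "(\<lambda>(y, x). norm (h y x)) \<in> borel_measurable (HL \<Otimes>\<^sub>M HL)" by (simp add: split_beta')
      from HL.borel_measurable_lebesgue_integral[OF this]
      show "(\<lambda>y. LINT x|HL. norm (case (y, x) of (y, x) \<Rightarrow> h y x)) \<in> borel_measurable HL" by simp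
      show "AE y in HL. norm (LINT x|HL. norm (case (y, x) of (y, x) \<Rightarrow> h y x)) \<le> norm (C / \<kappa> * (norm (g y) * exp (- \<kappa> * y)))"
      proof (rule AE_I2)
        fix y assume "y \<in> space HL"
        then have y: "0 \<le> y" by simp
        have "(LINT x|HL. norm (h y x)) = norm (g y) * (LINT x|HL. norm (indicator {y<..} x *\<^sub>R \<phi>' x))"
          unfolding hy norm_mult by simp
        also have "\<dots> \<le> norm (g y) * (C / \<kappa> * exp (- \<kappa> * y))" by (intro mult_left_mono t(3) y) auto
        also have "\<dots> = C / \<kappa> * (norm (g y) * exp (- \<kappa> * y))" by simp
        also have "\<dots> \<le> norm (C / \<kappa> * (norm (g y) * exp (- \<kappa> * y)))" unfolding real_norm_def by (rule abs_ge_self)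
        finally show "norm (LINT x|HL. norm (case (y, x) of (y, x) \<Rightarrow> h y x)) \<le> norm (C / \<kappa> * (norm (g y) * exp (- \<kappa> * y)))"
          unfolding prod.case by (simp only: real_norm_def[of "LINT x|HL. norm (h y x)"] abs_of_nonneg[OF Bochner_Integration.integral_nonneg[OF norm_ge_zero]])
      qed
    qed
  qed
  have in1: "(LINT y|HL. h y x) = primitive g x * \<phi>' x" for x
    unfolding hx primitive_def by (rule integral_mult_left_zero)
  have in2: "(LINT x|HL. h y x) = - (g y * \<phi> y)" if "0 < y" for y
    unfolding hy Bochner_Integration.integral_mult_right_zero using t(2)[of y] that by simp
  have i1: "integrable HL (\<lambda>x. primitive g x * \<phi>' x)"
    using HLP.integrable_snd[OF hint] by (simp add: in1)
  have "(LINT x|HL. primitive g x * \<phi>' x) = (LINT y|HL. LINT x|HL. h y x)"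
    using HLP.Fubini_integral[OF hint] by (simp add: in1)
  also have "\<dots> = (LINT y|HL. - (g y * \<phi> y))"
    by (rule Bochner_Integration.integral_cong[OF refl]) (use in2 in simp)
  finally have I1: "(LINT x|HL. primitive g x * \<phi>' x) = - (LINT y|HL. g y * \<phi> y)" by simp
  have "indicator {0<..} x *\<^sub>R \<phi>' x = \<phi>' x" if "x \<in> space HL" for x using that by simp
  then have i2: "integrable HL \<phi>'" "(LINT x|HL. \<phi>' x) = - \<phi> 0"
    using t(1,2)[of 0] Bochner_Integration.integrable_cong[of HL HL "\<lambda>x. indicator {0<..} x *\<^sub>R \<phi>' x" \<phi>']
      Bochner_Integration.integral_cong[of HL HL "\<lambda>x. indicator {0<..} x *\<^sub>R \<phi>' x" \<phi>'] by auto
  show "integrable HL (\<lambda>x. (G0 + primitive g x) * \<phi>' x)"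
    unfolding distrib_right by (intro Bochner_Integration.integrable_add i1 integrable_mult_right i2)
  show "(LINT x|HL. (G0 + primitive g x) * \<phi>' x) = - G0 * \<phi> 0 - (LINT x|HL. g x * \<phi> x)"
    unfolding distrib_right using i1 i2 I1 by simp
qed

definition laplace :: "(real \<Rightarrow> complex) \<Rightarrow> real \<Rightarrow> complex" where
  "laplace f \<kappa> = (LINT x|HL. f x * of_real (exp (- \<kappa> * x)))"

lemma laplace_integrable: assumes "exp_weighted \<kappa> f" shows "integrable HL (\<lambda>x. f x * of_real (exp (- \<kappa> * x)))"
proof (rule Bochner_Integration.integrable_bound)
  show "integrable HL (\<lambda>x. norm (f x) * exp (- \<kappa> * x))" using assms by (simp add: exp_weighted_def)
  have "(\<lambda>x. complex_of_real (exp (- \<kappa> * x))) \<in> borel_measurable HL" by (rule borel_imp_lebesgue_on) measurable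
  then show "(\<lambda>x. f x * of_real (exp (- \<kappa> * x))) \<in> borel_measurable HL"
    using assms by (intro borel_measurable_times) (auto simp: exp_weighted_def)
qed (auto simp: norm_mult)

lemma laplace_primitive:
  assumes g: "exp_weighted \<kappa> g" and \<kappa>: "0 < \<kappa>"
  shows "of_real \<kappa> * laplace (\<lambda>x. G0 + primitive g x) \<kappa> = G0 + laplace g \<kappa>"
proof -
  have d: "((\<lambda>x. complex_of_real (exp (- \<kappa> * x))) has_vector_derivative of_real (- \<kappa> * exp (- \<kappa> * x))) (at x)" for x
    by (intro has_vector_derivative_of_real) (auto intro!: derivative_eq_intros)
  have "(LINT x|HL. (G0 + primitive g x) * of_real (- \<kappa> * exp (- \<kappa> * x))) = - G0 * of_real (exp (- \<kappa> * 0)) - (LINT x|HL. g x * of_real (exp (- \<kappa> * x)))"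
  proof (rule integration_by_parts_primitive(2)[OF g d, where C=\<kappa>])
    show "continuous_on UNIV (\<lambda>x. complex_of_real (- \<kappa> * exp (- \<kappa> * x)))" by (intro continuous_intros)
    have "((\<lambda>x. exp (- \<kappa> * x)) \<longlongrightarrow> 0) at_top" using \<kappa> by real_asymp
    from tendsto_of_real[OF this] show "((\<lambda>x. complex_of_real (exp (- \<kappa> * x))) \<longlongrightarrow> 0) at_top" by simp
  qed (use \<kappa> in \<open>auto simp: norm_mult\<close>)
  moreover have "(LINT x|HL. (G0 + primitive g x) * of_real (- \<kappa> * exp (- \<kappa> * x))) = - of_real \<kappa> * laplace (\<lambda>x. G0 + primitive g x) \<kappa>"
    unfolding laplace_def by (subst integral_mult_right_zero[symmetric]) (simp add: mult_ac)
  ultimately have "- (of_real \<kappa> * laplace (\<lambda>x. G0 + primitive g x) \<kappa>) = - (G0 + laplace g \<kappa>)" by (simp add: laplace_def)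
  then show ?thesis by (simp only: neg_equal_iff_equal)
qed

text \<open>Increments are controlled only between positive points. Letting the left one tend to 0
  uses the continuity of v up to the vertex, which is how the boundary value enters.\<close>

lemma weak_deriv_rep:
  assumes f: "L2 HL f" and g: "L2 HL g" and wd: "weak_deriv f g"
    and v: "continuous_on {0..} v" and vf: "AE x in HL. v x = f x" and t: "0 \<le> t"
  shows "v t = v 0 + primitive g t"
proof (cases "t = 0")
  case True
  then show ?thesis by (simp add: primitive_0)
next
  case False
  then have t0: "0 < t" using t by simp
  have ex: "exp_weighted 1 g" using g by (rule exp_weighted_L2) simp
  note pi = exp_weighted_primitive_integrable[OF ex zero_less_one]
  have inc: "v t - v s = primitive g t - primitive g s" if s: "0 < s" "s < t" for s
  proof -
    have "v t - v s = (LINT x|HL. indicator {s<..t} x *\<^sub>R g x)"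
      by (rule weak_deriv_increment[OF f g wd v vf s])
    also have "\<dots> = (LINT x|HL. indicator {..<t} x *\<^sub>R g x - indicator {..<s} x *\<^sub>R g x)"
    proof (rule integral_cong_AE)
      have gm: "g \<in> borel_measurable HL" using g by (simp add: L2_def)
      show "(\<lambda>x. indicat_real {s<..t} x *\<^sub>R g x) \<in> borel_measurable HL"
        by (rule borel_measurable_scaleR[OF borel_imp_lebesgue_on gm]) simp
      show "(\<lambda>x. indicat_real {..<t} x *\<^sub>R g x - indicat_real {..<s} x *\<^sub>R g x) \<in> borel_measurable HL"
        using pi by (intro borel_measurable_diff) auto
      show "AE x in HL. indicat_real {s<..t} x *\<^sub>R g x = indicat_real {..<t} x *\<^sub>R g x - indicat_real {..<s} x *\<^sub>R g x"
        using AE_HL_neq[of s] AE_HL_neq[of t]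
      proof eventually_elim
        case (elim x)
        then show ?case using s by (auto simp: indicator_def)
      qed
    qed
    also have "\<dots> = primitive g t - primitive g s" unfolding primitive_def by (intro Bochner_Integration.integral_diff pi)
    finally show ?thesis .
  qed
  \<comment> \<open>The index is shifted by two so that s m < t holds already at m = 0.\<close>
  define s where "s = (\<lambda>m. t * inverse (real (Suc (Suc m))))"
  have s: "0 < s m" "s m < t" for m
    using t0 mult_strict_left_mono[of "inverse (real (Suc (Suc m)))" 1 t] by (auto simp: s_def inverse_less_1_iff)
  have "(\<lambda>m. inverse (real (Suc (Suc m)))) \<longlonglongrightarrow> 0"
    using LIMSEQ_inverse_real_of_nat by (rule LIMSEQ_Suc)
  then have sl: "s \<longlonglongrightarrow> 0" unfolding s_def by (rule tendsto_mult_right_zero)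
  have "(\<lambda>m. v (s m)) \<longlonglongrightarrow> v 0"
    by (rule continuous_on_tendsto_compose[OF v sl]) (use s in \<open>auto intro!: always_eventually less_imp_le\<close>)
  moreover have "(\<lambda>m. primitive g (s m)) \<longlonglongrightarrow> primitive g 0"
    by (rule continuous_on_tendsto_compose[OF primitive_continuous[OF ex zero_less_one, of UNIV] sl]) auto
  ultimately have "(\<lambda>m. v (s m) - primitive g (s m)) \<longlonglongrightarrow> v 0 - primitive g 0" by (intro tendsto_diff)
  moreover have "v (s m) - primitive g (s m) = v t - primitive g t" for m using inc[OF s] by (simp add: algebra_simps)
  ultimately have "v t - primitive g t = v 0" by (simp add: primitive_0 LIMSEQ_const_iff)
  then show ?thesis by (simp add: diff_eq_eq)
qed

lemma laplace_cong_AE: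
  assumes "AE x in HL. f x = g x" "f \<in> borel_measurable HL" "g \<in> borel_measurable HL"
  shows "laplace f \<kappa> = laplace g \<kappa>"
  unfolding laplace_def
proof (rule integral_cong_AE)
  have "(\<lambda>x. complex_of_real (exp (- \<kappa> * x))) \<in> borel_measurable HL" by (rule borel_imp_lebesgue_on) measurable
  then show "(\<lambda>x. f x * of_real (exp (- \<kappa> * x))) \<in> borel_measurable HL" "(\<lambda>x. g x * of_real (exp (- \<kappa> * x))) \<in> borel_measurable HL"
    using assms by (auto intro!: borel_measurable_times)
  show "AE x in HL. f x * of_real (exp (- \<kappa> * x)) = g x * of_real (exp (- \<kappa> * x))"
    using assms(1) by eventually_elim simp
qed

lemma laplace_add: "exp_weighted \<kappa> f \<Longrightarrow> exp_weighted \<kappa> g \<Longrightarrow> laplace (\<lambda>x. f x + g x) \<kappa> = laplace f \<kappa> + laplace g \<kappa>"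
  unfolding laplace_def distrib_right by (rule Bochner_Integration.integral_add[OF laplace_integrable laplace_integrable])

lemma laplace_diff: "exp_weighted \<kappa> f \<Longrightarrow> exp_weighted \<kappa> g \<Longrightarrow> laplace (\<lambda>x. f x - g x) \<kappa> = laplace f \<kappa> - laplace g \<kappa>"
  unfolding laplace_def left_diff_distrib by (rule Bochner_Integration.integral_diff[OF laplace_integrable laplace_integrable])

lemma laplace_scale: "laplace (\<lambda>x. b * f x) \<kappa> = b * laplace f \<kappa>"
  unfolding laplace_def by (simp add: mult.assoc)

lemma exp_weighted_scale: "exp_weighted \<kappa> f \<Longrightarrow> exp_weighted \<kappa> (\<lambda>x. b * f x)"
  by (auto simp: exp_weighted_def norm_mult mult.assoc)

lemma L2_cong_AE:
  assumes "L2 HL f" "g \<in> borel_measurable HL" "AE x in HL. g x = f x" shows "L2 HL g"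
  unfolding L2_def
proof
  show "integrable HL (\<lambda>x. (cmod (g x))^2)"
  proof (rule integrable_cong_AE_imp[OF L2_integrable[OF assms(1)]])
    show "(\<lambda>x. (cmod (g x))^2) \<in> borel_measurable HL" using assms(2) by measurable
    show "AE x in HL. (cmod (f x))^2 = (cmod (g x))^2" using assms(3) by eventually_elim simp
  qed
qed (rule assms)

lemma weak_deriv_primitive:
  assumes g: "exp_weighted 1 g" and u: "u \<in> borel_measurable HL" and uv: "AE x in HL. u x = G0 + primitive g x"
  shows "weak_deriv u g"
  unfolding weak_deriv_def
proof (intro allI impI)
  fix \<phi> assume "test_fun \<phi>"
  then obtain D :: "nat \<Rightarrow> real \<Rightarrow> complex" and s t where D: "D 0 = \<phi>" "\<And>m x. (D m has_vector_derivative D (Suc m) x) (at x)"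
    and st: "0 < s" "s \<le> t" "\<And>x. x \<notin> {s..t} \<Longrightarrow> \<phi> x = 0"
    unfolding test_fun_def by blast
  have d: "(\<phi> has_vector_derivative D 1 x) (at x)" for x using D(2)[of 0] by (simp add: D(1))
  have c: "continuous_on UNIV (D 1)"
    using D(2)[of 1] has_vector_derivative_continuous by (intro continuous_at_imp_continuous_on) blast
  have D0: "D 1 x = 0" if "x \<notin> {s..t}" for x
  proof -
    have "(\<phi> has_vector_derivative 0) (at x)"
      by (rule has_vector_derivative_transform_within_open[where f="\<lambda>_. 0" and S="- {s..t}"])
         (use that st(3) in auto)
    then show ?thesis using d vector_derivative_unique_at by blast
  qed
  \<comment> \<open>The growing exponential is bounded on the compact support, which provides the
    decay hypothesis of the integration by parts.\<close>
  have "compact ((\<lambda>x. D 1 x * of_real (exp (1 * x))) ` {s..t})"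
    by (intro compact_continuous_image continuous_intros continuous_on_subset[OF c]) auto
  from compact_imp_bounded[OF this] obtain C where "\<forall>y\<in>(\<lambda>x. D 1 x * of_real (exp (1 * x))) ` {s..t}. norm y \<le> C"
    unfolding bounded_iff by blast
  then have C: "norm (D 1 x * of_real (exp (1 * x))) \<le> C" if "x \<in> {s..t}" for x using that by blast
  have C0: "0 \<le> C" by (rule order_trans[OF norm_ge_zero C[of s]]) (use st in simp)
  have b: "norm (D 1 x) \<le> C * exp (- 1 * x)" for x
  proof (cases "x \<in> {s..t}")
    case True
    have "norm (D 1 x) * exp x \<le> C" using C[OF True] by (simp add: norm_mult)
    then have "norm (D 1 x) * exp x * exp (- x) \<le> C * exp (- x)" by (intro mult_right_mono) auto
    then show ?thesis by (simp add: mult.assoc exp_add[symmetric])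
  qed (use D0 C0 in auto)
  have l: "(\<phi> \<longlongrightarrow> 0) at_top"
    by (rule tendsto_eventually, rule eventually_mono[OF eventually_gt_at_top[of t]]) (use st(3) in auto)
  have vd: "vector_derivative \<phi> (at x) = D 1 x" for x by (rule vector_derivative_at[OF d])
  have "(LINT x|HL. u x * D 1 x) = (LINT x|HL. (G0 + primitive g x) * D 1 x)"
  proof (rule integral_cong_AE)
    have Dm: "D 1 \<in> borel_measurable HL" using c by (intro borel_imp_lebesgue_on borel_measurable_continuous_onI)
    show "(\<lambda>x. u x * D 1 x) \<in> borel_measurable HL" by (intro borel_measurable_times u Dm)
    show "(\<lambda>x. (G0 + primitive g x) * D 1 x) \<in> borel_measurable HL"
      using integration_by_parts_primitive(1)[OF g d c b _ l, of G0] by auto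
    show "AE x in HL. u x * D 1 x = (G0 + primitive g x) * D 1 x" using uv by eventually_elim simp
  qed
  also have "\<dots> = - G0 * \<phi> 0 - (LINT x|HL. g x * \<phi> x)"
    by (rule integration_by_parts_primitive(2)[OF g d c b _ l]) simp
  also have "\<phi> 0 = 0" using st by auto
  finally show "(LINT x|HL. u x * vector_derivative \<phi> (at x)) = - (LINT x|HL. g x * \<phi> x)" by (simp add: vd)
qed

text \<open>The derivative is recovered from the increments of the function over unit intervals.\<close>
lemma L2_deriv:
  assumes h: "L2 HL h" and vL: "L2 HL (\<lambda>x. b + primitive (\<lambda>y. d + primitive h y) x)"
  shows "L2 HL (\<lambda>x. d + primitive h x)"
proof -
  define dv where "dv = (\<lambda>x. d + primitive h x)"
  define v where "v = (\<lambda>x. b + primitive dv x)"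
  have hm[measurable]: "h \<in> borel_measurable HL" using h by (simp add: L2_def)
  have ex: "exp_weighted \<kappa> h" if "0 < \<kappa>" for \<kappa> using exp_weighted_L2[OF h that] .
  have dvc: "continuous_on S dv" for S
    unfolding dv_def by (intro continuous_intros primitive_continuous[OF ex[of 1]]) auto
  have dvm: "dv \<in> borel_measurable HL" by (rule HL_measurable_continuous[OF dvc])
  define K where "K = norm d + (LINT x|HL. norm (h x) * exp (- 1 * x))"
  have dvb: "norm (dv x) \<le> K * exp (1 * x)" if "0 < x" for x
  proof -
    have "norm (dv x) \<le> norm d + norm (primitive h x)" unfolding dv_def by (rule norm_triangle_ineq)
    also have "norm d \<le> norm d * exp (1 * x)" using that by (simp add: mult_le_cancel_left1)
    also have "norm (primitive h x) \<le> (LINT x|HL. norm (h x) * exp (- 1 * x)) * exp (1 * x)" by (rule primitive_bound[OF ex]) auto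
    finally show ?thesis by (simp add: K_def distrib_right)
  qed
  have dvex: "exp_weighted 2 dv" by (rule exp_weighted_bounded[OF dvm dvb]) auto
  note dvi = exp_weighted_primitive_integrable[OF dvex] and hi = exp_weighted_primitive_integrable[OF ex[of 1]]
  \<comment> \<open>A bound for the oscillation of \<open>dv\<close> over [x, x + 1).\<close>
  define R where "R = (\<lambda>x. LINT y|HL. norm (indicator {x..<x+1} y *\<^sub>R h y))"
  have im: "(\<lambda>y. indicator {x..<z} y :: real) \<in> borel_measurable HL" for x z :: real
    by (rule borel_imp_lebesgue_on) simp
  have hint: "integrable HL (\<lambda>y. indicator {x..<x+1} y *\<^sub>R h y)" for x
  proof (rule Bochner_Integration.integrable_bound[OF hi[of "x+1"]])
    show "(\<lambda>y. indicat_real {x..<x+1} y *\<^sub>R h y) \<in> borel_measurable HL" by (intro borel_measurable_scaleR im hm)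
  qed (auto simp: indicator_def)
  have diffprim: "primitive f z - primitive f x = (LINT y|HL. indicator {x..<z} y *\<^sub>R f y)"
    if "x \<le> z" "exp_weighted 2 f" for f x z
  proof -
    have "primitive f z - primitive f x = (LINT y|HL. indicator {..<z} y *\<^sub>R f y - indicator {..<x} y *\<^sub>R f y)"
      unfolding primitive_def using exp_weighted_primitive_integrable[OF that(2)] by (intro Bochner_Integration.integral_diff[symmetric]) auto
    also have "\<dots> = (LINT y|HL. indicator {x..<z} y *\<^sub>R f y)"
      by (intro Bochner_Integration.integral_cong refl) (use that(1) in \<open>auto simp: indicator_def\<close>)
    finally show ?thesis .
  qed
  have osc: "norm (dv y - dv x) \<le> R x" if "x \<le> y" "y < x + 1" for x y
  proof -
    have "dv y - dv x = (LINT z|HL. indicator {x..<y} z *\<^sub>R h z)"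
      unfolding dv_def using diffprim[OF that(1) ex[of 2]] by simp
    also have "norm \<dots> \<le> R x" unfolding R_def
    proof (rule Bochner_Integration.integral_norm_bound_integral)
      show "integrable HL (\<lambda>z. indicator {x..<y} z *\<^sub>R h z)"
        by (rule Bochner_Integration.integrable_bound[OF hint[of x] borel_measurable_scaleR[OF im hm]])
           (use that in \<open>auto simp: indicator_def\<close>)
      show "integrable HL (\<lambda>y. norm (indicator {x..<x+1} y *\<^sub>R h y))" by (rule integrable_norm[OF hint])
      show "norm (indicat_real {x..<y} z *\<^sub>R h z) \<le> norm (indicat_real {x..<x + 1} z *\<^sub>R h z)" for z
        using that by (auto simp: indicator_def)
    qed
    finally show ?thesis .
  qed
  have one: "has_bochner_integral HL (\<lambda>y. indicator {x..<x+1} y *\<^sub>R (w::complex)) w" if "0 < x" for x w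
  proof -
    have 1: "has_bochner_integral lborel (\<lambda>y. indicator {x..<x+1} y *\<^sub>R w) (measure lborel {x..<x+1} *\<^sub>R w)"
      by (rule has_bochner_integral_scaleR_left[OF has_bochner_integral_real_indicator]) auto
    have e: "indicator {0<..} y *\<^sub>R indicator {x..<x+1} y *\<^sub>R w = indicator {x..<x+1} y *\<^sub>R w" for y
      using that by (auto simp: indicator_def)
    have S: "{0::real<..} \<in> sets borel" and m: "(\<lambda>y. indicator {x..<x+1} y *\<^sub>R w) \<in> borel_measurable borel" by simp_all
    have m1: "measure lborel {x..<x+1} = 1" by simp
    show ?thesis using 1 integral_lebesgue_on_borel[OF S m] unfolding e m1 has_bochner_integral_iff by simp
  qed
  \<comment> \<open>Mean value over [x, x + 1): \<open>dv x\<close> differs from v (x + 1) - v x by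
    the mean of dv y - dv x, which R x controls.\<close>
  have key: "norm (dv x) \<le> norm (v (x + 1)) + norm (v x) + R x" if x: "0 < x" for x
  proof -
    have dvi1: "integrable HL (\<lambda>y. indicator {x..<x+1} y *\<^sub>R dv y)"
      by (rule Bochner_Integration.integrable_bound[OF dvi[of "x+1"] borel_measurable_scaleR[OF im dvm]])
         (auto simp: indicator_def)
    have "v (x + 1) - v x = (LINT y|HL. indicator {x..<x+1} y *\<^sub>R dv y)"
      unfolding v_def using diffprim[of x "x+1" dv] dvex by simp
    then have "v (x + 1) - v x - dv x = (LINT y|HL. indicator {x..<x+1} y *\<^sub>R dv y - indicator {x..<x+1} y *\<^sub>R dv x)"
      using one[OF x, of "dv x"] dvi1 by (subst Bochner_Integration.integral_diff) (auto simp: has_bochner_integral_iff)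
    also have "\<dots> = (LINT y|HL. indicator {x..<x+1} y *\<^sub>R (dv y - dv x))" by (simp add: scaleR_diff_right)
    also have "norm \<dots> \<le> (LINT y|HL. indicator {x..<x+1} y * R x)"
    proof (rule Bochner_Integration.integral_norm_bound_integral)
      show "integrable HL (\<lambda>y. indicator {x..<x+1} y *\<^sub>R (dv y - dv x))"
        unfolding scaleR_diff_right using one[OF x, of "dv x"] dvi1 by (intro Bochner_Integration.integrable_diff) (auto simp: has_bochner_integral_iff)
      have "integrable HL (\<lambda>y. Re (indicator {x..<x+1} y *\<^sub>R of_real (R x)))"
        using one[OF x, of "of_real (R x)"] by (intro integrable_Re) (simp add: has_bochner_integral_iff)
      then show "integrable HL (\<lambda>y. indicator {x..<x+1} y * R x)" by simp
      show "norm (indicat_real {x..<x+1} y *\<^sub>R (dv y - dv x)) \<le> indicator {x..<x+1} y * R x" for y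
        using osc[of x y] by (auto simp: indicator_def)
    qed
    also have "\<dots> = Re (LINT y|HL. indicator {x..<x+1} y *\<^sub>R of_real (R x))"
      using one[OF x, of "of_real (R x)"] by (subst integral_Re[symmetric]) (auto simp: has_bochner_integral_iff)
    also have "\<dots> = R x" using one[OF x, of "of_real (R x)"] by (simp add: has_bochner_integral_iff)
    finally have "norm (dv x - (v (x + 1) - v x)) \<le> R x" by (simp add: norm_minus_commute)
    then have "norm (dv x) \<le> norm (v (x + 1) - v x) + R x" using norm_triangle_ineq2[of "dv x" "v (x + 1) - v x"] by linarith
    then show ?thesis using norm_triangle_ineq4[of "v (x + 1)" "v x"] by linarith
  qed
  \<comment> \<open>The local energy of h. Cauchy-Schwarz on an interval of length 1, in the form
    for tuples with a single edge, bounds the square of R by it.\<close>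
  define H2 where "H2 = (\<lambda>x. LINT y|HL. (if x \<le> y \<and> y < x + 1 then (cmod (h y))^2 else 0))"
  have R2: "(R x)^2 \<le> H2 x" if x: "0 < x" for x
  proof -
    define u :: "nat \<Rightarrow> real \<Rightarrow> complex" where "u = (\<lambda>_ y. of_real (norm (indicator {x..<x+1} y *\<^sub>R h y)))"
    define w :: "nat \<Rightarrow> real \<Rightarrow> complex" where "w = (\<lambda>_ y. indicator {x..<x+1} y *\<^sub>R 1)"
    have um: "(\<lambda>y. norm (indicator {x..<x+1} y *\<^sub>R h y)) \<in> borel_measurable HL"
      using borel_measurable_scaleR[OF im hm] by measurable
    have uL: "tuple_L2 1 Hm u"
      unfolding tuple_L2_def u_def
      by (intro ballI L2_bound[OF _ L2_integrable[OF h]] measurable_compose[OF um borel_measurable_continuous_onI[OF continuous_on_of_real_id]])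
         (auto simp: indicator_def)
    have wL: "tuple_L2 1 Hm w"
      unfolding tuple_L2_def w_def
    proof (intro ballI L2_bound)
      show "(\<lambda>y. indicator {x..<x+1} y *\<^sub>R (1::complex)) \<in> borel_measurable HL" by (intro borel_measurable_scaleR im) simp
      show "integrable HL (\<lambda>y. Re (indicator {x..<x+1} y *\<^sub>R 1))"
        using one[OF x, of 1] by (intro integrable_Re) (simp add: has_bochner_integral_iff)
    qed (auto simp: indicator_def)
    have "tuple_inner 1 Hm u w = (LINT y|HL. of_real (norm (indicator {x..<x+1} y *\<^sub>R h y)))"
      unfolding tuple_inner_def u_def w_def by (auto intro!: Bochner_Integration.integral_cong simp: indicator_def)
    also have "\<dots> = of_real (R x)" unfolding R_def by (rule integral_complex_of_real)
    finally have tuple_inner: "tuple_inner 1 Hm u w = of_real (R x)" .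
    have nu: "tuple_norm2 1 Hm u = H2 x"
      unfolding tuple_norm2_def H2_def u_def by (auto intro!: Bochner_Integration.integral_cong simp: indicator_def)
    have nw: "tuple_norm2 1 Hm w = 1"
    proof -
      have "tuple_norm2 1 Hm w = (LINT y|HL. Re (indicator {x..<x+1} y *\<^sub>R 1))"
        unfolding tuple_norm2_def w_def by (auto intro!: Bochner_Integration.integral_cong simp: indicator_def)
      also have "\<dots> = 1" using one[OF x, of 1] by (subst integral_Re) (auto simp: has_bochner_integral_iff)
      finally show ?thesis .
    qed
    show ?thesis using tuple_inner_Cauchy_Schwarz[OF uL wL] unfolding tuple_inner nu nw by simp
  qed
  have H2i: "integrable HL H2"
  proof -
    \<comment> \<open>A given y is counted by the x in (y - 1, y], a set of measure at most 1, so by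
      Fubini the integral of \<open>H2\<close> is at most that of the square of h.\<close>
    define f where "f = (\<lambda>y x. if x \<le> y \<and> y < x + 1 then (cmod (h y))^2 else 0)"
    have fx: "f y x = (cmod (h y))^2 * indicator {y-1<..y} x" for y x by (auto simp: f_def indicator_def)
    have f1: "fst \<in> borel_measurable (HL \<Otimes>\<^sub>M HL)" by (rule measurable_compose[OF measurable_fst HL_ident])
    have f2: "snd \<in> borel_measurable (HL \<Otimes>\<^sub>M HL)" by (rule measurable_compose[OF measurable_snd HL_ident])
    have h2m: "(\<lambda>y. (cmod (h y))^2) \<in> borel_measurable HL" by measurable
    have hf: "(\<lambda>z. (cmod (h (fst z)))^2) \<in> borel_measurable (HL \<Otimes>\<^sub>M HL)"
      by (rule measurable_compose[OF measurable_fst h2m])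
    have "case_prod f \<in> borel_measurable (HL \<Otimes>\<^sub>M HL)"
      unfolding f_def split_beta' using f1 f2 hf by measurable
    note fm = this
    have ind: "integrable HL (\<lambda>x. indicator {y-1<..y} x :: real)" "(LINT x|HL. indicator {y-1<..y} x :: real) \<le> 1" for y
    proof -
      have e: "indicator {0<..} x *\<^sub>R (indicator {y-1<..y} x :: real) = indicator {max 0 (y-1)<..y} x" for x :: real
        by (auto simp: indicator_def)
      have m: "(\<lambda>x. indicator {y-1<..y} x :: real) \<in> borel_measurable borel" by simp
      have fin: "emeasure lborel {max 0 (y-1)<..y} < \<infinity>"
        by (rule emeasure_bounded_finite) (rule bounded_subset[OF bounded_closed_interval[of "max 0 (y-1)" y]], auto)
      then have hb: "has_bochner_integral lborel (\<lambda>x. indicator {max 0 (y-1)<..y} x :: real) (measure lborel {max 0 (y-1)<..y})"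
        by (intro has_bochner_integral_real_indicator) auto
      have mle: "measure lborel {max 0 (y-1)<..y} \<le> 1"
      proof (cases "max 0 (y-1) \<le> y")
        case True
        then show ?thesis by (simp only: measure_lborel_Ioc)
      qed auto
      have S: "{0::real<..} \<in> sets borel" by simp
      show "integrable HL (\<lambda>x. indicator {y-1<..y} x :: real)" "(LINT x|HL. indicator {y-1<..y} x :: real) \<le> 1"
        using integral_lebesgue_on_borel[OF S m] hb mle unfolding e has_bochner_integral_iff by argo+
    qed
    have "integrable (HL \<Otimes>\<^sub>M HL) (case_prod f)"
    proof (rule HLP.Fubini_integrable[OF fm])
      show "AE y in HL. integrable HL (\<lambda>x. case (y, x) of (y, x) \<Rightarrow> f y x)"
        unfolding prod.case fx by (intro AE_I2 integrable_mult_right ind)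
      show "integrable HL (\<lambda>y. LINT x|HL. norm (case (y, x) of (y, x) \<Rightarrow> f y x))"
      proof (rule Bochner_Integration.integrable_bound[OF L2_integrable[OF h]])
        have "(\<lambda>(y, x). norm (f y x)) \<in> borel_measurable (HL \<Otimes>\<^sub>M HL)"
          using measurable_compose[OF fm borel_measurable_continuous_onI[OF continuous_on_norm_id]] by (simp add: split_beta')
        from HL.borel_measurable_lebesgue_integral[OF this]
        show "(\<lambda>y. LINT x|HL. norm (case (y, x) of (y, x) \<Rightarrow> f y x)) \<in> borel_measurable HL" by simp
        show "AE y in HL. norm (LINT x|HL. norm (case (y, x) of (y, x) \<Rightarrow> f y x)) \<le> norm ((cmod (h y))^2)"
        proof (rule AE_I2)
          fix y
          have "(LINT x|HL. norm (f y x)) = (cmod (h y))^2 * (LINT x|HL. indicator {y-1<..y} x)"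
            unfolding fx by simp
          also have "\<dots> \<le> (cmod (h y))^2 * 1" by (intro mult_left_mono ind) auto
          finally have "(LINT x|HL. norm (f y x)) \<le> (cmod (h y))^2" by simp
          moreover have "0 \<le> (LINT x|HL. norm (f y x))" by simp
          ultimately show "norm (LINT x|HL. norm (case (y, x) of (y, x) \<Rightarrow> f y x)) \<le> norm ((cmod (h y))^2)" by simp
        qed
      qed
    qed
    from HLP.integrable_snd[OF this] show ?thesis by (simp add: H2_def f_def)
  qed
  have vc: "continuous_on UNIV v" unfolding v_def
    by (intro continuous_intros primitive_continuous[OF dvex]) auto
  then have vB: "(\<lambda>x. (cmod (v x))^2) \<in> borel_measurable borel" "(\<lambda>x. (cmod (v (x + 1)))^2) \<in> borel_measurable borel"
    by (auto intro!: borel_measurable_continuous_onI continuous_intros intro: continuous_on_compose2)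
  have vi: "integrable HL (\<lambda>x. (cmod (v x))^2)" using L2_integrable[OF vL] by (simp add: v_def dv_def)
  have vsi: "integrable HL (\<lambda>x. (cmod (v (x + 1)))^2)"
  proof -
    have "integrable lborel (\<lambda>x. indicator {0<..} x *\<^sub>R (cmod (v x))^2)"
      using vi integral_lebesgue_on_borel(1)[of "{0<..}", OF _ vB(1)] by simp
    from lborel_integrable_real_affine[OF this, of 1 1]
    have "integrable lborel (\<lambda>x. indicator {0<..} (1 + x) *\<^sub>R (cmod (v (1 + x)))^2)" by simp
    then have "integrable lborel (\<lambda>x. indicator {0<..} x *\<^sub>R (cmod (v (x + 1)))^2)"
    proof (rule Bochner_Integration.integrable_bound)
      show "(\<lambda>x. indicat_real {0<..} x *\<^sub>R (cmod (v (x + 1)))\<^sup>2) \<in> borel_measurable lborel"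
        using vB(2) by (intro borel_measurable_scaleR) auto
    qed (auto simp: indicator_def add.commute)
    then show ?thesis using integral_lebesgue_on_borel(1)[of "{0<..}", OF _ vB(2)] by simp
  qed
  have "L2 HL dv"
  proof (rule L2_bound[OF dvm])
    show "integrable HL (\<lambda>x. 3 * ((cmod (v (x + 1)))^2 + (cmod (v x))^2 + H2 x))"
      by (intro integrable_mult_right Bochner_Integration.integrable_add vi vsi H2i)
    fix x assume "x \<in> space HL"
    then have x: "0 < x" by simp
    have sq3: "(p + r + s)^2 \<le> 3 * (p^2 + r^2 + s^2)" for p r s :: real
      using sum_squares_bound[of p r] sum_squares_bound[of p s] sum_squares_bound[of r s]
      by (simp add: power2_eq_square algebra_simps)
    have "(cmod (dv x))^2 \<le> (norm (v (x + 1)) + norm (v x) + R x)^2"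
      by (rule power_mono[OF key[OF x]]) simp
    also have "\<dots> \<le> 3 * ((norm (v (x + 1)))^2 + (norm (v x))^2 + (R x)^2)" by (rule sq3)
    also have "\<dots> \<le> 3 * ((cmod (v (x + 1)))^2 + (cmod (v x))^2 + H2 x)" using R2[OF x] by simp
    finally show "(cmod (dv x))^2 \<le> 3 * ((cmod (v (x + 1)))^2 + (cmod (v x))^2 + H2 x)" .
  qed
  then show ?thesis by (simp add: dv_def)
qed

text \<open>Completeness of Lebesgue measure. In \<open>A_rel\<close> the function w is prescribed
  only almost everywhere, and its measurability has to be deduced.\<close>

lemma measurable_HL_AE:
  fixes f g :: "real \<Rightarrow> complex"
  assumes "f \<in> borel_measurable HL" "AE x in HL. f x = g x"
  shows "g \<in> borel_measurable HL"
proof -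
  have "(\<lambda>x. if x \<in> {0<..} then f x else 0) \<in> borel_measurable lebesgue"
    using assms(1) by (subst borel_measurable_if) auto
  moreover have "AE x in lebesgue. (if x \<in> {0<..} then f x else 0) = (if x \<in> {0<..} then g x else 0)"
    using assms(2) by (subst (asm) AE_restrict_space_iff) auto
  ultimately have "(\<lambda>x. if x \<in> {0<..} then g x else 0) \<in> borel_measurable lebesgue"
    by (rule borel_measurable_AE)
  then show ?thesis by (subst (asm) borel_measurable_if) auto
qed

lemma laplace_cong: "(\<And>x. 0 < x \<Longrightarrow> f x = g x) \<Longrightarrow> laplace f \<kappa> = laplace g \<kappa>"
  unfolding laplace_def by (intro Bochner_Integration.integral_cong refl) auto

section \<open>The domain of A in terms of Laplace transforms\<close>

context star begin

lemma tuple_inner_edge_exp: assumes "k \<in> {1..n}" shows "tuple_inner n Hm u (edge_exp \<kappa> k) = laplace (u k) \<kappa>"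
proof -
  have "tuple_inner n Hm u (edge_exp \<kappa> k) = (\<Sum>j\<in>{1..n}. if j = k then laplace (u k) \<kappa> else 0)"
    unfolding tuple_inner_def by (intro sum.cong refl) (auto simp: edge_exp_def laplace_def)
  then show ?thesis using assms by simp
qed

text \<open>Vanishing Laplace transforms at the positive integers mean orthogonality to all sums of
  exponentials with integer rates, and these are dense.\<close>

lemma exp_span_total:
  assumes u: "tuple_L2 n Hm u" and z: "\<And>m k. 1 \<le> m \<Longrightarrow> k \<in> {1..n} \<Longrightarrow> laplace (u k) (real m) = 0"
  shows "tuple_norm2 n Hm u = 0"
proof -
  have ip0: "tuple_inner n Hm u e = 0" if "exp_span \<nat> e v" for e v
    using that
  proof induction
    case zero
    then show ?case by (simp add: tuple_inner_def)
  next
    case (step e v \<kappa> k b)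
    obtain m where m: "\<kappa> = real m" using step(2) by (auto elim: Nats_cases)
    have "tuple_inner n Hm u (edge_exp \<kappa> k) = 0" using z[of m k] step(3,4) m by (simp add: tuple_inner_edge_exp)
    then show ?case using step u conjunct1[OF exp_span_L2[OF step(1)]]
      by (simp add: tuple_inner_add_right tuple_L2_scale edge_exp_tuple_L2 tuple_inner_scale_right)
  qed
  have "tuple_norm2 n Hm u \<le> e" if e: "0 < e" for e
  proof (cases "tuple_norm2 n Hm u = 0")
    case False
    then have p: "tuple_norm2 n Hm u > 0" using tuple_norm2_nonneg[of n Hm u] by linarith
    obtain f v where f: "exp_span \<nat> f v" "tuple_norm2 n Hm (\<lambda>k x. u k x - f k x) < e" using exp_span_dense[OF u e] by blast
    have fL: "tuple_L2 n Hm f" using exp_span_L2[OF f(1)] by simp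
    have "tuple_inner n Hm u (\<lambda>k x. u k x - f k x) = of_real (tuple_norm2 n Hm u)"
      using u fL by (simp add: tuple_inner_diff_right ip0[OF f(1)] tuple_inner_self)
    then have "(tuple_norm2 n Hm u)^2 \<le> tuple_norm2 n Hm u * tuple_norm2 n Hm (\<lambda>k x. u k x - f k x)"
      using tuple_inner_Cauchy_Schwarz[OF u tuple_L2_diff[OF u fL]] by simp
    then have "tuple_norm2 n Hm u \<le> tuple_norm2 n Hm (\<lambda>k x. u k x - f k x)" using p by (simp add: power2_eq_square)
    then show ?thesis using f(2) by simp
  qed (use e in simp)
  then show ?thesis using tuple_norm2_nonneg[of n Hm u] by (meson dense_ge antisym)
qed

text \<open>The function is placed on edge 1 of a tuple that vanishes elsewhere, so that the density
  of exponentials in the tuple space applies.\<close>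

lemma laplace_unique:
  assumes f: "L2 HL f" and z: "\<And>m. 1 \<le> m \<Longrightarrow> laplace f (real m) = 0"
  shows "AE x in HL. f x = 0"
proof -
  define u :: "nat \<Rightarrow> real \<Rightarrow> complex" where "u = (\<lambda>k x. if k = 1 then f x else 0)"
  have "L2 HL (u k)" for k by (cases "k = 1") (use f in \<open>simp_all add: u_def\<close>)
  then have "tuple_L2 n Hm u" by (simp add: tuple_L2_def)
  moreover have "laplace (u k) (real m) = 0" if "1 \<le> m" for m k
    using z[OF that] by (cases "k = 1") (simp_all add: u_def laplace_def)
  ultimately have "tuple_norm2 n Hm u = 0" by (rule exp_span_total)
  moreover have "(LINT x|HL. (cmod (u 1 x))^2) \<le> tuple_norm2 n Hm u"
    unfolding tuple_norm2_def by (rule member_le_sum) (use n1 in auto)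
  ultimately have "(LINT x|HL. (cmod (f x))^2) \<le> 0" by (simp add: u_def)
  moreover have "0 \<le> (LINT x|HL. (cmod (f x))^2)" by simp
  ultimately have "(LINT x|HL. (cmod (f x))^2) = 0" by (rule antisym)
  then have "AE x in HL. (cmod (f x))^2 = 0"
    by (subst (asm) integral_nonneg_eq_0_iff_AE) (use L2_integrable[OF f] in auto)
  then show ?thesis by eventually_elim simp
qed

text \<open>The equation is the Laplace transform of u'' = h with boundary data b and d, and the
  twofold primitive of h with these data satisfies it too. That primitive may grow, so uniqueness is
  applied after damping.\<close>

lemma edge_regular:
  assumes u: "L2 HL u" and h: "L2 HL h"
    and eq: "\<And>m. 1 \<le> m \<Longrightarrow> of_real (real m)^2 * laplace u (real m) = of_real (real m) * b + d + laplace h (real m)"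
  shows "AE x in HL. b + primitive (\<lambda>y. d + primitive h y) x = u x"
proof -
  define dv where "dv = (\<lambda>x. d + primitive h x)"
  define v where "v = (\<lambda>x. b + primitive dv x)"
  have ex: "exp_weighted \<kappa> h" if "0 < \<kappa>" for \<kappa> using exp_weighted_L2[OF h that] .
  have dvc: "continuous_on S dv" for S
    unfolding dv_def by (intro continuous_intros primitive_continuous[OF ex[of 1]]) auto
  have dvm: "dv \<in> borel_measurable HL" by (rule HL_measurable_continuous[OF dvc])
  have bnd: "norm (p + primitive f x) \<le> (norm p + (LINT x|HL. norm (f x) * exp (- \<kappa> * x))) * exp (\<kappa> * x)"
    if "0 < x" "0 < \<kappa>" "exp_weighted \<kappa> f" for p f x \<kappa>
  proof -
    have "norm (p + primitive f x) \<le> norm p + norm (primitive f x)" by (rule norm_triangle_ineq)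
    also have "norm p \<le> norm p * exp (\<kappa> * x)" using that by (simp add: mult_le_cancel_left1)
    also have "norm (primitive f x) \<le> (LINT x|HL. norm (f x) * exp (- \<kappa> * x)) * exp (\<kappa> * x)" by (rule primitive_bound[OF that(3,2)])
    finally show ?thesis by (simp add: distrib_right)
  qed
  \<comment> \<open>Rates are fixed below 1: \<open>dv\<close> grows at most like exp (x / 4) and v
    at most like exp (x / 2).\<close>
  have dvex: "exp_weighted \<kappa> dv" if "1/2 \<le> \<kappa>" for \<kappa>
    by (rule exp_weighted_bounded[OF dvm, where \<mu>="1/4"]) (unfold dv_def, rule bnd[OF _ _ ex], use that in auto)
  define C where "C = norm b + (LINT x|HL. norm (dv x) * exp (- (1/2) * x))"
  have vb: "norm (v x) \<le> C * exp (1/2 * x)" if "0 < x" for x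
    unfolding v_def C_def by (rule bnd[OF that _ dvex]) auto
  have vc: "continuous_on S v" for S
    unfolding v_def by (intro continuous_intros primitive_continuous[OF dvex[of 1]]) auto
  have vm: "v \<in> borel_measurable HL" by (rule HL_measurable_continuous[OF vc])
  have vex: "exp_weighted \<kappa> v" if "1 \<le> \<kappa>" for \<kappa>
    by (rule exp_weighted_bounded[OF vm vb]) (use that in auto)
  have uex: "exp_weighted \<kappa> u" if "1 \<le> \<kappa>" for \<kappa> using exp_weighted_L2[OF u, of \<kappa>] that by simp
  have vlap: "of_real (real m)^2 * laplace v (real m) = of_real (real m) * b + d + laplace h (real m)" if "1 \<le> m" for m
  proof -
    have "of_real (real m) * laplace v (real m) = b + laplace dv (real m)"
      unfolding v_def using that by (intro laplace_primitive dvex) auto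
    moreover have "of_real (real m) * laplace dv (real m) = d + laplace h (real m)"
      unfolding dv_def using that by (intro laplace_primitive ex) auto
    ultimately show ?thesis by (simp add: power2_eq_square mult.assoc distrib_left)
  qed
  have same: "laplace u (real m) = laplace v (real m)" if "1 \<le> m" for m
  proof -
    have "of_real (real m)^2 * laplace u (real m) = of_real (real m)^2 * laplace v (real m)"
      by (simp only: eq[OF that] vlap[OF that])
    then show ?thesis using that by simp
  qed
  \<comment> \<open>Damping by exp (-x) puts both u and v into L2 and shifts the argument of the
    transform by one, so that it stays an integer.\<close>
  define f where "f = (\<lambda>x. (u x - v x) * of_real (exp (- 1 * x)))"
  have em: "(\<lambda>x. complex_of_real (exp (- 1 * x))) \<in> borel_measurable HL" by (rule borel_imp_lebesgue_on) measurable
  have um: "u \<in> borel_measurable HL" using u by (simp add: L2_def)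
  have "L2 HL (\<lambda>x. u x * of_real (exp (- 1 * x)))"
  proof (rule L2_bound[OF _ L2_integrable[OF u]])
    show "(\<lambda>x. u x * of_real (exp (- 1 * x))) \<in> borel_measurable HL" by (intro borel_measurable_times um em)
    fix x assume "x \<in> space HL"
    then have "norm (u x) * exp (- 1 * x) \<le> norm (u x)" by (simp add: mult_left_le)
    then show "(cmod (u x * of_real (exp (- 1 * x))))^2 \<le> (cmod (u x))^2" by (intro power_mono) (auto simp: norm_mult)
  qed
  moreover have "L2 HL (\<lambda>x. v x * of_real (exp (- 1 * x)))"
  proof (rule L2_bound)
    show "(\<lambda>x. v x * of_real (exp (- 1 * x))) \<in> borel_measurable HL" by (intro borel_measurable_times vm em)
    show "integrable HL (\<lambda>x. C^2 * exp (- 1 * x))" by (intro integrable_mult_right exp_integrable) simp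
    fix x assume "x \<in> space HL"
    then have "norm (v x) * exp (- 1 * x) \<le> C * exp (1/2 * x) * exp (- 1 * x)" using vb[of x] by (intro mult_right_mono) auto
    also have "\<dots> = C * exp (- (1/2) * x)" by (simp add: mult.assoc exp_add[symmetric])
    finally have "(norm (v x) * exp (- 1 * x))^2 \<le> (C * exp (- (1/2) * x))^2" by (intro power_mono) auto
    also have "\<dots> = C^2 * exp (- 1 * x)" by (simp add: power_mult_distrib exp_double[symmetric])
    finally show "(cmod (v x * of_real (exp (- 1 * x))))^2 \<le> C^2 * exp (- 1 * x)" by (simp add: norm_mult)
  qed
  ultimately have fL: "L2 HL f" unfolding f_def left_diff_distrib by (rule L2_diff)
  have "laplace f (real m) = 0" if "1 \<le> m" for m
  proof -
    have "laplace f (real m) = laplace (\<lambda>x. u x - v x) (real (Suc m))"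
      unfolding laplace_def f_def
      by (intro Bochner_Integration.integral_cong refl) (simp add: exp_add[symmetric] algebra_simps flip: of_real_mult)
    also have "\<dots> = 0" using same[of "Suc m"] by (subst laplace_diff[OF uex vex]) auto
    finally show ?thesis .
  qed
  from laplace_unique[OF fL this] have "AE x in HL. f x = 0" .
  then have "AE x in HL. v x = u x" by eventually_elim (auto simp: f_def)
  then show ?thesis by (simp add: v_def dv_def)
qed

text \<open>Each weak derivative is replaced by a primitive with its boundary value, and each
  primitive divides the transform by \<kappa>. All positive \<kappa> are treated because the
  resolvent evaluates the identity at the rates \<open>\<tau> t l\<close>, which need not be
  integers.\<close>

lemma A_rel_imp_laplace:
  assumes "A_rel n c a u w"
  shows "tuple_L2 n Hm u \<and> tuple_L2 n Hm w \<and> (\<exists>b d. (\<Sum>k\<in>{1..n}. of_real (c k) * d k) = 0 \<and>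
    (\<forall>k\<in>{1..n}. \<forall>\<kappa>>0. of_real (c k) * (of_real \<kappa>^2 * laplace (u k) \<kappa> - of_real \<kappa> * b - d k)
       = of_real (a k) * laplace (u k) \<kappa> - laplace (w k) \<kappa>))"
proof -
  from assms obtain g h v dv where A': "\<forall>k\<in>{1..n}. L2 HL (u k) \<and> L2 HL (g k) \<and> L2 HL (h k) \<and>
         weak_deriv (u k) (g k) \<and> weak_deriv (g k) (h k) \<and>
         continuous_on {0..} (v k) \<and> continuous_on {0..} (dv k) \<and>
         (AE x in HL. v k x = u k x) \<and> (AE x in HL. dv k x = g k x) \<and>
         (AE x in HL. w k x = - complex_of_real (c k) * h k x + complex_of_real (a k) * u k x)"
    and B': "\<forall>i\<in>{1..n}. \<forall>k\<in>{1..n}. v i 0 = v k 0"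
    and D: "(\<Sum>k\<in>{1..n}. complex_of_real (c k) * dv k 0) = 0"
    unfolding A_rel_def by (elim exE conjE) (rule that)
  note A = bspec[OF A'] and B = bspec[OF bspec[OF B']]
  have 1: "1 \<in> {1..n}" using n1 by simp
  have wae: "AE x in HL. - complex_of_real (c k) * h k x + complex_of_real (a k) * u k x = w k x" if "k \<in> {1..n}" for k
    using conjunct2[OF conjunct2[OF conjunct2[OF conjunct2[OF conjunct2[OF conjunct2[OF conjunct2[OF conjunct2[OF conjunct2[OF A[OF that]]]]]]]]]]
    by eventually_elim simp
  have whL: "L2 HL (\<lambda>x. - complex_of_real (c k) * h k x + complex_of_real (a k) * u k x)" if "k \<in> {1..n}" for k
    using A[OF that] by (intro L2_add L2_scale) auto
  have wm: "w k \<in> borel_measurable HL" if "k \<in> {1..n}" for k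
    by (rule measurable_HL_AE[OF L2_measurable[OF whL[OF that]] wae[OF that]])
  have wL: "L2 HL (w k)" if k: "k \<in> {1..n}" for k
  proof (rule L2_cong_AE[OF whL[OF k] wm[OF k]])
    show "AE x in HL. w k x = - complex_of_real (c k) * h k x + complex_of_real (a k) * u k x"
      using wae[OF k] by eventually_elim simp
  qed
  show ?thesis
  proof (intro conjI exI[of _ "\<lambda>k. dv k 0"] exI[of _ "v 1 0"] ballI allI impI)
    show "tuple_L2 n Hm u" using A by (simp add: tuple_L2_def)
    show "tuple_L2 n Hm w" using wL by (simp add: tuple_L2_def)
    show "(\<Sum>k\<in>{1..n}. complex_of_real (c k) * dv k 0) = 0" by (rule D)
    fix k and \<kappa> :: real assume k: "k \<in> {1..n}" and \<kappa>: "0 < \<kappa>"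
    have uL: "L2 HL (u k)" and gL: "L2 HL (g k)" and hL: "L2 HL (h k)"
      and ug: "weak_deriv (u k) (g k)" and gh: "weak_deriv (g k) (h k)"
      and vc: "continuous_on {0..} (v k)" and dvc: "continuous_on {0..} (dv k)"
      and vu: "AE x in HL. v k x = u k x" and dvg: "AE x in HL. dv k x = g k x"
      using A[OF k] by auto
    note m = L2_measurable[OF uL] L2_measurable[OF gL] L2_measurable[OF hL] HL_measurable_continuous[OF vc] HL_measurable_continuous[OF dvc]
    have "laplace (u k) \<kappa> = laplace (v k) \<kappa>" by (rule laplace_cong_AE[symmetric, OF vu m(4,1)])
    also have "\<dots> = laplace (\<lambda>x. v k 0 + primitive (g k) x) \<kappa>"
      by (rule laplace_cong) (rule weak_deriv_rep[OF uL gL ug vc vu less_imp_le])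
    finally have "of_real \<kappa> * laplace (u k) \<kappa> = v k 0 + laplace (g k) \<kappa>"
      using laplace_primitive[OF exp_weighted_L2[OF gL \<kappa>] \<kappa>] by simp
    moreover have "laplace (g k) \<kappa> = laplace (dv k) \<kappa>" by (rule laplace_cong_AE[symmetric, OF dvg m(5,2)])
    moreover have "\<dots> = laplace (\<lambda>x. dv k 0 + primitive (h k) x) \<kappa>"
      by (rule laplace_cong) (rule weak_deriv_rep[OF gL hL gh dvc dvg less_imp_le])
    moreover have "of_real \<kappa> * laplace (\<lambda>x. dv k 0 + primitive (h k) x) \<kappa> = dv k 0 + laplace (h k) \<kappa>"
      by (rule laplace_primitive[OF exp_weighted_L2[OF hL \<kappa>] \<kappa>])
    ultimately have "of_real \<kappa>^2 * laplace (u k) \<kappa> = of_real \<kappa> * v 1 0 + dv k 0 + laplace (h k) \<kappa>"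
      using B[OF k 1] by (simp add: power2_eq_square mult.assoc distrib_left)
    moreover have "laplace (w k) \<kappa> = - of_real (c k) * laplace (h k) \<kappa> + of_real (a k) * laplace (u k) \<kappa>"
    proof -
      have e: "exp_weighted \<kappa> (\<lambda>x. - of_real (c k) * h k x)" "exp_weighted \<kappa> (\<lambda>x. of_real (a k) * u k x)"
        by (intro exp_weighted_scale exp_weighted_L2 hL uL \<kappa>)+
      show ?thesis
        using laplace_cong_AE[OF wae[OF k] L2_measurable[OF whL[OF k]] wm[OF k], of \<kappa>]
        unfolding laplace_add[OF e] laplace_scale by (rule sym)
    qed
    ultimately show "of_real (c k) * (of_real \<kappa>^2 * laplace (u k) \<kappa> - of_real \<kappa> * v 1 0 - dv k 0) = of_real (a k) * laplace (u k) \<kappa> - laplace (w k) \<kappa>"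
      by (simp add: algebra_simps)
  qed
qed

text \<open>The second derivative is read off from the differential equation and integrated twice
  from the data d and b. The result represents u by \<open>edge_regular\<close>, and its first
  derivative is square integrable by \<open>L2_deriv\<close>.\<close>

lemma laplace_imp_A_rel:
  assumes u: "tuple_L2 n Hm u" and w: "tuple_L2 n Hm w" and D: "(\<Sum>k\<in>{1..n}. of_real (c k) * d k) = 0"
    and eq: "\<And>k m. k \<in> {1..n} \<Longrightarrow> 1 \<le> m \<Longrightarrow> of_real (c k) * (of_real (real m)^2 * laplace (u k) (real m) - of_real (real m) * b - d k)
       = of_real (a k) * laplace (u k) (real m) - laplace (w k) (real m)"
  shows "A_rel n c a u w"
proof -
  define h where "h = (\<lambda>k x. of_real (a k / c k) * u k x - of_real (1 / c k) * w k x)"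
  define dv where "dv = (\<lambda>k x. d k + primitive (h k) x)"
  define v where "v = (\<lambda>k x. b + primitive (dv k) x)"
  show ?thesis unfolding A_rel_def
  proof (rule exI[of _ dv], rule exI[of _ h], rule exI[of _ v], rule exI[of _ dv], intro conjI ballI)
    fix k assume k: "k \<in> {1..n}"
    have ck: "c k > 0" using c_pos[OF k] .
    have uL: "L2 HL (u k)" and wL: "L2 HL (w k)" using u w k by (auto simp: tuple_L2_def)
    show "L2 HL (u k)" by (rule uL)
    show hL: "L2 HL (h k)" unfolding h_def by (intro L2_diff L2_scale uL wL)
    have ex: "exp_weighted \<kappa> (h k)" if "0 < \<kappa>" for \<kappa> using exp_weighted_L2[OF hL that] .
    have vu: "AE x in HL. v k x = u k x"
      unfolding v_def dv_def
    proof (rule edge_regular[OF uL hL])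
      fix m :: nat assume m: "1 \<le> m"
      then have e: "exp_weighted (real m) (\<lambda>x. of_real (a k / c k) * u k x)" "exp_weighted (real m) (\<lambda>x. of_real (1 / c k) * w k x)"
        by (intro exp_weighted_scale exp_weighted_L2 uL wL, simp)+
      have "laplace (h k) (real m) = of_real (a k / c k) * laplace (u k) (real m) - of_real (1 / c k) * laplace (w k) (real m)"
        unfolding h_def by (simp only: laplace_diff[OF e] laplace_scale)
      then have "of_real (c k) * laplace (h k) (real m) = of_real (a k) * laplace (u k) (real m) - laplace (w k) (real m)"
        using ck by (simp add: right_diff_distrib)
      then have "of_real (c k) * (of_real (real m)^2 * laplace (u k) (real m) - of_real (real m) * b - d k) = of_real (c k) * laplace (h k) (real m)"
        using eq[OF k m] by simp
      then have "of_real (real m)^2 * laplace (u k) (real m) - of_real (real m) * b - d k = laplace (h k) (real m)" using ck by simp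
      then show "of_real (real m)^2 * laplace (u k) (real m) = of_real (real m) * b + d k + laplace (h k) (real m)" by (simp add: algebra_simps)
    qed
    then show "AE x in HL. v k x = u k x" .
    have dvc: "continuous_on S (dv k)" for S
      unfolding dv_def by (intro continuous_intros primitive_continuous[OF ex[of 1]]) auto
    then show "continuous_on {0..} (dv k)" .
    have dvm: "dv k \<in> borel_measurable HL" by (rule HL_measurable_continuous[OF dvc])
    have dvb: "norm (dv k x) \<le> (norm (d k) + (LINT x|HL. norm (h k x) * exp (- (1/2) * x))) * exp (1/2 * x)" if "0 < x" for x
    proof -
      have "norm (dv k x) \<le> norm (d k) + norm (primitive (h k) x)" unfolding dv_def by (rule norm_triangle_ineq)
      also have "norm (d k) \<le> norm (d k) * exp (1/2 * x)" using that by (simp add: mult_le_cancel_left1)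
      also have "norm (primitive (h k) x) \<le> (LINT x|HL. norm (h k x) * exp (- (1/2) * x)) * exp (1/2 * x)" by (rule primitive_bound[OF ex]) auto
      finally show ?thesis by (simp add: distrib_right)
    qed
    have dvex: "exp_weighted 1 (dv k)" by (rule exp_weighted_bounded[OF dvm dvb]) auto
    show vc: "continuous_on {0..} (v k)"
      unfolding v_def by (intro continuous_intros primitive_continuous[OF dvex]) auto
    have "L2 HL (v k)" by (rule L2_cong_AE[OF uL HL_measurable_continuous[OF vc] vu])
    then show "L2 HL (dv k)" using L2_deriv[OF hL] unfolding v_def dv_def by blast
    have vu': "AE x in HL. u k x = b + primitive (dv k) x" using vu unfolding v_def by eventually_elim simp
    show "weak_deriv (u k) (dv k)"
      by (rule weak_deriv_primitive[OF dvex L2_measurable[OF uL] vu'])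
    show "weak_deriv (dv k) (h k)"
    proof (rule weak_deriv_primitive[OF ex[of 1] dvm])
      show "AE x in HL. dv k x = d k + primitive (h k) x" by (simp add: dv_def)
    qed simp
    show "AE x in HL. dv k x = dv k x" by simp
    show "AE x in HL. w k x = - complex_of_real (c k) * h k x + complex_of_real (a k) * u k x"
      by (rule AE_I2) (use ck in \<open>simp add: h_def algebra_simps\<close>)
  next
    show "v i 0 = v k 0" for i k by (simp add: v_def primitive_0)
    show "(\<Sum>k\<in>{1..n}. complex_of_real (c k) * dv k 0) = 0" using D by (simp add: dv_def primitive_0)
  qed
qed

end

section \<open>The resolvent on exponentials\<close>

context star begin

definition nonresonant :: "real \<Rightarrow> bool" where
  "nonresonant t \<longleftrightarrow> 0 < t \<and> (\<forall>k\<in>{1..n}. \<forall>m::nat. c k * (real m)^2 \<noteq> a k + t)"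

text \<open>Countably many resonances cannot fill an interval. Arbitrarily large values serve the
  limit of the Yosida approximations.\<close>

lemma nonresonant_exists: "\<exists>t>T. nonresonant t"
proof -
  define C where "C = (\<lambda>(k, m::nat). c k * (real m)^2 - a k) ` ({1..n} \<times> UNIV)"
  have "countable C" unfolding C_def by (intro countable_image countable_SIGMA) auto
  moreover have "uncountable {max T 0<..<max T 0 + 1}" by (simp add: uncountable_open_interval)
  ultimately have "\<not> {max T 0<..<max T 0 + 1} \<subseteq> C" using countable_subset by blast
  then obtain t where "t \<in> {max T 0<..<max T 0 + 1}" and tC: "t \<notin> C" by blast
  then have t: "max T 0 < t" "t \<notin> C" by simp_all
  have "nonresonant t"
    unfolding nonresonant_def
  proof (intro conjI ballI allI notI)
    fix k and m :: nat assume "k \<in> {1..n}" "c k * (real m)^2 = a k + t"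
    then have "t \<in> C" unfolding C_def by (intro image_eqI[of _ _ "(k, m)"]) auto
    then show False using t by simp
  qed (use t in simp)
  then show ?thesis using t by auto
qed

text \<open>Decay rate of the homogeneous solutions at the spectral parameter -t, that is, the root
  \<open>Z k (- t)\<close>; accordingly \<open>W\<tau> t\<close> is the value of \<open>W\<close> at
  -t.\<close>

definition \<tau> :: "real \<Rightarrow> nat \<Rightarrow> real" where "\<tau> t k = sqrt ((a k + t) / c k)"

definition W\<tau> :: "real \<Rightarrow> real" where "W\<tau> t = (\<Sum>k\<in>{1..n}. c k * \<tau> t k)"

definition res_p :: "real \<Rightarrow> nat \<Rightarrow> nat \<Rightarrow> real" where "res_p t m k = 1 / (a k + t - c k * (real m)^2)"

text \<open>Common vertex value \<beta> of the resolvent of exp (-m x) on edge k. Continuity gives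
  the homogeneous solutions the coefficient \<beta> - p on edge k and \<beta> elsewhere, with p the
  coefficient of the particular solution; then the Kirchhoff condition reads W\<tau> \<beta> = c_k p
  (\<tau>_k - m).\<close>

definition res_beta :: "real \<Rightarrow> nat \<Rightarrow> nat \<Rightarrow> real" where "res_beta t m k = c k * res_p t m k * (\<tau> t k - real m) / W\<tau> t"

definition res_alpha :: "real \<Rightarrow> nat \<Rightarrow> nat \<Rightarrow> nat \<Rightarrow> real" where "res_alpha t m k l = res_beta t m k - (if l = k then res_p t m k else 0)"

lemma \<tau>_pos: "nonresonant t \<Longrightarrow> k \<in> {1..n} \<Longrightarrow> 0 < \<tau> t k"
  using c_pos[of k] a_nonneg[of k] by (simp add: \<tau>_def nonresonant_def add_nonneg_pos)

lemma \<tau>_sq: "nonresonant t \<Longrightarrow> k \<in> {1..n} \<Longrightarrow> c k * (\<tau> t k)^2 = a k + t"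
  using c_pos[of k] a_nonneg[of k] by (simp add: \<tau>_def nonresonant_def)

lemma W\<tau>_pos: "nonresonant t \<Longrightarrow> 0 < W\<tau> t"
  unfolding W\<tau>_def by (intro sum_pos) (use n1 in \<open>auto intro!: mult_pos_pos c_pos \<tau>_pos\<close>)

lemma res_p_nz: "nonresonant t \<Longrightarrow> k \<in> {1..n} \<Longrightarrow> a k + t - c k * (real m)^2 \<noteq> 0"
  unfolding nonresonant_def by (metis eq_iff_diff_eq_0)

lemma res_p_inverse: assumes "nonresonant t" "k \<in> {1..n}"
  shows "complex_of_real (res_p t m k) * of_real (a k + t - c k * (real m)^2) = 1"
proof -
  have "res_p t m k * (a k + t - c k * (real m)^2) = 1" using res_p_nz[OF assms, of m] by (simp add: res_p_def)
  then show ?thesis by (simp only: of_real_mult[symmetric] of_real_1)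
qed

lemma res_beta_W: assumes "nonresonant t"
  shows "complex_of_real (res_beta t m k) * of_real (W\<tau> t) = of_real (c k) * of_real (res_p t m k) * of_real (\<tau> t k - real m)"
proof -
  have "res_beta t m k * W\<tau> t = c k * res_p t m k * (\<tau> t k - real m)" using W\<tau>_pos[OF assms] by (simp add: res_beta_def)
  then show ?thesis by (simp only: of_real_mult[symmetric])
qed

text \<open>With z the conjugate root, the left factor is c_k (\<kappa> + z) (\<kappa> - z), which
  clears the denominator. The right side collects the boundary terms of two integrations by parts.
  For \<kappa> = \<tau> t k the left factor is lam + t.\<close>

lemma edge_exp_transform_shift:
  assumes k: "k \<in> {1..n}" and j: "j \<in> {1..n}" and lam: "a j < lam" and \<kappa>: "0 < \<kappa>"
  shows "of_real (lam - a k + c k * \<kappa>^2) * vv \<kappa> k j lam =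
    of_real (c k) * (of_real \<kappa> - cnj (Z k lam)) + (if j = k then cnj (W lam) else 0)"
proof -
  define z where "z = cnj (Z k lam)"
  have ck: "c k \<noteq> 0" using c_pos[OF k] by simp
  have nz: "of_real \<kappa> + z \<noteq> 0" "of_real \<kappa> + cnj z \<noteq> 0" using zeta_nz[OF \<kappa>, of k lam] by (auto simp: z_def)
  have "of_real (c k) * z^2 = of_real (a k - lam)"
    using arg_cong[OF zeta_sq[OF k, of lam], of cnj] by (simp add: z_def)
  then have L: "of_real (lam - a k + c k * \<kappa>^2) = of_real (c k) * (of_real \<kappa> + z) * (of_real \<kappa> - z)"
    by (simp add: algebra_simps power2_eq_square)
  show ?thesis
  proof (cases "j = k")
    case False
    then show ?thesis unfolding L edge_exp_transform_def z_def[symmetric] using nz by simp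
  next
    case True
    have "Re (Z k lam) = 0" using Im_zeta_pos[OF j lam] True by simp
    then have "Z k lam = - z" "cnj z = - z" by (simp_all add: z_def complex_eq_iff)
    note zz = this
    define K where "K = complex_of_real \<kappa>"
    define w where "w = cnj (W lam)"
    define y where "y = w / (of_real (c k) * (K - z))"
    have nz': "K + z \<noteq> 0" "K - z \<noteq> 0" using nz zz by (auto simp: K_def)
    have v: "vv \<kappa> k j lam = (1 + y) / (K + z)"
      using True by (simp add: edge_exp_transform_def z_def[symmetric] zz y_def w_def K_def)
    have "of_real (c k) * (K + z) * (K - z) * ((1 + y) / (K + z)) = of_real (c k) * (K - z) * (1 + y)"
      using nz' by simp
    also have "\<dots> = of_real (c k) * (K - z) + w"
      using nz' ck by (simp add: distrib_left y_def)
    finally show ?thesis unfolding L v using True by (simp add: K_def w_def z_def)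
  qed
qed

text \<open>The resolvent $(A + t)^{-1}$ applied to $e^{-mx}$ on the edge $k$: a particular solution there plus multiples of the decaying solutions $e^{-\<tau>_l x}$ fixed by the vertex conditions.\<close>
definition res_exp :: "real \<Rightarrow> nat \<Rightarrow> nat \<Rightarrow> nat \<Rightarrow> real \<Rightarrow> complex" where
  "res_exp t m k = (\<lambda>j x. of_real (res_p t m k) * edge_exp (real m) k j x + (\<Sum>l\<in>{1..n}. of_real (res_alpha t m k l) * edge_exp (\<tau> t l) l j x))"

definition res_transform :: "real \<Rightarrow> nat \<Rightarrow> nat \<Rightarrow> nat \<Rightarrow> real \<Rightarrow> complex" where
  "res_transform t m k = (\<lambda>j x. of_real (res_p t m k) * vv (real m) k j x + (\<Sum>l\<in>{1..n}. of_real (res_alpha t m k l) * vv (\<tau> t l) l j x))"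

lemma exp_span_res: assumes t: "nonresonant t" and m: "1 \<le> m" and k: "k \<in> {1..n}" shows "exp_span {0<..} (res_exp t m k) (res_transform t m k)"
  unfolding res_exp_def res_transform_def
  by (intro exp_span_add exp_span_sum exp_span_scale exp_span_single) (use m k \<tau>_pos[OF t] in auto)

text \<open>Multiplication by lam + t makes the transforms of the homogeneous solutions affine in
  the conjugate roots. Summed over the edges, these roots add up to the conjugate of W and cancel
  against the correction at l = j; the rest is the defining relation of
  \<open>res_beta\<close>.\<close>

lemma res_transform_eq:
  assumes t: "nonresonant t" and m: "1 \<le> m" and k: "k \<in> {1..n}" and j: "j \<in> {1..n}" and lam: "a j < lam"
  shows "res_transform t m k j lam = vv (real m) k j lam / of_real (lam + t)"
proof -
  have lt: "lam + t > 0" using lam a_nonneg[OF j] t by (simp add: nonresonant_def)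
  define p where "p = complex_of_real (res_p t m k)"
  define b where "b = complex_of_real (res_beta t m k)"
  define v where "v = vv (real m) k j lam"
  define Wb where "Wb = cnj (W lam)"
  define q where "q = complex_of_real (a k + t - c k * (real m)^2)"
  have pq: "p * q = 1" unfolding p_def q_def by (rule res_p_inverse[OF t k])
  have bW: "b * of_real (W\<tau> t) = of_real (c k) * p * of_real (\<tau> t k - real m)"
    unfolding b_def p_def by (rule res_beta_W[OF t])
  define X where "X = (\<lambda>l. of_real (c l) * (of_real (\<tau> t l) - cnj (Z l lam)) + (if j = l then Wb else 0))"
  have X: "of_real (lam + t) * vv (\<tau> t l) l j lam = X l" if l: "l \<in> {1..n}" for l
    using edge_exp_transform_shift[OF l j lam \<tau>_pos[OF t l]] \<tau>_sq[OF t l] by (simp add: X_def Wb_def add.commute)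
  have v: "of_real (lam + t) * v = of_real (c k) * (of_real (real m) - cnj (Z k lam)) + (if j = k then Wb else 0) + q * v"
  proof -
    have "of_real (lam + t) * v = of_real (lam - a k + c k * (real m)^2) * v + q * v"
      unfolding q_def by (simp add: algebra_simps)
    then show ?thesis unfolding v_def Wb_def using edge_exp_transform_shift[OF k j lam, of "real m"] m by simp
  qed
  \<comment> \<open>The conjugate roots cancel here, leaving a quantity that depends neither on lam
    nor on j.\<close>
  have SX: "(\<Sum>l\<in>{1..n}. X l) = of_real (W\<tau> t)"
  proof -
    have "(\<Sum>l\<in>{1..n}. of_real (c l) * cnj (Z l lam)) = Wb" by (simp add: Wb_def zeta_sum_def)
    then show ?thesis unfolding X_def sum.distrib right_diff_distrib sum_subtractf using j by (simp add: W\<tau>_def)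
  qed
  have "of_real (lam + t) * res_transform t m k j lam = p * (of_real (lam + t) * v) + (\<Sum>l\<in>{1..n}. of_real (res_alpha t m k l) * (of_real (lam + t) * vv (\<tau> t l) l j lam))"
    unfolding res_transform_def p_def v_def by (simp add: distrib_left sum_distrib_left mult.left_commute)
  also have "(\<Sum>l\<in>{1..n}. of_real (res_alpha t m k l) * (of_real (lam + t) * vv (\<tau> t l) l j lam)) = (\<Sum>l\<in>{1..n}. b * X l - (if l = k then p * X l else 0))"
  proof (intro sum.cong refl)
    fix l assume l: "l \<in> {1..n}"
    show "of_real (res_alpha t m k l) * (of_real (lam + t) * vv (\<tau> t l) l j lam) = b * X l - (if l = k then p * X l else 0)"
      unfolding X[OF l] by (simp add: res_alpha_def b_def p_def left_diff_distrib)
  qed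
  also have "\<dots> = b * of_real (W\<tau> t) - p * X k"
    unfolding sum_subtractf sum_distrib_left[symmetric] SX using k by simp
  finally have "of_real (lam + t) * res_transform t m k j lam = (p * q) * v"
    unfolding v bW X_def by (simp add: algebra_simps)
  then show ?thesis using lt pq by (simp add: v_def field_simps del: of_real_add)
qed

text \<open>The Laplace transform at m, on edge k, of (A + t)^(-1) f, with the resolvent moved onto
  the exponential by symmetry. In this way the resolvent of a general f is described through Laplace
  transforms of f.\<close>

definition res_laplace :: "real \<Rightarrow> (nat \<Rightarrow> real \<Rightarrow> complex) \<Rightarrow> nat \<Rightarrow> nat \<Rightarrow> complex" where
  "res_laplace t f m k = of_real (res_p t m k) * laplace (f k) (real m) + (\<Sum>l\<in>{1..n}. of_real (res_alpha t m k l) * laplace (f l) (\<tau> t l))"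

lemma tuple_inner_sum_right:
  assumes "finite I" "\<And>i. i \<in> I \<Longrightarrow> tuple_L2 n M (e i)" "tuple_L2 n M f"
  shows "tuple_L2 n M (\<lambda>k x. \<Sum>i\<in>I. e i k x) \<and> tuple_inner n M f (\<lambda>k x. \<Sum>i\<in>I. e i k x) = (\<Sum>i\<in>I. tuple_inner n M f (e i))"
  using assms
proof (induction I rule: finite_induct)
  case empty
  then show ?case by (simp add: tuple_inner_def)
next
  case (insert i I)
  then show ?case by (simp add: tuple_L2_add tuple_inner_add_right)
qed

lemma tuple_inner_res_exp:
  assumes t: "nonresonant t" and m: "1 \<le> m" and k: "k \<in> {1..n}" and f: "tuple_L2 n Hm f"
  shows "tuple_inner n Hm f (res_exp t m k) = res_laplace t f m k"
proof -
  have L: "tuple_L2 n Hm (\<lambda>j x. of_real (res_alpha t m k l) * edge_exp (\<tau> t l) l j x)" if "l \<in> {1..n}" for l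
    using \<tau>_pos[OF t that] by (intro tuple_L2_scale edge_exp_tuple_L2)
  have L1: "tuple_L2 n Hm (\<lambda>j x. of_real (res_p t m k) * edge_exp (real m) k j x)"
    using m by (intro tuple_L2_scale edge_exp_tuple_L2) simp
  show ?thesis
    unfolding res_exp_def res_laplace_def
    using tuple_inner_sum_right[where I="{1..n}" and e="\<lambda>l j x. of_real (res_alpha t m k l) * edge_exp (\<tau> t l) l j x", OF finite_atLeastAtMost L f]
    by (simp add: tuple_inner_add_right[OF L1 _ f] tuple_inner_scale_right tuple_inner_edge_exp tuple_inner_edge_exp[OF k])
qed

lemma res_laplace_split:
  assumes "k \<in> {1..n}"
  shows "res_laplace t f m k = of_real (res_p t m k) * (laplace (f k) (real m) - laplace (f k) (\<tau> t k)) + of_real (res_beta t m k) * (\<Sum>l\<in>{1..n}. laplace (f l) (\<tau> t l))"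
proof -
  have "(\<Sum>l\<in>{1..n}. complex_of_real (res_alpha t m k l) * laplace (f l) (\<tau> t l)) = (\<Sum>l\<in>{1..n}. of_real (res_beta t m k) * laplace (f l) (\<tau> t l) - (if l = k then of_real (res_p t m k) * laplace (f l) (\<tau> t l) else 0))"
    by (intro sum.cong refl) (simp add: res_alpha_def left_diff_distrib)
  then show ?thesis unfolding res_laplace_def sum_subtractf sum_distrib_left[symmetric] using assms
    by (simp add: right_diff_distrib)
qed

lemma laplace_shifted:
  assumes u: "tuple_L2 n Hm u" and w: "tuple_L2 n Hm w" and k: "k \<in> {1..n}" and \<kappa>: "0 < \<kappa>"
  shows "laplace (\<lambda>x. w k x + of_real t * u k x) \<kappa> = laplace (w k) \<kappa> + of_real t * laplace (u k) \<kappa>"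
proof -
  have "exp_weighted \<kappa> (w k)" "exp_weighted \<kappa> (\<lambda>x. of_real t * u k x)"
    using u w k by (auto intro!: exp_weighted_scale exp_weighted_L2 \<kappa> simp: tuple_L2_def)
  from laplace_add[OF this] show ?thesis by (simp add: laplace_scale)
qed

text \<open>At the rate \<open>\<tau> t l\<close> the factor of the transform of u vanishes, so the
  transform of f there consists of boundary data alone. Summation over the edges removes d by the
  Kirchhoff condition and isolates b.\<close>

lemma A_rel_imp_res_laplace:
  assumes A: "A_rel n c a u w" and t: "nonresonant t" and m: "1 \<le> m" and k: "k \<in> {1..n}"
  shows "laplace (u k) (real m) = res_laplace t (\<lambda>k x. w k x + of_real t * u k x) m k"
proof -
  obtain b d where u: "tuple_L2 n Hm u" and w: "tuple_L2 n Hm w" and D: "(\<Sum>k\<in>{1..n}. of_real (c k) * d k) = 0"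
    and E': "\<forall>k\<in>{1..n}. \<forall>\<kappa>>0. of_real (c k) * (of_real \<kappa>^2 * laplace (u k) \<kappa> - of_real \<kappa> * b - d k)
       = of_real (a k) * laplace (u k) \<kappa> - laplace (w k) \<kappa>"
    using A_rel_imp_laplace[OF A] by (elim conjE exE) (rule that)
  note E = E'[rule_format]
  define f where "f = (\<lambda>k x. w k x + of_real t * u k x)"
  have f: "laplace (f k) \<kappa> = of_real (a k + t - c k * \<kappa>^2) * laplace (u k) \<kappa> + of_real (c k) * of_real \<kappa> * b + of_real (c k) * d k"
    if "k \<in> {1..n}" "0 < \<kappa>" for k \<kappa>
    unfolding f_def laplace_shifted[OF u w that] using E[OF that] by (simp add: algebra_simps)
  have f\<tau>: "laplace (f l) (\<tau> t l) = of_real (c l * \<tau> t l) * b + of_real (c l) * d l" if "l \<in> {1..n}" for l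
    using f[OF that \<tau>_pos[OF t that]] \<tau>_sq[OF t that] by simp
  have "(\<Sum>l\<in>{1..n}. laplace (f l) (\<tau> t l)) = (\<Sum>l\<in>{1..n}. of_real (c l * \<tau> t l)) * b + (\<Sum>l\<in>{1..n}. of_real (c l) * d l)"
    unfolding sum_distrib_right sum.distrib[symmetric] by (intro sum.cong refl f\<tau>)
  then have S: "(\<Sum>l\<in>{1..n}. laplace (f l) (\<tau> t l)) = of_real (W\<tau> t) * b" by (simp only: D W\<tau>_def of_real_sum add_0_right)
  define p where "p = complex_of_real (res_p t m k)"
  have p: "p * of_real (a k + t - c k * (real m)^2) = 1"
    unfolding p_def by (rule res_p_inverse[OF t k])
  have bW: "of_real (res_beta t m k) * of_real (W\<tau> t) = of_real (c k) * p * of_real (\<tau> t k - real m)"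
    unfolding p_def by (rule res_beta_W[OF t])
  have m0: "0 < real m" using m by simp
  have "res_laplace t f m k = p * (of_real (a k + t - c k * (real m)^2) * laplace (u k) (real m) + of_real (c k) * of_real (real m) * b + of_real (c k) * d k - (of_real (c k * \<tau> t k) * b + of_real (c k) * d k))
     + (of_real (res_beta t m k) * of_real (W\<tau> t)) * b"
    unfolding res_laplace_split[OF k] S f\<tau>[OF k] f[OF k m0] p_def by (simp add: mult.assoc)
  also have "\<dots> = (p * of_real (a k + t - c k * (real m)^2)) * laplace (u k) (real m)"
    unfolding bW by (simp add: algebra_simps)
  finally show ?thesis using p by (simp add: f_def)
qed

text \<open>The boundary data are recovered from the transforms at the rates
  \<open>\<tau> t l\<close>: b from their weighted sum, then each d. The choice of b is exactly what
  makes the Kirchhoff condition hold for d.\<close>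

lemma res_laplace_imp_A_rel:
  assumes u: "tuple_L2 n Hm u" and w: "tuple_L2 n Hm w" and t: "nonresonant t"
    and R: "\<And>m k. 1 \<le> m \<Longrightarrow> k \<in> {1..n} \<Longrightarrow> laplace (u k) (real m) = res_laplace t (\<lambda>k x. w k x + of_real t * u k x) m k"
  shows "A_rel n c a u w"
proof -
  define f where "f = (\<lambda>k x. w k x + of_real t * u k x)"
  define b where "b = (\<Sum>l\<in>{1..n}. laplace (f l) (\<tau> t l)) / of_real (W\<tau> t)"
  define d where "d = (\<lambda>k. (laplace (f k) (\<tau> t k) - of_real (c k * \<tau> t k) * b) / of_real (c k))"
  have W0: "complex_of_real (W\<tau> t) \<noteq> 0" using W\<tau>_pos[OF t] by simp
  have S: "(\<Sum>l\<in>{1..n}. laplace (f l) (\<tau> t l)) = of_real (W\<tau> t) * b" using W0 by (simp add: b_def)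
  have cd: "of_real (c k) * d k = laplace (f k) (\<tau> t k) - of_real (c k * \<tau> t k) * b" if "k \<in> {1..n}" for k
    using c_pos[OF that] by (simp add: d_def)
  show ?thesis
  proof (rule laplace_imp_A_rel[OF u w])
    have "(\<Sum>k\<in>{1..n}. of_real (c k) * d k) = (\<Sum>k\<in>{1..n}. laplace (f k) (\<tau> t k) - of_real (c k * \<tau> t k) * b)"
      by (intro sum.cong refl cd)
    also have "\<dots> = 0" unfolding sum_subtractf S by (simp add: W\<tau>_def sum_distrib_right)
    finally show "(\<Sum>k\<in>{1..n}. of_real (c k) * d k) = 0" .
    fix k and m :: nat assume k: "k \<in> {1..n}" and m: "1 \<le> m"
    define p where "p = complex_of_real (res_p t m k)"
    define q where "q = complex_of_real (a k + t - c k * (real m)^2)"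
    have pq: "q * p = 1" using res_p_inverse[OF t k, of m] unfolding p_def q_def by (simp only: mult.commute)
    have bW: "of_real (res_beta t m k) * of_real (W\<tau> t) = of_real (c k) * p * of_real (\<tau> t k - real m)"
      unfolding p_def by (rule res_beta_W[OF t])
    have m0: "0 < real m" using m by simp
    have E: "laplace (u k) (real m) = p * (laplace (f k) (real m) - laplace (f k) (\<tau> t k)) + of_real (c k) * p * of_real (\<tau> t k - real m) * b"
      using R[OF m k] unfolding f_def[symmetric] res_laplace_split[OF k] S mult.assoc[symmetric] bW p_def .
    have "q * laplace (u k) (real m) = (q * p) * (laplace (f k) (real m) - laplace (f k) (\<tau> t k) + of_real (c k) * of_real (\<tau> t k - real m) * b)"
      unfolding E by (simp add: algebra_simps)
    then have "q * laplace (u k) (real m) = laplace (f k) (real m) - laplace (f k) (\<tau> t k) + of_real (c k) * of_real (\<tau> t k - real m) * b"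
      unfolding pq by simp
    moreover have "laplace (f k) (real m) = laplace (w k) (real m) + of_real t * laplace (u k) (real m)"
      unfolding f_def by (rule laplace_shifted[OF u w k m0])
    ultimately have "of_real (c k) * of_real (real m)^2 * laplace (u k) (real m) - of_real (c k) * of_real (real m) * b - (laplace (f k) (\<tau> t k) - of_real (c k * \<tau> t k) * b)
       = of_real (a k) * laplace (u k) (real m) - laplace (w k) (real m)"
      unfolding q_def by (simp add: algebra_simps)
    then show "of_real (c k) * (of_real (real m)^2 * laplace (u k) (real m) - of_real (real m) * b - d k) = of_real (a k) * laplace (u k) (real m) - laplace (w k) (real m)"
      unfolding cd[OF k, symmetric] by (simp add: algebra_simps)
  qed
qed

end

section \<open>Domains of powers\<close>

lemma nn_dist_eq_tuple_norm2:
  assumes "tuple_L2 n M (\<lambda>k x. f k x - g k x)"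
  shows "(\<Sum>k\<in>{1..n}. \<integral>\<^sup>+ x. ennreal ((cmod (f k x - g k x))^2) \<partial>M k) = ennreal (tuple_norm2 n M (\<lambda>k x. f k x - g k x))"
proof -
  have "(\<Sum>k\<in>{1..n}. \<integral>\<^sup>+ x. ennreal ((cmod (f k x - g k x))^2) \<partial>M k) = (\<Sum>k\<in>{1..n}. ennreal (LINT x|M k. (cmod (f k x - g k x))^2))"
    by (intro sum.cong refl nn_integral_eq_integral) (use assms in \<open>auto simp: tuple_L2_def L2_def\<close>)
  then show ?thesis by (simp add: tuple_norm2_def sum_ennreal)
qed

section \<open>Stability of the range of the transform under division by lam + t\<close>

context star begin

lemma Q_space: "x \<in> space (Q j) \<longleftrightarrow> a j < x"
  by (simp add: qmeasure_def)

lemma graph_cong_AE: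
  assumes graph: "graph w \<eta>" and m: "\<And>k. k \<in> {1..n} \<Longrightarrow> \<eta>' k \<in> borel_measurable (Q k)"
    and eq: "\<And>k. k \<in> {1..n} \<Longrightarrow> AE x in Q k. \<eta> k x = \<eta>' k x"
  shows "graph w \<eta>'"
proof (rule graph_pointwise[OF graph graph_L2(1)[OF graph] _ m])
  show "(\<lambda>i. tuple_norm2 n Hm (\<lambda>k x. w k x - w k x)) \<longlonglongrightarrow> 0" by (simp add: tuple_norm2_def)
  fix k assume "k \<in> {1..n}"
  from eq[OF this] show "AE x in Q k. (\<lambda>i. \<eta> k x) \<longlonglongrightarrow> \<eta>' k x" by eventually_elim simp
qed

text \<open>Besides a transform it supplies approximants with integer exponents, those for which the
  resolvent is given by an explicit formula.\<close>

lemma graph_exists: assumes u: "tuple_L2 n Hm u" shows "\<exists>\<eta> e v. graph u \<eta> \<and> (\<forall>i. exp_span \<nat> (e i) (v i)) \<and> (\<lambda>i. tuple_norm2 n Q (\<lambda>k x. v i k x - \<eta> k x)) \<longlonglongrightarrow> 0"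
proof -
  have "\<exists>f v. exp_span \<nat> f v \<and> tuple_norm2 n Hm (\<lambda>k x. u k x - f k x) < inverse (real (Suc i))" for i
    by (rule exp_span_dense[OF u]) simp
  then have "\<forall>i. \<exists>p. exp_span \<nat> (fst p) (snd p) \<and> tuple_norm2 n Hm (\<lambda>k x. u k x - fst p k x) < inverse (real (Suc i))"
    by (simp only: split_paired_Ex fst_conv snd_conv) blast
  from choice[OF this] obtain p where p: "\<forall>i. exp_span \<nat> (fst (p i)) (snd (p i)) \<and> tuple_norm2 n Hm (\<lambda>k x. u k x - fst (p i) k x) < inverse (real (Suc i))" ..
  have s: "exp_span \<nat> (fst (p i)) (snd (p i))" for i using p by blast
  have b: "norm (tuple_norm2 n Hm (\<lambda>k x. fst (p i) k x - u k x)) \<le> inverse (real (Suc i))" for i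
    using p tuple_norm2_minus_commute[of n Hm "fst (p i)" u] by (simp add: less_imp_le del: of_nat_Suc)
  have lim: "(\<lambda>i. tuple_norm2 n Hm (\<lambda>k x. fst (p i) k x - u k x)) \<longlonglongrightarrow> 0"
    by (rule Lim_null_comparison[OF always_eventually[OF allI[OF b]] LIMSEQ_inverse_real_of_nat])
  obtain \<eta> where "graph u \<eta>" "(\<lambda>i. tuple_norm2 n Q (\<lambda>k x. snd (p i) k x - \<eta> k x)) \<longlonglongrightarrow> 0"
    using graph_complete_left[OF graph_S[OF exp_span_pos[OF s]] u lim] by (elim exE conjE) (rule that)
  then show ?thesis using s by (intro exI[of _ \<eta>] exI[of _ "\<lambda>i. fst (p i)"] exI[of _ "\<lambda>i. snd (p i)"]) blast
qed

definition div_shift :: "real \<Rightarrow> (nat \<Rightarrow> real \<Rightarrow> complex) \<Rightarrow> nat \<Rightarrow> real \<Rightarrow> complex" where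
  "div_shift t \<eta> = (\<lambda>k x. \<eta> k x / of_real (x + t))"

lemma div_shift_measurable: assumes "\<eta> k \<in> borel_measurable (Q k)" shows "div_shift t \<eta> k \<in> borel_measurable (Q k)"
proof -
  have "(\<lambda>x. complex_of_real (x + t)) \<in> borel_measurable (Q k)"
    by (rule borel_imp_Q) (intro borel_measurable_continuous_onI continuous_intros)
  then show ?thesis unfolding div_shift_def using assms by (intro borel_measurable_divide)
qed

lemma div_shift_bound:
  assumes k: "k \<in> {1..n}" and t: "0 < t" and x: "x \<in> space (Q k)"
  shows "(cmod (div_shift t \<eta> k x))^2 \<le> (1/t)^2 * (cmod (\<eta> k x))^2"
proof -
  have xt: "t \<le> x + t" "0 < x + t" using x a_nonneg[OF k] t by (simp_all add: Q_space)
  have n: "cmod (of_real (x + t)) = x + t" using xt(2) by (simp only: norm_of_real)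
  have "cmod (div_shift t \<eta> k x) \<le> cmod (\<eta> k x) / t"
    unfolding div_shift_def norm_divide n using xt t by (intro divide_left_mono) auto
  from power_mono[OF this, of 2] show ?thesis by (simp add: power_divide)
qed

lemma div_shift_tuple_L2: assumes \<eta>: "tuple_L2 n Q \<eta>" and t: "0 < t" shows "tuple_L2 n Q (div_shift t \<eta>)" "tuple_norm2 n Q (div_shift t \<eta>) \<le> (1/t)^2 * tuple_norm2 n Q \<eta>"
proof -
  have i: "integrable (Q k) (\<lambda>x. (1/t)^2 * (cmod (\<eta> k x))^2)" if "k \<in> {1..n}" for k
    using \<eta> that by (intro integrable_mult_right L2_integrable) (simp add: tuple_L2_def)
  have L: "L2 (Q k) (div_shift t \<eta> k)" if k: "k \<in> {1..n}" for k
    by (rule L2_bound[OF div_shift_measurable[of \<eta>, OF tuple_L2_measurable[OF \<eta> k]] i[OF k] div_shift_bound[OF k t]])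
  then show "tuple_L2 n Q (div_shift t \<eta>)" by (simp add: tuple_L2_def)
  show "tuple_norm2 n Q (div_shift t \<eta>) \<le> (1/t)^2 * tuple_norm2 n Q \<eta>"
    unfolding tuple_norm2_def sum_distrib_left
  proof (rule sum_mono)
    fix k assume k: "k \<in> {1..n}"
    have "(LINT x|Q k. (cmod (div_shift t \<eta> k x))^2) \<le> (LINT x|Q k. (1/t)^2 * (cmod (\<eta> k x))^2)"
      by (rule integral_mono[OF L2_integrable[OF L[OF k]] i[OF k] div_shift_bound[OF k t]])
    then show "(LINT x|Q k. (cmod (div_shift t \<eta> k x))^2) \<le> (1/t)^2 * (LINT x|Q k. (cmod (\<eta> k x))^2)" by simp
  qed
qed

lemma tuple_inner_cong_space:
  assumes "\<And>k x. k \<in> {1..n} \<Longrightarrow> x \<in> space (M k) \<Longrightarrow> u k x * cnj (v k x) = u' k x * cnj (v' k x)"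
  shows "tuple_inner n M u v = tuple_inner n M u' v'"
  unfolding tuple_inner_def by (intro sum.cong refl Bochner_Integration.integral_cong) (use assms in auto)

lemma tuple_inner_res_transform:
  assumes t: "nonresonant t" and m: "1 \<le> m" and k: "k \<in> {1..n}"
  shows "tuple_inner n Q \<eta> (res_transform t m k) = tuple_inner n Q (div_shift t \<eta>) (vv (real m) k)"
proof (rule tuple_inner_cong_space)
  fix j x assume j: "j \<in> {1..n}" and x: "x \<in> space (Q j)"
  show "\<eta> j x * cnj (res_transform t m k j x) = div_shift t \<eta> j x * cnj (vv (real m) k j x)"
    using res_transform_eq[OF t m k j, of x] x by (simp add: div_shift_def Q_space del: of_real_add)
qed

lemma exp_span_div_shift:
  assumes t: "nonresonant t" and "exp_span \<nat> e v"
  shows "\<exists>r y. exp_span {0<..} r y \<and> (\<forall>j\<in>{1..n}. \<forall>x>a j. y j x = div_shift t v j x)"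
  using assms(2)
proof induction
  case zero
  show ?case by (rule exI, rule exI, rule conjI, rule exp_span.zero) (simp add: div_shift_def)
next
  case (step e v \<kappa> k b)
  obtain r y where r: "exp_span {0<..} r y" "\<forall>j\<in>{1..n}. \<forall>x>a j. y j x = div_shift t v j x" using step by blast
  obtain m where m: "\<kappa> = real m" using step(2) by (auto elim: Nats_cases)
  have m1: "1 \<le> m" using step(3) m by simp
  from exp_span_add[OF exp_span_scale[OF exp_span_res[OF t m1 step(4)], of b] r(1)]
  show ?case
  proof (intro exI conjI)
    show "\<forall>j\<in>{1..n}. \<forall>x>a j. y j x + b * res_transform t m k j x = div_shift t (\<lambda>j x. v j x + b * vv \<kappa> k j x) j x"
      using r(2) res_transform_eq[OF t m1 step(4)] by (auto simp: div_shift_def m add_divide_distrib simp del: of_real_add)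
  qed
qed

text \<open>For sums of exponentials with integer rates, division by lam + t is the transform of an
  explicit resolvent. The quotient is bounded by 1 / t because the spectrum is nonnegative, so the
  property passes to limits, and the closed range supplies g.\<close>

lemma graph_div_shift: assumes t: "nonresonant t" and graph: "graph f \<eta>" shows "\<exists>g. graph g (div_shift t \<eta>)"
proof -
  have t0: "0 < t" using t by (simp add: nonresonant_def)
  \<comment> \<open>The given transform may come with arbitrary positive exponents; a second
    transform of f, at distance zero from it, is taken for its approximants with integer
    exponents.\<close>
  obtain \<eta>' e v where G': "graph f \<eta>'" and s: "\<And>i. exp_span \<nat> (e i) (v i)" and l: "(\<lambda>i. tuple_norm2 n Q (\<lambda>k x. v i k x - \<eta>' k x)) \<longlonglongrightarrow> 0"
    using graph_exists[OF graph_L2(1)[OF graph]] by blast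
  note L = graph_L2(2)[OF graph] and L' = graph_L2(2)[OF G']
  have z: "tuple_norm2 n Q (\<lambda>k x. \<eta>' k x - \<eta> k x) = 0"
    using graph_iso_diff[OF G' graph] by (simp add: tuple_norm2_def)
  have vL: "tuple_L2 n Q (v i)" for i using exp_span_L2[OF s] by simp
  have "\<forall>i. \<exists>p. exp_span {0<..} (fst p) (snd p) \<and> (\<forall>j\<in>{1..n}. \<forall>x>a j. snd p j x = div_shift t (v i) j x)"
    using exp_span_div_shift[OF t s] by (simp only: split_paired_Ex fst_conv snd_conv) blast
  from choice[OF this] obtain p where p: "\<forall>i. exp_span {0<..} (fst (p i)) (snd (p i)) \<and> (\<forall>j\<in>{1..n}. \<forall>x>a j. snd (p i) j x = div_shift t (v i) j x)" ..
  have GG: "graph (fst (p i)) (snd (p i))" for i using p graph_S by blast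
  have eq: "tuple_norm2 n Q (\<lambda>k x. snd (p i) k x - div_shift t \<eta> k x) = tuple_norm2 n Q (div_shift t (\<lambda>k x. v i k x - \<eta> k x))" for i
    unfolding tuple_norm2_def
  proof (intro sum.cong refl Bochner_Integration.integral_cong)
    fix j x assume "j \<in> {1..n}" "x \<in> space (Q j)"
    then have "snd (p i) j x = div_shift t (v i) j x" using p by (simp only: Q_space)
    then show "(cmod (snd (p i) j x - div_shift t \<eta> j x))^2 = (cmod (div_shift t (\<lambda>k x. v i k x - \<eta> k x) j x))^2"
      by (simp add: div_shift_def diff_divide_distrib)
  qed
  have b: "norm (tuple_norm2 n Q (\<lambda>k x. snd (p i) k x - div_shift t \<eta> k x)) \<le> (1/t)^2 * (2 * tuple_norm2 n Q (\<lambda>k x. v i k x - \<eta>' k x))" for i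
  proof -
    have "tuple_norm2 n Q (div_shift t (\<lambda>k x. v i k x - \<eta> k x)) \<le> (1/t)^2 * tuple_norm2 n Q (\<lambda>k x. v i k x - \<eta> k x)"
      by (rule div_shift_tuple_L2(2)[OF tuple_L2_diff[OF vL L] t0])
    also have "\<dots> \<le> (1/t)^2 * (2 * tuple_norm2 n Q (\<lambda>k x. v i k x - \<eta>' k x))"
      using tuple_norm2_triangle[OF vL[of i] L' L] z by (intro mult_left_mono) auto
    finally show ?thesis by (simp add: eq)
  qed
  have "(\<lambda>i. (1/t)^2 * (2 * tuple_norm2 n Q (\<lambda>k x. v i k x - \<eta>' k x))) \<longlonglongrightarrow> (1/t)^2 * (2 * 0)"
    by (rule tendsto_mult[OF tendsto_const tendsto_mult[OF tendsto_const l]])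
  then have b0: "(\<lambda>i. (1/t)^2 * (2 * tuple_norm2 n Q (\<lambda>k x. v i k x - \<eta>' k x))) \<longlonglongrightarrow> 0" by simp
  have "(\<lambda>i. tuple_norm2 n Q (\<lambda>k x. snd (p i) k x - div_shift t \<eta> k x)) \<longlonglongrightarrow> 0"
    by (rule Lim_null_comparison[OF always_eventually[OF allI[OF b]] b0])
  from graph_complete_right[OF GG div_shift_tuple_L2(1)[OF L t0] this] show ?thesis by blast
qed

section \<open>The operator A as multiplication by lam\<close>

definition mult_lam :: "(nat \<Rightarrow> real \<Rightarrow> complex) \<Rightarrow> nat \<Rightarrow> real \<Rightarrow> complex" where
  "mult_lam \<psi> = (\<lambda>k x. of_real x * \<psi> k x)"

lemma mult_lam_measurable: assumes "\<psi> k \<in> borel_measurable (Q k)" shows "mult_lam \<psi> k \<in> borel_measurable (Q k)"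
  unfolding mult_lam_def
  by (rule borel_measurable_times[OF borel_imp_Q[OF borel_measurable_continuous_onI[OF continuous_on_of_real_id]] assms])

text \<open>Let \<eta> be the transform of f = w + t u and g the original of \<eta> / (lam + t).
  Symmetry of the resolvent makes the Laplace transforms of u and g agree at the integers, so u = g
  and \<psi> = \<eta> / (lam + t) almost everywhere; hence lam \<psi> = \<eta> - t \<psi> is the
  transform of w.\<close>

lemma A_rel_imp_mult_lam:
  assumes graph: "graph u \<psi>" and A: "A_rel n c a u w"
  shows "tuple_L2 n Q (mult_lam \<psi>)" "graph w (mult_lam \<psi>)"
proof -
  obtain t where t: "nonresonant t" using nonresonant_exists by blast
  have t0: "0 < t" using t by (simp add: nonresonant_def)
  have u: "tuple_L2 n Hm u" and w: "tuple_L2 n Hm w" using A_rel_imp_laplace[OF A] by auto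
  define f where "f = (\<lambda>k x. w k x + of_real t * u k x)"
  have f: "tuple_L2 n Hm f" unfolding f_def by (intro tuple_L2_add tuple_L2_scale u w)
  obtain \<eta> where graph\<eta>: "graph f \<eta>" using graph_exists[OF f] by blast
  obtain g where Gg: "graph g (div_shift t \<eta>)" using graph_div_shift[OF t graph\<eta>] by blast
  note D = graph_diff[OF graph Gg]
  have "laplace (u k) (real m) - laplace (g k) (real m) = 0" if m: "1 \<le> m" and k: "k \<in> {1..n}" for m k
  proof -
    have m0: "0 < real m" using m by simp
    have e: "graph (edge_exp (real m) k) (vv (real m) k)" by (rule graph_S[OF exp_span_single]) (use m0 k in auto)
    have "laplace (u k) (real m) = tuple_inner n Hm f (res_exp t m k)"
      using A_rel_imp_res_laplace[OF A t m k] unfolding tuple_inner_res_exp[OF t m k f] f_def[symmetric] .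
    also have "\<dots> = tuple_inner n Q \<eta> (res_transform t m k)" by (rule graph_tuple_inner[OF graph\<eta> graph_S[OF exp_span_res[OF t m k]]])
    also have "\<dots> = tuple_inner n Q (div_shift t \<eta>) (vv (real m) k)" by (rule tuple_inner_res_transform[OF t m k])
    also have "\<dots> = tuple_inner n Hm g (edge_exp (real m) k)" by (rule graph_tuple_inner[OF Gg e, symmetric])
    also have "\<dots> = laplace (g k) (real m)" by (rule tuple_inner_edge_exp[OF k])
    finally show ?thesis by simp
  qed
  then have "laplace (\<lambda>x. u k x - g k x) (real m) = 0" if "1 \<le> m" "k \<in> {1..n}" for m k
    using that u graph_L2(1)[OF Gg] by (subst laplace_diff) (auto intro!: exp_weighted_L2 simp: tuple_L2_def)
  then have "tuple_norm2 n Hm (\<lambda>k x. u k x - g k x) = 0" by (intro exp_span_total graph_L2(1)[OF D])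
  then have z: "tuple_norm2 n Q (\<lambda>k x. \<psi> k x - div_shift t \<eta> k x) = 0" using graph_iso[OF D] by simp
  have ae: "AE x in Q k. \<eta> k x - of_real t * \<psi> k x = mult_lam \<psi> k x" if k: "k \<in> {1..n}" for k
  proof -
    have L: "L2 (Q k) (\<lambda>x. \<psi> k x - div_shift t \<eta> k x)" using graph_L2(2)[OF D] k by (simp add: tuple_L2_def)
    have "(LINT x|Q k. (cmod (\<psi> k x - div_shift t \<eta> k x))^2) \<le> 0"
      unfolding z[symmetric] tuple_norm2_def by (rule member_le_sum[OF k]) auto
    moreover have "0 \<le> (LINT x|Q k. (cmod (\<psi> k x - div_shift t \<eta> k x))^2)" by simp
    ultimately have "(LINT x|Q k. (cmod (\<psi> k x - div_shift t \<eta> k x))^2) = 0" by (rule antisym)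
    then have "AE x in Q k. (cmod (\<psi> k x - div_shift t \<eta> k x))^2 = 0"
      by (subst (asm) integral_nonneg_eq_0_iff_AE) (use L2_integrable[OF L] in auto)
    moreover have "AE x in Q k. a k < x" by (rule AE_I2) (simp add: Q_space)
    ultimately show ?thesis
    proof eventually_elim
      case (elim x)
      have "complex_of_real (x + t) \<noteq> 0" using elim(2) a_nonneg[OF k] t0 by (simp only: of_real_eq_0_iff)
      moreover have "\<psi> k x = \<eta> k x / of_real (x + t)" using elim(1) by (simp add: div_shift_def)
      ultimately have "\<eta> k x = of_real (x + t) * \<psi> k x" by simp
      then show ?case by (simp add: mult_lam_def algebra_simps)
    qed
  qed
  have "graph (\<lambda>k x. f k x - of_real t * u k x) (\<lambda>k x. \<eta> k x - of_real t * \<psi> k x)"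
    by (rule graph_diff[OF graph\<eta> graph_scale[OF graph]])
  then have "graph w (\<lambda>k x. \<eta> k x - of_real t * \<psi> k x)" by (simp add: f_def)
  from graph_cong_AE[OF this mult_lam_measurable[of \<psi>, OF tuple_L2_measurable[OF graph_L2(2)[OF graph]]] ae]
  show "graph w (mult_lam \<psi>)" .
  then show "tuple_L2 n Q (mult_lam \<psi>)" by (rule graph_L2)
qed

text \<open>For lam >= 0 the factors t - t^2 / (lam + t) = t lam / (lam + t) increase to lam, so lam
  \<psi> is a dominated limit of transforms and the closed range supplies w. That w equals A u is
  then checked through the resolvent at one fixed t.\<close>

lemma mult_lam_imp_A_rel:
  assumes graph: "graph u \<psi>" and L: "tuple_L2 n Q (mult_lam \<psi>)"
  shows "\<exists>w. A_rel n c a u w \<and> graph w (mult_lam \<psi>)"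
proof -
  have "\<forall>i::nat. \<exists>t. real (Suc i) < t \<and> nonresonant t" using nonresonant_exists by blast
  from choice[OF this] obtain T where T: "\<And>i. real (Suc i) < T i" "\<And>i. nonresonant (T i)" by blast
  have T0: "0 < T i" for i using T(2)[of i] by (simp add: nonresonant_def)
  have "\<forall>i. \<exists>g. graph g (div_shift (T i) \<psi>)" using graph_div_shift[OF T(2) graph] by blast
  from choice[OF this] obtain g where g: "\<And>i. graph (g i) (div_shift (T i) \<psi>)" by blast
  define \<eta> where "\<eta> = (\<lambda>i k x. of_real (T i) * \<psi> k x - of_real ((T i)^2) * div_shift (T i) \<psi> k x)"
  have GG: "graph (\<lambda>k x. of_real (T i) * u k x - of_real ((T i)^2) * g i k x) (\<eta> i)" for i
    unfolding \<eta>_def by (intro graph_diff graph_scale graph g)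
  have \<eta>m: "\<eta> i k \<in> borel_measurable (Q k)" if "k \<in> {1..n}" for i k
    by (rule tuple_L2_measurable[OF graph_L2(2)[OF GG] that])
  have mm: "mult_lam \<psi> k \<in> borel_measurable (Q k)" if "k \<in> {1..n}" for k by (rule tuple_L2_measurable[OF L that])
  \<comment> \<open>The relative error is -x / (x + T i), of modulus at most 1 and tending to 0;
    this gives both the majorant and the pointwise limit.\<close>
  have dif: "\<eta> i k x - mult_lam \<psi> k x = - of_real (x / (x + T i)) * mult_lam \<psi> k x" if x: "x \<in> space (Q k)" and k: "k \<in> {1..n}" for i k x
  proof -
    have "0 < x + T i" using x a_nonneg[OF k] T0[of i] by (simp add: Q_space)
    then have "complex_of_real x + of_real (T i) \<noteq> 0" by (simp flip: of_real_add)
    then show ?thesis by (simp add: \<eta>_def mult_lam_def div_shift_def field_simps power2_eq_square)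
  qed
  have comp: "(\<lambda>i. LINT x|Q k. (cmod (\<eta> i k x - mult_lam \<psi> k x))^2) \<longlonglongrightarrow> (LINT x|Q k. 0)" if k: "k \<in> {1..n}" for k
  proof (rule integral_dominated_convergence[where w="\<lambda>x. (cmod (mult_lam \<psi> k x))^2"])
    show "integrable (Q k) (\<lambda>x. (cmod (mult_lam \<psi> k x))^2)" using L k by (intro L2_integrable) (simp add: tuple_L2_def)
    show "(\<lambda>x. (cmod (\<eta> i k x - mult_lam \<psi> k x))^2) \<in> borel_measurable (Q k)" for i
      using \<eta>m[OF k, of i] mm[OF k] by measurable
    show "AE x in Q k. (\<lambda>i. (cmod (\<eta> i k x - mult_lam \<psi> k x))^2) \<longlonglongrightarrow> 0"
    proof (rule AE_I2)
      fix x assume x: "x \<in> space (Q k)"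
      have x0: "0 \<le> x" using x a_nonneg[OF k] by (simp add: Q_space)
      have "(\<lambda>i. x / (x + T i)) \<longlonglongrightarrow> 0"
      proof (rule Lim_null_comparison[OF always_eventually])
        show "(\<lambda>i. x * inverse (real (Suc i))) \<longlonglongrightarrow> 0"
          by (rule tendsto_mult_right_zero[OF LIMSEQ_inverse_real_of_nat])
        show "\<forall>i. norm (x / (x + T i)) \<le> x * inverse (real (Suc i))"
        proof
          fix i
          have "x / (x + T i) \<le> x / real (Suc i)" using x0 T(1)[of i] by (intro divide_left_mono mult_pos_pos) auto
          then show "norm (x / (x + T i)) \<le> x * inverse (real (Suc i))" using x0 T0[of i] by (simp add: divide_inverse)
        qed
      qed
      then have "(\<lambda>i. (cmod (- of_real (x / (x + T i)) * mult_lam \<psi> k x))^2) \<longlonglongrightarrow> (cmod (- of_real 0 * mult_lam \<psi> k x))^2"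
        by (intro tendsto_power tendsto_norm tendsto_mult tendsto_minus tendsto_of_real tendsto_const)
      then show "(\<lambda>i. (cmod (\<eta> i k x - mult_lam \<psi> k x))^2) \<longlonglongrightarrow> 0" by (simp add: dif[OF x k])
    qed
    show "AE x in Q k. norm ((cmod (\<eta> i k x - mult_lam \<psi> k x))^2) \<le> (cmod (mult_lam \<psi> k x))^2" for i
    proof (rule AE_I2)
      fix x assume x: "x \<in> space (Q k)"
      have x0: "0 \<le> x" using x a_nonneg[OF k] by (simp add: Q_space)
      have "\<bar>x / (x + T i)\<bar> \<le> 1" using x0 T0[of i] by (simp add: divide_le_eq)
      then have "cmod (\<eta> i k x - mult_lam \<psi> k x) \<le> 1 * cmod (mult_lam \<psi> k x)"
        unfolding dif[OF x k] norm_mult norm_minus_cancel norm_of_real by (intro mult_right_mono) auto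
      from power_mono[OF this, of 2] show "norm ((cmod (\<eta> i k x - mult_lam \<psi> k x))^2) \<le> (cmod (mult_lam \<psi> k x))^2" by simp
    qed
  qed simp
  have "(\<lambda>i. tuple_norm2 n Q (\<lambda>k x. \<eta> i k x - mult_lam \<psi> k x)) \<longlonglongrightarrow> (\<Sum>k\<in>{1..n}. LINT x|Q k. 0)"
    unfolding tuple_norm2_def by (intro tendsto_sum comp)
  then have lim: "(\<lambda>i. tuple_norm2 n Q (\<lambda>k x. \<eta> i k x - mult_lam \<psi> k x)) \<longlonglongrightarrow> 0" by simp
  obtain w where Gw: "graph w (mult_lam \<psi>)" using graph_complete_right[OF GG L lim] by blast
  obtain t where t: "nonresonant t" using nonresonant_exists by blast
  define f where "f = (\<lambda>k x. w k x + of_real t * u k x)"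
  have Gf: "graph f (\<lambda>k x. mult_lam \<psi> k x + of_real t * \<psi> k x)" unfolding f_def by (intro graph_add graph_scale Gw graph)
  have "A_rel n c a u w"
  proof (rule res_laplace_imp_A_rel[OF graph_L2(1)[OF graph] graph_L2(1)[OF Gw] t])
    fix m k assume m: "(1::nat) \<le> m" and k: "k \<in> {1..n}"
    have m0: "0 < real m" using m by simp
    have e: "graph (edge_exp (real m) k) (vv (real m) k)" by (rule graph_S[OF exp_span_single]) (use m0 k in auto)
    have "laplace (u k) (real m) = tuple_inner n Q \<psi> (vv (real m) k)" using graph_tuple_inner[OF graph e] by (simp only: tuple_inner_edge_exp[OF k])
    also have "\<dots> = tuple_inner n Q (div_shift t (\<lambda>k x. mult_lam \<psi> k x + of_real t * \<psi> k x)) (vv (real m) k)"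
    proof (rule tuple_inner_cong_space)
      fix j x assume j: "j \<in> {1..n}" and x: "x \<in> space (Q j)"
      have "0 < x + t" using x a_nonneg[OF j] t by (simp add: Q_space nonresonant_def)
      then have "complex_of_real (x + t) \<noteq> 0" by (simp only: of_real_eq_0_iff)
      then have "div_shift t (\<lambda>k x. mult_lam \<psi> k x + of_real t * \<psi> k x) j x = \<psi> j x"
        by (simp add: div_shift_def mult_lam_def distrib_right[symmetric] flip: of_real_add)
      then show "\<psi> j x * cnj (vv (real m) k j x) = div_shift t (\<lambda>k x. mult_lam \<psi> k x + of_real t * \<psi> k x) j x * cnj (vv (real m) k j x)" by simp
    qed
    also have "\<dots> = tuple_inner n Q (\<lambda>k x. mult_lam \<psi> k x + of_real t * \<psi> k x) (res_transform t m k)" by (rule tuple_inner_res_transform[OF t m k, symmetric])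
    also have "\<dots> = tuple_inner n Hm f (res_exp t m k)" by (rule graph_tuple_inner[OF Gf graph_S[OF exp_span_res[OF t m k]], symmetric])
    also have "\<dots> = res_laplace t (\<lambda>k x. w k x + of_real t * u k x) m k" unfolding tuple_inner_res_exp[OF t m k graph_L2(1)[OF Gf]] f_def[symmetric] ..
    finally show "laplace (u k) (real m) = res_laplace t (\<lambda>k x. w k x + of_real t * u k x) m k" .
  qed
  then show ?thesis using Gw by blast
qed

text \<open>On the nonnegative spectrum lam^2 <= 1 + lam^(2 (j + 1)). The induction removes one
  factor lam at a time, so the first power must be known to be square integrable before the others
  are treated.\<close>

lemma tuple_L2_mult_lam_lower:
  assumes \<psi>: "tuple_L2 n Q \<psi>" and L: "tuple_L2 n Q (\<lambda>k x. of_real x ^ Suc j * \<psi> k x)"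
  shows "tuple_L2 n Q (mult_lam \<psi>)"
  unfolding tuple_L2_def
proof
  fix k assume k: "k \<in> {1..n}"
  have i: "integrable (Q k) (\<lambda>x. (cmod (\<psi> k x))^2 + (cmod (of_real x ^ Suc j * \<psi> k x))^2)"
    using \<psi> L k by (intro Bochner_Integration.integrable_add L2_integrable) (auto simp: tuple_L2_def)
  show "L2 (Q k) (mult_lam \<psi> k)"
  proof (rule L2_bound[OF mult_lam_measurable[of \<psi>, OF tuple_L2_measurable[OF \<psi> k]] i])
    fix x assume x: "x \<in> space (Q k)"
    have x0: "0 \<le> x" using x a_nonneg[OF k] by (simp add: Q_space)
    have "x^2 \<le> 1 + (x ^ Suc j)^2"
    proof (cases "x \<le> 1")
      case True
      then have "x^2 \<le> 1" using x0 by (simp add: power_le_one)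
      then show ?thesis by (simp add: add_increasing2)
    next
      case False
      then have "x^1 \<le> x ^ Suc j" by (intro power_increasing) auto
      then have "x^2 \<le> (x ^ Suc j)^2" using x0 by (intro power_mono) auto
      then show ?thesis by simp
    qed
    then have "x^2 * (cmod (\<psi> k x))^2 \<le> (1 + (x ^ Suc j)^2) * (cmod (\<psi> k x))^2" by (rule mult_right_mono) simp
    then show "(cmod (mult_lam \<psi> k x))^2 \<le> (cmod (\<psi> k x))^2 + (cmod (of_real x ^ Suc j * \<psi> k x))^2"
      using x0 by (simp add: mult_lam_def norm_mult norm_power power_mult_distrib distrib_right)
  qed
qed

text \<open>Each induction step replaces u by A u and \<psi> by lam \<psi>. The w in
  \<open>DA\<close> is given only by existence, but any such w has the transform lam \<psi>, which
  makes the step reversible.\<close>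

theorem DA_iff: "graph u \<psi> \<Longrightarrow> DA n c a j u \<longleftrightarrow> tuple_L2 n Q (\<lambda>k x. of_real x ^ j * \<psi> k x)"
proof (induction j arbitrary: u \<psi>)
  case 0
  then show ?case using graph_L2[OF 0] by (simp add: inH_def tuple_L2_def)
next
  case (Suc j)
  have eq: "(\<lambda>k x. of_real x ^ j * mult_lam \<psi> k x) = (\<lambda>k x. of_real x ^ Suc j * \<psi> k x)" for j
    by (simp add: mult_lam_def fun_eq_iff mult_ac)
  show ?case
  proof
    assume "DA n c a (Suc j) u"
    then obtain w where w: "A_rel n c a u w" "DA n c a j w" by auto
    show "tuple_L2 n Q (\<lambda>k x. of_real x ^ Suc j * \<psi> k x)"
      using Suc.IH[OF A_rel_imp_mult_lam(2)[OF Suc.prems w(1)]] w(2) unfolding eq by simp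
  next
    assume L: "tuple_L2 n Q (\<lambda>k x. of_real x ^ Suc j * \<psi> k x)"
    from mult_lam_imp_A_rel[OF Suc.prems tuple_L2_mult_lam_lower[OF graph_L2(2)[OF Suc.prems] L]]
    obtain w where w: "A_rel n c a u w" "graph w (mult_lam \<psi>)" by blast
    have "DA n c a j w" using Suc.IH[OF w(2)] L unfolding eq by simp
    then show "DA n c a (Suc j) u" using w(1) by auto
  qed
qed

text \<open>The defining limit runs over test tuples, whose transforms lie in the closed relation by
  \<open>graph_test\<close>; so does the limit.\<close>

lemma graph_Vtilde:
  assumes u: "inH n u" and V: "is_Vtilde n c a u \<psi>"
  shows "graph u \<psi>"
proof -
  have uL: "tuple_L2 n Hm u" using u by (simp add: inH_def tuple_L2_def)
  have \<psi>L: "tuple_L2 n Q \<psi>" using V by (simp add: is_Vtilde_def inL2q_def tuple_L2_def)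
  obtain \<phi> where \<phi>: "\<forall>m. \<forall>k\<in>{1..n}. test_fun (\<phi> m k)" and l1: "(\<lambda>m. Hdist2 n (\<phi> m) u) \<longlonglongrightarrow> 0"
    and l2: "(\<lambda>m. L2q_dist2 n c a (V n c a (\<phi> m)) \<psi>) \<longlonglongrightarrow> 0"
    using V unfolding is_Vtilde_def by blast
  have graph: "graph (\<phi> m) (V n c a (\<phi> m))" for m by (rule graph_test) (use \<phi> in blast)
  have e1: "Hdist2 n (\<phi> m) u = ennreal (tuple_norm2 n Hm (\<lambda>k x. \<phi> m k x - u k x))" for m
    unfolding Hdist2_def by (rule nn_dist_eq_tuple_norm2[OF tuple_L2_diff[OF graph_L2(1)[OF graph] uL]])
  have e2: "L2q_dist2 n c a (V n c a (\<phi> m)) \<psi> = ennreal (tuple_norm2 n Q (\<lambda>k x. V n c a (\<phi> m) k x - \<psi> k x))" for m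
    unfolding L2q_dist2_def by (rule nn_dist_eq_tuple_norm2[OF tuple_L2_diff[OF graph_L2(2)[OF graph] \<psi>L]])
  have "(\<lambda>m. tuple_norm2 n Hm (\<lambda>k x. \<phi> m k x - u k x)) \<longlonglongrightarrow> 0" using l1 unfolding e1 by (simp add: ennreal_tendsto_0_iff)
  moreover have "(\<lambda>m. tuple_norm2 n Q (\<lambda>k x. V n c a (\<phi> m) k x - \<psi> k x)) \<longlonglongrightarrow> 0" using l2 unfolding e2 by (simp add: ennreal_tendsto_0_iff)
  ultimately show ?thesis by (rule graph_closed[OF graph uL \<psi>L])
qed

end

theorem theorem7p10:
  fixes n j :: nat and c a :: "nat \<Rightarrow> real"
    and u \<psi> :: "nat \<Rightarrow> real \<Rightarrow> complex"
  assumes "n \<ge> 2"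
    and "\<forall>k\<in>{1..n}. c k > 0"
    and "\<forall>k\<in>{1..n}. 0 \<le> a k"
    and "\<forall>i\<in>{1..n}. \<forall>k\<in>{1..n}. i \<le> k \<longrightarrow> a i \<le> a k"
    and "inH n u"
    and "is_Vtilde n c a u \<psi>"
  shows "(DA n c a j u \<longleftrightarrow> inL2q n c a (\<lambda>k lam. complex_of_real lam ^ j * \<psi> k lam))
       \<and> (inL2q n c a (\<lambda>k lam. complex_of_real lam ^ j * \<psi> k lam) \<longleftrightarrow>
          (\<forall>k\<in>{1..n}. L2 (qmeasure n c a k) (\<lambda>lam. complex_of_real lam ^ j * \<psi> k lam)))"
proof -
  interpret star n c a
    by unfold_locales (use assms in auto)
  show ?thesis
    using DA_iff[OF graph_Vtilde[OF assms(5,6)], of j] by (simp add: inL2q_def tuple_L2_def)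
qed

end
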